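(* Category HNN-extensions of groupoids $G$ whose associated submonoids are all subgroups are precisely left Rees categories $M\cong\mathcal{G}^{*}\bowtie G$ for some graph $\mathcal{G}$. That is: (a) if $M$ is a category HNN-extension of a groupoid $G$ such that each associated submonoid $H_i$ is a subgroup of $G$, then $M$ is a left Rees category and $M\cong\mathcal{G}^{*}\bowtie G$ for some directed graph $\mathcal{G}$ and some self-similar action of $G$ on $\mathcal{G}^*$; and (b) every left Rees category $M\cong\mathcal{G}^{*}\bowtie G$ is isomorphic to a category HNN-extension of the groupoid $G$ in which each associated submonoid is a subgroup of $G$.
   Context: All categories are small and treated as sets of arrows with partial multiplication, objects being identified with identity arrows; each arrow $x$ has a domain $\mathbf{d}(x)$ and codomain $\mathbf{r}(x)$ with $x=x\mathbf{d}(x)=\mathbf{r}(x)x$, and $xy$ is defined iff $\mathbf{d}(x)=\mathbf{r}(y)$. $C_0$ is the set of identities and $C_1$ the set of non-identity arrows. $C$ is right rigid if $xC\cap yC\neq\emptyset$ implies $xC\subseteq yC$ or $yC\subseteq xC$. A left Rees category is a small category which is left cancellative, right rigid, and in which each principal right ideal $xC$ is properly contained in only finitely many distinct principal right ideals. The free category $\mathcal{G}^*$ on a directed graph $\mathcal{G}$ has the vertices as identities and non-empty composable sequences of edges as non-identity arrows, under concatenation. Category HNN-extension: let $C$ be a category with category presentation $\langle\mathcal{K}\,|\,\mathcal{R}(C)\rangle$ ($\mathcal{K}$ a directed graph with $\mathcal{K}_0=C_0$), $I$ an index set, $H_i$ ($i\in I$) submonoids of $C$ and $\alpha_i:H_i\to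 C$ functors. Let $e_i,f_i$ be the identities with $H_i\subseteq e_iCe_i$ and $\alpha_i(H_i)\subseteq f_iCf_i$. Let $\mathcal{H}$ be the graph obtained from $\mathcal{K}$ by adding one new edge $t_i$ for each $i\in I$ with $\mathbf{r}(t_i)=e_i$, $\mathbf{d}(t_i)=f_i$. The category HNN-extension of $C$ is the category with category presentation $\langle\mathcal{H}\,|\,\mathcal{R}(C),\ xt_i=t_i\alpha_i(x)\ \forall x\in H_i,\ i\in I\rangle$; the $H_i$ are its associated submonoids. A subgroup of a groupoid $G$ is a subgroup of some local group $eGe$. A self-similar action of a groupoid $G$ on a category $C$, where $G_0$ and $C_0$ are identified, consists of functions $(g,x)\mapsto g\cdot x\in C$ and $(g,x)\mapsto g|_x\in G$ defined on pairs with $g^{-1}g=\mathbf{r}(x)$ such that: (C1) $\mathbf{r}(g\cdot x)=gg^{-1}$; (C2) $\mathbf{d}(g\cdot x)=g|_x(g|_x)^{-1}$; (C3) $\mathbf{d}(x)=(g|_x)^{-1}g|_x$; (SS1) $\mathbf{r}(x)\cdot x=x$; (SS2) if $gh$ is defined and $h^{-1}h=\mathbf{r}(x)$ then $(gh)\cdot x=g\cdot(h\cdot x)$; (SS3) $gg^{-1}=g\cdot g^{-1}g$; (SS4) $\mathbf{r}(x)|_x=\mathbf{d}(x)$; (SS5) $g|_{g^{-1}g}=g$; (SS6) if $xy$ is defined and $g^{-1}g=\mathbf{r}(x)$ then $g|_{xy}=(g|_x)|_y$; (SS7) if $gh$ is defined and $h^{-1}h=\mathbf{r}(x)$ then $(gh)|_x=g|_{h\cdot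 x}h|_x$; (SS8) if $xy$ is defined and $g^{-1}g=\mathbf{r}(x)$ then $g\cdot(xy)=(g\cdot x)(g|_x\cdot y)$. The Zappa-Szép product $C\bowtie G$ is the category with arrows $\{(x,g)\in C\times G:\mathbf{d}(x)=gg^{-1}\}$ and product $(x,g)(y,h)=(x(g\cdot y),g|_yh)$, defined when $g^{-1}g=\mathbf{r}(y)$. *)

theory Defs
  imports "HOL-Algebra.Group" "Graph_Theory.Arc_Walk"
begin

section \<open>Categories as sets of arrows\<close>

text \<open>
  Objects are identified with identity arrows. The product \<open>x \<cdot> y\<close> is meaningful only if
  \<open>Dom x = Ran y\<close>; the value of the operation on other pairs is irrelevant.
\<close>

record 'a arrow_cat =
  Arr :: "'a set"
  Dom :: "'a \<Rightarrow> 'a"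
  Ran :: "'a \<Rightarrow> 'a"
  Mul :: "'a \<Rightarrow> 'a \<Rightarrow> 'a" (infixl "\<cdot>\<index>" 70)

definition Obj :: "'a arrow_cat \<Rightarrow> 'a set" where
  "Obj C = {e \<in> Arr C. Dom C e = e}"

locale category =
  fixes C :: "'a arrow_cat" (structure)
  assumes dom_closed: "x \<in> Arr C \<Longrightarrow> Dom C x \<in> Arr C"
    and ran_closed: "x \<in> Arr C \<Longrightarrow> Ran C x \<in> Arr C"
    and dom_dom: "x \<in> Arr C \<Longrightarrow> Dom C (Dom C x) = Dom C x"
    and ran_dom: "x \<in> Arr C \<Longrightarrow> Ran C (Dom C x) = Dom C x"
    and dom_ran: "x \<in> Arr C \<Longrightarrow> Dom C (Ran C x) = Ran C x"
    and ran_ran: "x \<in> Arr C \<Longrightarrow> Ran C (Ran C x) = Ran C x"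
    and mul_closed: "\<lbrakk>x \<in> Arr C; y \<in> Arr C; Dom C x = Ran C y\<rbrakk> \<Longrightarrow> x \<cdot> y \<in> Arr C"
    and dom_mul: "\<lbrakk>x \<in> Arr C; y \<in> Arr C; Dom C x = Ran C y\<rbrakk> \<Longrightarrow> Dom C (x \<cdot> y) = Dom C y"
    and ran_mul: "\<lbrakk>x \<in> Arr C; y \<in> Arr C; Dom C x = Ran C y\<rbrakk> \<Longrightarrow> Ran C (x \<cdot> y) = Ran C x"
    and mul_assoc: "\<lbrakk>x \<in> Arr C; y \<in> Arr C; z \<in> Arr C; Dom C x = Ran C y; Dom C y = Ran C z\<rbrakk>
                      \<Longrightarrow> (x \<cdot> y) \<cdot> z = x \<cdot> (y \<cdot> z)"
    and mul_dom: "x \<in> Arr C \<Longrightarrow> x \<cdot> Dom C x = x"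
    and ran_mul_self: "x \<in> Arr C \<Longrightarrow> Ran C x \<cdot> x = x"

locale groupoid = category +
  assumes ex_inverse: "x \<in> Arr C \<Longrightarrow> \<exists>y \<in> Arr C. Dom C y = Ran C x \<and> Ran C y = Dom C x
                         \<and> x \<cdot> y = Ran C x \<and> y \<cdot> x = Dom C x"

definition cat_functor :: "'a arrow_cat \<Rightarrow> 'b arrow_cat \<Rightarrow> ('a \<Rightarrow> 'b) \<Rightarrow> bool" where
  "cat_functor C D F \<longleftrightarrow> category C \<and> category D \<and> F ` Arr C \<subseteq> Arr D
     \<and> (\<forall>x \<in> Arr C. F (Dom C x) = Dom D (F x) \<and> F (Ran C x) = Ran D (F x))
     \<and> (\<forall>x \<in> Arr C. \<forall>y \<in> Arr C. Dom C x = Ran C y \<longrightarrow> F (x \<cdot>\<^bsub>C\<^esub> y) = F x \<cdot>\<^bsub>D\<^esub> F y)"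

definition cat_iso :: "'a arrow_cat \<Rightarrow> 'b arrow_cat \<Rightarrow> ('a \<Rightarrow> 'b) \<Rightarrow> bool" where
  "cat_iso C D F \<longleftrightarrow> cat_functor C D F \<and> bij_betw F (Arr C) (Arr D)"

definition isomorphic_cats :: "'a arrow_cat \<Rightarrow> 'b arrow_cat \<Rightarrow> bool" where
  "isomorphic_cats C D \<longleftrightarrow> (\<exists>F. cat_iso C D F)"


section \<open>Left Rees categories\<close>

definition principal_right_ideal :: "'a arrow_cat \<Rightarrow> 'a \<Rightarrow> 'a set" where
  "principal_right_ideal C x = {x \<cdot>\<^bsub>C\<^esub> y | y. y \<in> Arr C \<and> Dom C x = Ran C y}"

definition left_cancellative :: "'a arrow_cat \<Rightarrow> bool" where
  "left_cancellative C \<longleftrightarrow>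
     (\<forall>x \<in> Arr C. \<forall>y \<in> Arr C. \<forall>z \<in> Arr C.
        Dom C x = Ran C y \<and> Dom C x = Ran C z \<and> x \<cdot>\<^bsub>C\<^esub> y = x \<cdot>\<^bsub>C\<^esub> z \<longrightarrow> y = z)"

definition right_rigid :: "'a arrow_cat \<Rightarrow> bool" where
  "right_rigid C \<longleftrightarrow>
     (\<forall>x \<in> Arr C. \<forall>y \<in> Arr C.
        principal_right_ideal C x \<inter> principal_right_ideal C y \<noteq> {} \<longrightarrow>
        principal_right_ideal C x \<subseteq> principal_right_ideal C y \<or>
        principal_right_ideal C y \<subseteq> principal_right_ideal C x)"

definition left_Rees_category :: "'a arrow_cat \<Rightarrow> bool" where
  "left_Rees_category C \<longleftrightarrow> category C \<and> left_cancellative C \<and> right_rigid C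
     \<and> (\<forall>x \<in> Arr C. finite {P \<in> principal_right_ideal C ` Arr C. principal_right_ideal C x \<subset> P})"


section \<open>Free categories and category presentations\<close>

text \<open>
  An edge \<open>a\<close> of a directed graph is an arrow from \<open>tail a\<close> to \<open>head a\<close>, so its domain is its
  tail and its codomain is its head. An arrow of the free category is a triple \<open>(v, p, u)\<close>
  with codomain \<open>v\<close> and domain \<open>u\<close>, where the sequence \<open>p = [a\<^sub>1, \<dots>, a\<^sub>n]\<close> of edges satisfies
  \<open>tail a\<^sub>k = head a\<^bsub>k+1\<^esub>\<close>. Since \<open>awalk\<close> traverses edges from tail to head, the list is
  reversed. The triple \<open>(v, [], v)\<close> is the vertex \<open>v\<close>, regarded as an identity.
\<close>

type_synonym ('v, 'e) path = "'v \<times> 'e list \<times> 'v"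

definition free_category :: "('v, 'e) pre_digraph \<Rightarrow> ('v, 'e) path arrow_cat" where
  "free_category K =
     \<lparr> Arr = {(v, p, u). pre_digraph.awalk K u (rev p) v},
       Dom = (\<lambda>(v, p, u). (u, [], u)),
       Ran = (\<lambda>(v, p, u). (v, [], v)),
       Mul = (\<lambda>(v, p, u) (v', p', u'). (v, p @ p', u')) \<rparr>"

inductive_set cat_congruence :: "'a arrow_cat \<Rightarrow> ('a \<times> 'a) set \<Rightarrow> ('a \<times> 'a) set"
  for C :: "'a arrow_cat" and R :: "('a \<times> 'a) set" where
  base: "(x, y) \<in> R \<Longrightarrow> (x, y) \<in> cat_congruence C R"
| refl: "x \<in> Arr C \<Longrightarrow> (x, x) \<in> cat_congruence C R"
| sym: "(x, y) \<in> cat_congruence C R \<Longrightarrow> (y, x) \<in> cat_congruence C R"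
| trans: "\<lbrakk>(x, y) \<in> cat_congruence C R; (y, z) \<in> cat_congruence C R\<rbrakk>
            \<Longrightarrow> (x, z) \<in> cat_congruence C R"
| mul: "\<lbrakk>(x, y) \<in> cat_congruence C R; (u, v) \<in> cat_congruence C R; Dom C x = Ran C u\<rbrakk>
          \<Longrightarrow> (x \<cdot>\<^bsub>C\<^esub> u, y \<cdot>\<^bsub>C\<^esub> v) \<in> cat_congruence C R"

definition quotient_category :: "'a arrow_cat \<Rightarrow> ('a \<times> 'a) set \<Rightarrow> 'a set arrow_cat" where
  "quotient_category C \<theta> =
     \<lparr> Arr = Arr C // \<theta>,
       Dom = (\<lambda>X. \<Union>x\<in>X. \<theta> `` {Dom C x}),
       Ran = (\<lambda>X. \<Union>x\<in>X. \<theta> `` {Ran C x}),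
       Mul = (\<lambda>X Y. \<Union>x\<in>X. \<Union>y\<in>Y. \<theta> `` {x \<cdot>\<^bsub>C\<^esub> y}) \<rparr>"

definition parallel_pairs :: "'a arrow_cat \<Rightarrow> ('a \<times> 'a) set" where
  "parallel_pairs C =
     {(x, y). x \<in> Arr C \<and> y \<in> Arr C \<and> Dom C x = Dom C y \<and> Ran C x = Ran C y}"

definition path_class ::
  "('v, 'e) pre_digraph \<Rightarrow> (('v, 'e) path \<times> ('v, 'e) path) set \<Rightarrow> ('v, 'e) path
     \<Rightarrow> ('v, 'e) path set" where
  "path_class K R p = cat_congruence (free_category K) R `` {p}"

definition presented_category ::
  "('v, 'e) pre_digraph \<Rightarrow> (('v, 'e) path \<times> ('v, 'e) path) set
     \<Rightarrow> ('v, 'e) path set arrow_cat" where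
  "presented_category K R =
     quotient_category (free_category K) (cat_congruence (free_category K) R)"

text \<open>
  \<open>\<langle>K | R\<rangle>\<close> is a presentation of \<open>C\<close>, where \<open>\<epsilon>\<close> sends the class of a path to the arrow of \<open>C\<close>
  it represents. The vertices of \<open>K\<close> are the objects of \<open>C\<close>, and \<open>\<epsilon>\<close> respects this.
\<close>

definition category_presentation ::
  "'a arrow_cat \<Rightarrow> ('a, 'k) pre_digraph \<Rightarrow> (('a, 'k) path \<times> ('a, 'k) path) set
     \<Rightarrow> (('a, 'k) path set \<Rightarrow> 'a) \<Rightarrow> bool" where
  "category_presentation C K R \<epsilon> \<longleftrightarrow>
     wf_digraph K \<and> verts K = Obj C \<and> R \<subseteq> parallel_pairs (free_category K)
     \<and> cat_iso (presented_category K R) C \<epsilon>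
     \<and> (\<forall>v \<in> verts K. \<epsilon> (path_class K R (v, [], v)) = v)"


section \<open>Category HNN-extensions\<close>

definition local_monoid :: "'a arrow_cat \<Rightarrow> 'a \<Rightarrow> 'a monoid" where
  "local_monoid C e =
     \<lparr> carrier = {x \<in> Arr C. Dom C x = e \<and> Ran C x = e}, mult = Mul C, one = e \<rparr>"

definition is_subgroup_of_groupoid :: "'a set \<Rightarrow> 'a arrow_cat \<Rightarrow> bool" where
  "is_subgroup_of_groupoid H G \<longleftrightarrow> (\<exists>e \<in> Obj G. subgroup H (local_monoid G e))"

text \<open>
  Each \<open>H i\<close> is a submonoid of the local monoid at \<open>e i\<close>, and \<open>\<alpha> i\<close> is a functor to \<open>C\<close> from
  \<open>H i\<close>, viewed as a subcategory with the single object \<open>e i\<close>; its values lie in the local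
  monoid at \<open>f i\<close>. Since \<open>H i\<close> contains \<open>e i\<close>, both \<open>e i\<close> and \<open>f i\<close> are determined by
  \<open>H i\<close> and \<open>\<alpha> i\<close>.
\<close>

definition hnn_data ::
  "'a arrow_cat \<Rightarrow> 'i set \<Rightarrow> ('i \<Rightarrow> 'a set) \<Rightarrow> ('i \<Rightarrow> 'a \<Rightarrow> 'a)
     \<Rightarrow> ('i \<Rightarrow> 'a) \<Rightarrow> ('i \<Rightarrow> 'a) \<Rightarrow> bool" where
  "hnn_data C I H \<alpha> e f \<longleftrightarrow>
     (\<forall>i \<in> I. e i \<in> Obj C \<and> f i \<in> Obj C
        \<and> submonoid (H i) (local_monoid C (e i))
        \<and> cat_functor (C\<lparr>Arr := H i\<rparr>) C (\<alpha> i)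
        \<and> \<alpha> i ` H i \<subseteq> carrier (local_monoid C (f i)))"

definition hnn_graph ::
  "('a, 'k) pre_digraph \<Rightarrow> 'i set \<Rightarrow> ('i \<Rightarrow> 'a) \<Rightarrow> ('i \<Rightarrow> 'a) \<Rightarrow> ('a, 'k + 'i) pre_digraph" where
  "hnn_graph K I e f =
     \<lparr> verts = verts K,
       arcs = Inl ` arcs K \<union> Inr ` I,
       tail = case_sum (tail K) f,
       head = case_sum (head K) e \<rparr>"

definition lift_path :: "('a, 'k) path \<Rightarrow> ('a, 'k + 'i) path" where
  "lift_path = (\<lambda>(v, p, u). (v, map Inl p, u))"

definition stable_letter :: "('i \<Rightarrow> 'a) \<Rightarrow> ('i \<Rightarrow> 'a) \<Rightarrow> 'i \<Rightarrow> ('a, 'k + 'i) path" where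
  "stable_letter e f i = (e i, [Inr i], f i)"

text \<open>
  The relation \<open>x t\<^sub>i = t\<^sub>i \<alpha>\<^sub>i(x)\<close> is imposed for all paths \<open>p\<close> and \<open>q\<close> of \<open>K\<close> that represent
  \<open>x\<close> and \<open>\<alpha>\<^sub>i(x)\<close>. Modulo the relations of \<open>C\<close>, different choices of \<open>p\<close> and \<open>q\<close> give
  the same relation.
\<close>

definition hnn_relations ::
  "('a, 'k) pre_digraph \<Rightarrow> (('a, 'k) path \<times> ('a, 'k) path) set \<Rightarrow> (('a, 'k) path set \<Rightarrow> 'a)
     \<Rightarrow> 'i set \<Rightarrow> ('i \<Rightarrow> 'a set) \<Rightarrow> ('i \<Rightarrow> 'a \<Rightarrow> 'a) \<Rightarrow> ('i \<Rightarrow> 'a) \<Rightarrow> ('i \<Rightarrow> 'a)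
     \<Rightarrow> (('a, 'k + 'i) path \<times> ('a, 'k + 'i) path) set" where
  "hnn_relations K R \<epsilon> I H \<alpha> e f =
     {(lift_path p, lift_path q) | p q. (p, q) \<in> R}
     \<union> {(lift_path p \<cdot>\<^bsub>free_category (hnn_graph K I e f)\<^esub> stable_letter e f i,
         stable_letter e f i \<cdot>\<^bsub>free_category (hnn_graph K I e f)\<^esub> lift_path q) | i p q.
          i \<in> I \<and> p \<in> Arr (free_category K) \<and> q \<in> Arr (free_category K)
          \<and> \<epsilon> (path_class K R p) \<in> H i
          \<and> \<epsilon> (path_class K R q) = \<alpha> i (\<epsilon> (path_class K R p))}"

definition hnn_category ::
  "('a, 'k) pre_digraph \<Rightarrow> (('a, 'k) path \<times> ('a, 'k) path) set \<Rightarrow> (('a, 'k) path set \<Rightarrow> 'a)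
     \<Rightarrow> 'i set \<Rightarrow> ('i \<Rightarrow> 'a set) \<Rightarrow> ('i \<Rightarrow> 'a \<Rightarrow> 'a) \<Rightarrow> ('i \<Rightarrow> 'a) \<Rightarrow> ('i \<Rightarrow> 'a)
     \<Rightarrow> ('a, 'k + 'i) path set arrow_cat" where
  "hnn_category K R \<epsilon> I H \<alpha> e f =
     presented_category (hnn_graph K I e f) (hnn_relations K R \<epsilon> I H \<alpha> e f)"

text \<open>
  As with any category given by a presentation, \<open>M\<close> is an HNN-extension of \<open>C\<close> if it is
  isomorphic to the presented category.
\<close>

definition is_hnn_extension ::
  "'m arrow_cat \<Rightarrow> 'a arrow_cat
     \<Rightarrow> ('a, 'k) pre_digraph \<Rightarrow> (('a, 'k) path \<times> ('a, 'k) path) set \<Rightarrow> (('a, 'k) path set \<Rightarrow> 'a)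
     \<Rightarrow> 'i set \<Rightarrow> ('i \<Rightarrow> 'a set) \<Rightarrow> ('i \<Rightarrow> 'a \<Rightarrow> 'a) \<Rightarrow> ('i \<Rightarrow> 'a) \<Rightarrow> ('i \<Rightarrow> 'a) \<Rightarrow> bool" where
  "is_hnn_extension M C K R \<epsilon> I H \<alpha> e f \<longleftrightarrow>
     category_presentation C K R \<epsilon> \<and> hnn_data C I H \<alpha> e f
     \<and> isomorphic_cats M (hnn_category K R \<epsilon> I H \<alpha> e f)"


section \<open>Self-similar actions and Zappa-Szep products\<close>

text \<open>
  The bijection \<open>j\<close> is the identification of the objects of \<open>C\<close> with those of \<open>G\<close>. For an
  arrow \<open>g\<close> of a groupoid, \<open>g\<inverse>g = Dom g\<close> and \<open>gg\<inverse> = Ran g\<close>. Below, \<open>act g x\<close> is \<open>g \<cdot> x\<close> and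
  \<open>res g x\<close> is the restriction of \<open>g\<close> to \<open>x\<close>; both matter only if \<open>Dom g = j (Ran x)\<close>.
\<close>

locale self_similar_action =
  G: groupoid G + C: category C
  for G :: "'g arrow_cat" and C :: "'c arrow_cat" +
  fixes j :: "'c \<Rightarrow> 'g"
    and act :: "'g \<Rightarrow> 'c \<Rightarrow> 'c"
    and res :: "'g \<Rightarrow> 'c \<Rightarrow> 'g"
  assumes identification: "bij_betw j (Obj C) (Obj G)"
    and act_closed: "\<lbrakk>g \<in> Arr G; x \<in> Arr C; Dom G g = j (Ran C x)\<rbrakk> \<Longrightarrow> act g x \<in> Arr C"
    and res_closed: "\<lbrakk>g \<in> Arr G; x \<in> Arr C; Dom G g = j (Ran C x)\<rbrakk> \<Longrightarrow> res g x \<in> Arr G"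
    and C1: "\<lbrakk>g \<in> Arr G; x \<in> Arr C; Dom G g = j (Ran C x)\<rbrakk>
               \<Longrightarrow> j (Ran C (act g x)) = Ran G g"
    and C2: "\<lbrakk>g \<in> Arr G; x \<in> Arr C; Dom G g = j (Ran C x)\<rbrakk>
               \<Longrightarrow> j (Dom C (act g x)) = Ran G (res g x)"
    and C3: "\<lbrakk>g \<in> Arr G; x \<in> Arr C; Dom G g = j (Ran C x)\<rbrakk>
               \<Longrightarrow> j (Dom C x) = Dom G (res g x)"
    and SS1: "x \<in> Arr C \<Longrightarrow> act (j (Ran C x)) x = x"
    and SS2: "\<lbrakk>g \<in> Arr G; h \<in> Arr G; x \<in> Arr C; Dom G g = Ran G h; Dom G h = j (Ran C x)\<rbrakk>
                \<Longrightarrow> act (g \<cdot>\<^bsub>G\<^esub> h) x = act g (act h x)"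
    and SS3: "\<lbrakk>g \<in> Arr G; e \<in> Obj C; e' \<in> Obj C; j e = Dom G g; j e' = Ran G g\<rbrakk>
                \<Longrightarrow> act g e = e'"
    and SS4: "x \<in> Arr C \<Longrightarrow> res (j (Ran C x)) x = j (Dom C x)"
    and SS5: "\<lbrakk>g \<in> Arr G; e \<in> Obj C; j e = Dom G g\<rbrakk> \<Longrightarrow> res g e = g"
    and SS6: "\<lbrakk>g \<in> Arr G; x \<in> Arr C; y \<in> Arr C; Dom C x = Ran C y; Dom G g = j (Ran C x)\<rbrakk>
                \<Longrightarrow> res g (x \<cdot>\<^bsub>C\<^esub> y) = res (res g x) y"
    and SS7: "\<lbrakk>g \<in> Arr G; h \<in> Arr G; x \<in> Arr C; Dom G g = Ran G h; Dom G h = j (Ran C x)\<rbrakk>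
                \<Longrightarrow> res (g \<cdot>\<^bsub>G\<^esub> h) x = res g (act h x) \<cdot>\<^bsub>G\<^esub> res h x"
    and SS8: "\<lbrakk>g \<in> Arr G; x \<in> Arr C; y \<in> Arr C; Dom C x = Ran C y; Dom G g = j (Ran C x)\<rbrakk>
                \<Longrightarrow> act g (x \<cdot>\<^bsub>C\<^esub> y) = act g x \<cdot>\<^bsub>C\<^esub> act (res g x) y"

text \<open>
  The identities of the product are the pairs \<open>(e, j e)\<close> with \<open>e\<close> an object of \<open>C\<close>, and the
  product of \<open>(x, g)\<close> and \<open>(y, h)\<close> is defined iff \<open>Dom g = j (Ran y)\<close>.
\<close>

definition zappa_szep ::
  "'g arrow_cat \<Rightarrow> 'c arrow_cat \<Rightarrow> ('c \<Rightarrow> 'g) \<Rightarrow> ('g \<Rightarrow> 'c \<Rightarrow> 'c) \<Rightarrow> ('g \<Rightarrow> 'c \<Rightarrow> 'g)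
     \<Rightarrow> ('c \<times> 'g) arrow_cat" where
  "zappa_szep G C j act res =
     \<lparr> Arr = {(x, g). x \<in> Arr C \<and> g \<in> Arr G \<and> j (Dom C x) = Ran G g},
       Dom = (\<lambda>(x, g). (inv_into (Obj C) j (Dom G g), Dom G g)),
       Ran = (\<lambda>(x, g). (Ran C x, j (Ran C x))),
       Mul = (\<lambda>(x, g) (y, h). (x \<cdot>\<^bsub>C\<^esub> act g y, res g y \<cdot>\<^bsub>G\<^esub> h)) \<rparr>"

text \<open>\<open>M\<close> is isomorphic to the Zappa-Szep product of the free category on \<open>\<G>\<close> with \<open>G\<close>.\<close>

definition is_free_zappa_szep ::
  "'m arrow_cat \<Rightarrow> 'g arrow_cat \<Rightarrow> ('v, 'e) pre_digraph \<Rightarrow> (('v, 'e) path \<Rightarrow> 'g)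
     \<Rightarrow> ('g \<Rightarrow> ('v, 'e) path \<Rightarrow> ('v, 'e) path) \<Rightarrow> ('g \<Rightarrow> ('v, 'e) path \<Rightarrow> 'g) \<Rightarrow> bool" where
  "is_free_zappa_szep M G \<G> j act res \<longleftrightarrow>
     wf_digraph \<G> \<and> self_similar_action G (free_category \<G>) j act res
     \<and> isomorphic_cats M (zappa_szep G (free_category \<G>) j act res)"

end

theory Submission
  imports Defs
begin

text \<open>
  In an HNN-extension of a groupoid \<open>G\<close> along subgroups \<open>H i\<close>, the relation \<open>h t\<^sub>i = t\<^sub>i \<alpha>\<^sub>i(h)\<close> moves
  every \<open>h \<in> H i\<close> to the right of the stable letter \<open>t\<^sub>i\<close>. Fix a set of representatives \<open>r\<close> of the cosets
  \<open>g H\<^sub>i\<close>. Writing \<open>g = r h\<close> gives \<open>g t\<^sub>i = (r t\<^sub>i) \<alpha>\<^sub>i(h)\<close>, so every arrow has a normal form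
  \<open>(r\<^sub>1 t\<^bsub>i\<^sub>1\<^esub>) \<dots> (r\<^sub>n t\<^bsub>i\<^sub>n\<^esub>) g\<close>: a path in the graph whose edges are the symbols \<open>r t\<^sub>i\<close>, followed by an
  element of \<open>G\<close>. The same rewriting, applied to \<open>g (r t\<^sub>i)\<close>, is a self-similar action of \<open>G\<close> on this
  graph, and uniqueness of normal forms says that the HNN-extension is the Zappa-Szep product of its
  free category with \<open>G\<close>.

  Conversely, let \<open>G\<close> act self-similarly on a free category. The action preserves the length of paths
  (\<open>act_edge\<close>), so \<open>G\<close> acts on edges. With one stable letter for each orbit of edges, the stabilizer of
  its representative as associated subgroup and restriction to the representative as \<open>\<alpha>\<^sub>i\<close>, the relation
  \<open>h t\<^sub>i = t\<^sub>i \<alpha>\<^sub>i(h)\<close> is the product \<open>h x = (h \<cdot> x) h|\<^sub>x\<close> in the case \<open>h \<cdot> x = x\<close>.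

  Both directions therefore rest on one isomorphism. Suppose that \<open>G\<close> acts on \<open>\<G>\<^sup>*\<close>, that one edge is
  chosen in each orbit, and that \<open>H i\<close> and \<open>\<alpha> i\<close> are the stabilizers of these edges and the restrictions to
  them (locale \<open>hnn_transversal\<close>). The universal property of the presentation gives a functor \<open>\<Phi>\<close> from the
  HNN-extension to the Zappa-Szep product. In the other direction, an edge \<open>x = g \<cdot> x\<^sub>i\<close> goes to
  \<open>g t\<^sub>i (g|\<^bsub>x\<^sub>i\<^esub>)\<inverse>\<close>; different choices of \<open>g\<close> differ by an element of the stabilizer, which slides
  through \<open>t\<^sub>i\<close>. That the resulting map inverts \<open>\<Phi>\<close> is proved in \<open>hnn_isomorphic_zappa_szep\<close>, so the
  product itself plays the part of the normal forms and no rewriting system has to be analysed. For given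
  subgroups the action on cosets satisfies these hypotheses (\<open>hnn_transversal_cosets\<close>), and for a given
  action the orbit representatives do (\<open>ex_hnn_extension\<close>).

  Finally, the principal right ideal of \<open>(x, g)\<close> in such a product depends only on \<open>x\<close> and consists of the
  pairs whose path extends \<open>x\<close>. The left Rees conditions thus reduce to facts about prefixes: two
  prefixes of one path are comparable, and a path has finitely many of them (\<open>left_Rees_zappa_szep\<close>).
\<close>


section \<open>Categories and groupoids\<close>

context category
begin

lemma ObjD:
  assumes "e \<in> Obj C"
  shows "e \<in> Arr C" "Dom C e = e" "Ran C e = e"
proof -
  show "e \<in> Arr C" and d: "Dom C e = e"
    using assms by (auto simp: Obj_def)
  show "Ran C e = e"
    using ran_dom[OF \<open>e \<in> Arr C\<close>] d by simp
qed

lemma Dom_in_Obj: "x \<in> Arr C \<Longrightarrow> Dom C x \<in> Obj C"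
  by (simp add: Obj_def dom_closed dom_dom)

lemma Ran_in_Obj: "x \<in> Arr C \<Longrightarrow> Ran C x \<in> Obj C"
  by (simp add: Obj_def ran_closed dom_ran)

lemmas arrow_simps =
  dom_closed ran_closed dom_dom ran_dom dom_ran ran_ran
  mul_closed dom_mul ran_mul mul_assoc mul_dom ran_mul_self Dom_in_Obj Ran_in_Obj

lemma mem_local_monoid:
  "x \<in> carrier (local_monoid C e) \<longleftrightarrow> x \<in> Arr C \<and> Dom C x = e \<and> Ran C x = e"
  by (simp add: local_monoid_def)

end

context groupoid
begin

definition ginv :: "'a \<Rightarrow> 'a" where
  "ginv x = (SOME y. y \<in> Arr C \<and> Dom C y = Ran C x \<and> Ran C y = Dom C x
                 \<and> x \<cdot> y = Ran C x \<and> y \<cdot> x = Dom C x)"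

lemma ginv_all:
  assumes "x \<in> Arr C"
  shows "ginv x \<in> Arr C \<and> Dom C (ginv x) = Ran C x \<and> Ran C (ginv x) = Dom C x
                 \<and> x \<cdot> ginv x = Ran C x \<and> ginv x \<cdot> x = Dom C x"
  unfolding ginv_def by (rule someI_ex) (use ex_inverse[OF assms] in blast)

lemma
  assumes "x \<in> Arr C"
  shows ginv_closed: "ginv x \<in> Arr C"
    and dom_ginv: "Dom C (ginv x) = Ran C x"
    and ran_ginv: "Ran C (ginv x) = Dom C x"
    and mul_ginv: "x \<cdot> ginv x = Ran C x"
    and ginv_mul: "ginv x \<cdot> x = Dom C x"
  using ginv_all[OF assms] by auto

lemma ginv_mul_cancel:
  "\<lbrakk>x \<in> Arr C; y \<in> Arr C; Dom C x = Ran C y\<rbrakk> \<Longrightarrow> ginv x \<cdot> (x \<cdot> y) = y"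
  using mul_assoc[of "ginv x" x y] by (simp add: ginv_closed dom_ginv ginv_mul ran_mul_self)

lemma mul_ginv_cancel:
  "\<lbrakk>x \<in> Arr C; y \<in> Arr C; Ran C x = Ran C y\<rbrakk> \<Longrightarrow> x \<cdot> (ginv x \<cdot> y) = y"
  using mul_assoc[of x "ginv x" y]
  by (simp add: ginv_closed dom_ginv ran_ginv mul_ginv ran_mul_self)

lemmas inverse_simps =
  ginv_closed dom_ginv ran_ginv mul_ginv ginv_mul ginv_mul_cancel mul_ginv_cancel

lemma left_cancel:
  assumes "x \<in> Arr C" "y \<in> Arr C" "z \<in> Arr C"
    and "Dom C x = Ran C y" "Dom C x = Ran C z" "x \<cdot> y = x \<cdot> z"
  shows "y = z"
  by (metis assms ginv_mul_cancel)

end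


section \<open>Functors and isomorphisms\<close>

lemma cat_functorD:
  assumes "cat_functor C D F"
  shows "category C" "category D"
    and "\<And>x. x \<in> Arr C \<Longrightarrow> F x \<in> Arr D"
    and "\<And>x. x \<in> Arr C \<Longrightarrow> Dom D (F x) = F (Dom C x)"
    and "\<And>x. x \<in> Arr C \<Longrightarrow> Ran D (F x) = F (Ran C x)"
    and "\<And>x y. \<lbrakk>x \<in> Arr C; y \<in> Arr C; Dom C x = Ran C y\<rbrakk>
           \<Longrightarrow> F (x \<cdot>\<^bsub>C\<^esub> y) = F x \<cdot>\<^bsub>D\<^esub> F y"
  using assms by (auto simp: cat_functor_def)

lemma cat_functorI:
  assumes "category C" "category D"
    and "\<And>x. x \<in> Arr C \<Longrightarrow> F x \<in> Arr D"
    and "\<And>x. x \<in> Arr C \<Longrightarrow> Dom D (F x) = F (Dom C x)"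
    and "\<And>x. x \<in> Arr C \<Longrightarrow> Ran D (F x) = F (Ran C x)"
    and "\<And>x y. \<lbrakk>x \<in> Arr C; y \<in> Arr C; Dom C x = Ran C y\<rbrakk>
           \<Longrightarrow> F (x \<cdot>\<^bsub>C\<^esub> y) = F x \<cdot>\<^bsub>D\<^esub> F y"
  shows "cat_functor C D F"
  using assms by (auto simp: cat_functor_def)

lemma cat_functor_comp:
  assumes "cat_functor C D F" "cat_functor D E F'"
  shows "cat_functor C E (F' \<circ> F)"
  using cat_functorD[OF assms(1)] cat_functorD[OF assms(2)]
  by (intro cat_functorI) (simp_all)

lemma cat_iso_sym:
  assumes "cat_iso C D F"
  shows "cat_iso D C (inv_into (Arr C) F)"
proof -
  let ?F' = "inv_into (Arr C) F"
  have fu: "cat_functor C D F" and bij: "bij_betw F (Arr C) (Arr D)"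
    using assms by (auto simp: cat_iso_def)
  note F = cat_functorD[OF fu]
  have inj: "inj_on F (Arr C)" and onto: "F ` Arr C = Arr D"
    using bij by (auto simp: bij_betw_def)
  have in_C: "?F' y \<in> Arr C" and cancel: "F (?F' y) = y" if "y \<in> Arr D" for y
    using that onto by (auto intro: inv_into_into f_inv_into_f)
  have eqI: "?F' y = x" if "y \<in> Arr D" "x \<in> Arr C" "F x = y" for x y
    using that inj by (auto intro: inv_into_f_eq)
  have dom: "?F' (Dom D y) = Dom C (?F' y)" if "y \<in> Arr D" for y
  proof (rule eqI)
    show "F (Dom C (?F' y)) = Dom D y"
      using F(4)[OF in_C[OF that]] by (simp add: cancel that)
  qed (simp_all add: that in_C category.dom_closed[OF F(1)] category.dom_closed[OF F(2)])
  have ran: "?F' (Ran D y) = Ran C (?F' y)" if "y \<in> Arr D" for y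
  proof (rule eqI)
    show "F (Ran C (?F' y)) = Ran D y"
      using F(5)[OF in_C[OF that]] by (simp add: cancel that)
  qed (simp_all add: that in_C category.ran_closed[OF F(1)] category.ran_closed[OF F(2)])
  have "cat_functor D C ?F'"
  proof (rule cat_functorI)
    fix x y assume xy: "x \<in> Arr D" "y \<in> Arr D" "Dom D x = Ran D y"
    have d: "Dom C (?F' x) = Ran C (?F' y)"
      using xy dom[of x] ran[of y] by simp
    show "?F' (x \<cdot>\<^bsub>D\<^esub> y) = ?F' x \<cdot>\<^bsub>C\<^esub> ?F' y"
      using xy d by (intro eqI)
        (simp_all add: F(6) in_C cancel category.arrow_simps[OF F(1)] category.arrow_simps[OF F(2)])
  qed (simp_all add: F in_C dom ran)
  then show ?thesis
    using bij by (simp add: cat_iso_def bij_betw_inv_into)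
qed

lemma isomorphic_cats_sym: "isomorphic_cats C D \<Longrightarrow> isomorphic_cats D C"
  unfolding isomorphic_cats_def using cat_iso_sym by blast

lemma isomorphic_cats_trans:
  assumes "isomorphic_cats C D" "isomorphic_cats D E"
  shows "isomorphic_cats C E"
proof -
  obtain F F' where "cat_iso C D F" "cat_iso D E F'"
    using assms by (auto simp: isomorphic_cats_def)
  then have "cat_iso C E (F' \<circ> F)"
    by (auto simp: cat_iso_def intro: cat_functor_comp bij_betw_trans)
  then show ?thesis
    by (auto simp: isomorphic_cats_def)
qed


section \<open>Free categories\<close>

abbreviation edge_path :: "('v, 'e) pre_digraph \<Rightarrow> 'e \<Rightarrow> ('v, 'e) path" where
  "edge_path K a \<equiv> (head K a, [a], tail K a)"

lemma free_category_simps [simp]: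
  "Dom (free_category K) (v, p, u) = (u, [], u)"
  "Ran (free_category K) (v, p, u) = (v, [], v)"
  "(v, p, u) \<cdot>\<^bsub>free_category K\<^esub> (v', p', u') = (v, p @ p', u')"
  by (simp_all add: free_category_def)

context wf_digraph
begin

lemma path_Nil_iff: "(v, [], u) \<in> Arr (free_category G) \<longleftrightarrow> u = v \<and> v \<in> verts G"
  by (auto simp: free_category_def awalk_def)

lemma path_Cons_iff:
  "(v, a # p, u) \<in> Arr (free_category G)
     \<longleftrightarrow> a \<in> arcs G \<and> head G a = v \<and> (tail G a, p, u) \<in> Arr (free_category G)"
  by (auto simp: free_category_def awalk_Cons_iff awalk_Nil_iff)

lemma path_append_iff:
  "(v, p @ q, u) \<in> Arr (free_category G)
     \<longleftrightarrow> (\<exists>w. (v, p, w) \<in> Arr (free_category G) \<and> (w, q, u) \<in> Arr (free_category G))"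
proof (induction p arbitrary: v)
  case Nil
  show ?case
  proof (cases q)
    case Nil
    then show ?thesis by (auto simp: path_Nil_iff)
  next
    case (Cons a q')
    then show ?thesis by (auto simp: path_Nil_iff path_Cons_iff)
  qed
qed (auto simp: path_Cons_iff)

lemma path_verts:
  assumes "(v, p, u) \<in> Arr (free_category G)"
  shows "v \<in> verts G" "u \<in> verts G"
  using path_append_iff[of v "[]" p u] path_append_iff[of v p "[]" u] assms
  by (auto simp: path_Nil_iff)

text \<open>
The codomain is the head of the first edge if there is one, and otherwise it is the domain.
\<close>
lemma path_start_unique:
  "\<lbrakk>(v, p, u) \<in> Arr (free_category G); (v', p, u) \<in> Arr (free_category G)\<rbrakk> \<Longrightarrow> v = v'"
  by (cases p) (auto simp: path_Nil_iff path_Cons_iff)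

lemma edge_path_closed: "a \<in> arcs G \<Longrightarrow> edge_path G a \<in> Arr (free_category G)"
  by (simp add: path_Cons_iff path_Nil_iff)

lemma category_free_category: "category (free_category G)"
  by unfold_locales
    (auto simp: path_Nil_iff path_append_iff path_verts)

lemma Obj_free: "Obj (free_category G) = {(v, [], v) | v. v \<in> verts G}"
  by (auto simp: Obj_def path_Nil_iff)

text \<open>
Paths grow here at their domain end. In an HNN-extension this is the end at which the group element of a
normal form stands, so multiplication by a generator on this side changes a normal form only locally.
\<close>
lemma free_category_induct [consumes 1, case_names vertex edge]:
  assumes "x \<in> Arr (free_category G)"
    and vertex: "\<And>v. v \<in> verts G \<Longrightarrow> P (v, [], v)"
    and edge: "\<And>x a. \<lbrakk>x \<in> Arr (free_category G); P x; a \<in> arcs G;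
                 Dom (free_category G) x = Ran (free_category G) (edge_path G a)\<rbrakk>
               \<Longrightarrow> P (x \<cdot>\<^bsub>free_category G\<^esub> edge_path G a)"
  shows "P x"
proof -
  have "(v, p, u) \<in> Arr (free_category G) \<Longrightarrow> P (v, p, u)" for v p u
  proof (induction p arbitrary: u rule: rev_induct)
    case Nil
    then show ?case by (auto simp: path_Nil_iff intro: vertex)
  next
    case (snoc a p)
    then have "a \<in> arcs G" "u = tail G a" "(v, p, head G a) \<in> Arr (free_category G)"
      by (auto simp: path_append_iff path_Cons_iff path_Nil_iff)
    then show ?case
      using edge[of "(v, p, head G a)" a] snoc.IH by simp
  qed
  then show ?thesis
    using assms(1) by (cases x) blast
qed

end

primrec path_product :: "'d arrow_cat \<Rightarrow> ('v \<Rightarrow> 'd) \<Rightarrow> ('e \<Rightarrow> 'd) \<Rightarrow> 'v \<Rightarrow> 'e list \<Rightarrow> 'd" where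
  "path_product D \<phi>\<^sub>0 \<phi> u [] = \<phi>\<^sub>0 u"
| "path_product D \<phi>\<^sub>0 \<phi> u (a # p) = \<phi> a \<cdot>\<^bsub>D\<^esub> path_product D \<phi>\<^sub>0 \<phi> u p"

definition free_extension :: "'d arrow_cat \<Rightarrow> ('v \<Rightarrow> 'd) \<Rightarrow> ('e \<Rightarrow> 'd) \<Rightarrow> ('v, 'e) path \<Rightarrow> 'd" where
  "free_extension D \<phi>\<^sub>0 \<phi> = (\<lambda>(v, p, u). path_product D \<phi>\<^sub>0 \<phi> u p)"

lemma free_extension_vertex: "free_extension D \<phi>\<^sub>0 \<phi> (v, [], v) = \<phi>\<^sub>0 v"
  by (simp add: free_extension_def)

text \<open>
The free category has the usual universal property: a graph morphism into a category extends to a functor.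
\<close>
locale graph_morphism = wf_digraph K + D: category D
  for K :: "('v, 'e) pre_digraph" and D :: "'d arrow_cat" +
  fixes \<phi>\<^sub>0 :: "'v \<Rightarrow> 'd" and \<phi> :: "'e \<Rightarrow> 'd"
  assumes vertex_closed: "v \<in> verts K \<Longrightarrow> \<phi>\<^sub>0 v \<in> Obj D"
    and edge_closed: "a \<in> arcs K \<Longrightarrow> \<phi> a \<in> Arr D"
    and Dom_edge: "a \<in> arcs K \<Longrightarrow> Dom D (\<phi> a) = \<phi>\<^sub>0 (tail K a)"
    and Ran_edge: "a \<in> arcs K \<Longrightarrow> Ran D (\<phi> a) = \<phi>\<^sub>0 (head K a)"
begin

lemma path_product_props:
  assumes "(v, p, u) \<in> Arr (free_category K)"
  shows "path_product D \<phi>\<^sub>0 \<phi> u p \<in> Arr D \<and> Dom D (path_product D \<phi>\<^sub>0 \<phi> u p) = \<phi>\<^sub>0 u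
    \<and> Ran D (path_product D \<phi>\<^sub>0 \<phi> u p) = \<phi>\<^sub>0 v"
  using assms
proof (induction p arbitrary: v)
  case Nil
  then show ?case
    using D.ObjD[OF vertex_closed] by (auto simp: path_Nil_iff)
next
  case (Cons a p)
  then have "a \<in> arcs K" "head K a = v" "(tail K a, p, u) \<in> Arr (free_category K)"
    by (auto simp: path_Cons_iff)
  then show ?case
    using Cons.IH[of "tail K a"] by (simp add: D.arrow_simps edge_closed Dom_edge Ran_edge)
qed

lemma path_product_append:
  assumes "(v, p, w) \<in> Arr (free_category K)" "(w, q, u) \<in> Arr (free_category K)"
  shows "path_product D \<phi>\<^sub>0 \<phi> u (p @ q)
    = path_product D \<phi>\<^sub>0 \<phi> w p \<cdot>\<^bsub>D\<^esub> path_product D \<phi>\<^sub>0 \<phi> u q"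
  using assms(1)
proof (induction p arbitrary: v)
  case Nil
  then show ?case
    using path_product_props[OF assms(2)] D.ran_mul_self[of "path_product D \<phi>\<^sub>0 \<phi> u q"]
    by (auto simp: path_Nil_iff)
next
  case (Cons a p)
  then have "a \<in> arcs K" "head K a = v" "(tail K a, p, w) \<in> Arr (free_category K)"
    by (auto simp: path_Cons_iff)
  then show ?case
    using Cons.IH[of "tail K a"] path_product_props[of "tail K a" p w] path_product_props[OF assms(2)]
    by (simp add: D.arrow_simps edge_closed Dom_edge Ran_edge)
qed

lemma functor_free_extension: "cat_functor (free_category K) D (free_extension D \<phi>\<^sub>0 \<phi>)"
proof (rule cat_functorI)
  fix x y assume xy: "x \<in> Arr (free_category K)" "y \<in> Arr (free_category K)"
    "Dom (free_category K) x = Ran (free_category K) y"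
  then show "free_extension D \<phi>\<^sub>0 \<phi> (x \<cdot>\<^bsub>free_category K\<^esub> y)
      = free_extension D \<phi>\<^sub>0 \<phi> x \<cdot>\<^bsub>D\<^esub> free_extension D \<phi>\<^sub>0 \<phi> y"
    by (cases x, cases y) (auto simp: free_extension_def path_product_append)
qed (auto simp: free_extension_def path_product_props category_free_category D.category_axioms)

lemma free_extension_edge:
  assumes "a \<in> arcs K"
  shows "free_extension D \<phi>\<^sub>0 \<phi> (edge_path K a) = \<phi> a"
  using D.mul_dom[OF edge_closed[OF assms]] Dom_edge[OF assms] by (simp add: free_extension_def)

end


section \<open>Quotients by generated congruences\<close>

locale generated_congruence = category +
  fixes R :: "('a \<times> 'a) set"
  assumes parallel: "R \<subseteq> parallel_pairs C"
begin

abbreviation cls :: "'a \<Rightarrow> 'a set" where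
  "cls x \<equiv> cat_congruence C R `` {x}"

text \<open>
Identifying only parallel arrows keeps objects apart, so two arrows of the quotient are composable only if
their representatives already are. This is what makes the quotient a category.
\<close>
lemma congruence_parallel: "(x, y) \<in> cat_congruence C R \<Longrightarrow> (x, y) \<in> parallel_pairs C"
proof (induction rule: cat_congruence.induct)
  case (base x y)
  then show ?case using parallel by blast
qed (auto simp: parallel_pairs_def arrow_simps)

lemma equiv_congruence: "equiv (Arr C) (cat_congruence C R)"
proof (rule equivI)
  show "refl_on (Arr C) (cat_congruence C R)"
    using congruence_parallel
    by (auto simp: refl_on_def parallel_pairs_def intro: cat_congruence.refl)
  show "cat_congruence C R \<subseteq> Arr C \<times> Arr C"
    using congruence_parallel by (auto simp: parallel_pairs_def)
  show "sym (cat_congruence C R)"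
    by (rule symI) (rule cat_congruence.sym)
  show "trans (cat_congruence C R)"
    by (rule transI) (rule cat_congruence.trans)
qed

lemma cls_eq_iff:
  "\<lbrakk>x \<in> Arr C; y \<in> Arr C\<rbrakk> \<Longrightarrow> cls x = cls y \<longleftrightarrow> (x, y) \<in> cat_congruence C R"
  using eq_equiv_class_iff[OF equiv_congruence] by blast

lemma cls_eqI: "(x, y) \<in> cat_congruence C R \<Longrightarrow> cls x = cls y"
  using equiv_class_eq[OF equiv_congruence] by blast

lemma mem_cls: "x \<in> Arr C \<Longrightarrow> x \<in> cls x"
  using equiv_class_self[OF equiv_congruence] by blast

lemma quotient_Dom:
  assumes "x \<in> Arr C"
  shows "Dom (quotient_category C (cat_congruence C R)) (cls x) = cls (Dom C x)"
proof -
  have "Dom C y = Dom C x" if "y \<in> cls x" for y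
    using that congruence_parallel[of x y] by (simp add: parallel_pairs_def)
  then have "(\<Union>y\<in>cls x. cls (Dom C y)) = (\<Union>y\<in>cls x. cls (Dom C x))"
    by (intro SUP_cong) simp_all
  then have "(\<Union>y\<in>cls x. cls (Dom C y)) = cls (Dom C x)"
    using mem_cls[OF assms] by auto
  then show ?thesis
    by (simp add: quotient_category_def)
qed

lemma quotient_Ran:
  assumes "x \<in> Arr C"
  shows "Ran (quotient_category C (cat_congruence C R)) (cls x) = cls (Ran C x)"
proof -
  have "Ran C y = Ran C x" if "y \<in> cls x" for y
    using that congruence_parallel[of x y] by (simp add: parallel_pairs_def)
  then have "(\<Union>y\<in>cls x. cls (Ran C y)) = (\<Union>y\<in>cls x. cls (Ran C x))"
    by (intro SUP_cong) simp_all
  then have "(\<Union>y\<in>cls x. cls (Ran C y)) = cls (Ran C x)"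
    using mem_cls[OF assms] by auto
  then show ?thesis
    by (simp add: quotient_category_def)
qed

lemma quotient_Mul:
  assumes "x \<in> Arr C" "y \<in> Arr C" "Dom C x = Ran C y"
  shows "cls x \<cdot>\<^bsub>quotient_category C (cat_congruence C R)\<^esub> cls y = cls (x \<cdot> y)"
proof -
  have "cls (x' \<cdot> y') = cls (x \<cdot> y)" if "x' \<in> cls x" "y' \<in> cls y" for x' y'
    using that assms
    by (intro cls_eqI[symmetric]) (auto intro: cat_congruence.mul)
  then have "(\<Union>x'\<in>cls x. \<Union>y'\<in>cls y. cls (x' \<cdot> y'))
      = (\<Union>x'\<in>cls x. \<Union>y'\<in>cls y. cls (x \<cdot> y))"
    by (intro SUP_cong) simp_all
  then have "(\<Union>x'\<in>cls x. \<Union>y'\<in>cls y. cls (x' \<cdot> y')) = cls (x \<cdot> y)"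
    using mem_cls[OF assms(1)] mem_cls[OF assms(2)] by auto
  then show ?thesis
    by (simp add: quotient_category_def)
qed

lemma quotient_Arr: "Arr (quotient_category C (cat_congruence C R)) = cls ` Arr C"
  by (auto simp: quotient_category_def quotient_def)

lemma composable_cls:
  assumes "x \<in> Arr C" "y \<in> Arr C"
    and "Dom (quotient_category C (cat_congruence C R)) (cls x)
       = Ran (quotient_category C (cat_congruence C R)) (cls y)"
  shows "Dom C x = Ran C y"
proof -
  have "(Dom C x, Ran C y) \<in> cat_congruence C R"
    using assms by (simp add: quotient_Dom quotient_Ran cls_eq_iff arrow_simps)
  then show ?thesis
    using congruence_parallel[of "Dom C x" "Ran C y"] assms
    by (simp add: parallel_pairs_def arrow_simps)
qed

lemmas quotient_simps = quotient_Dom quotient_Ran quotient_Mul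

lemma category_quotient: "category (quotient_category C (cat_congruence C R))"
proof unfold_locales
  fix X Y Z
  let ?Q = "quotient_category C (cat_congruence C R)"
  assume X: "X \<in> Arr ?Q"
  then obtain x where x: "x \<in> Arr C" "X = cls x" by (auto simp: quotient_Arr)
  show "Dom ?Q X \<in> Arr ?Q" "Ran ?Q X \<in> Arr ?Q"
    "Dom ?Q (Dom ?Q X) = Dom ?Q X" "Ran ?Q (Dom ?Q X) = Dom ?Q X"
    "Dom ?Q (Ran ?Q X) = Ran ?Q X" "Ran ?Q (Ran ?Q X) = Ran ?Q X"
    "X \<cdot>\<^bsub>?Q\<^esub> Dom ?Q X = X" "Ran ?Q X \<cdot>\<^bsub>?Q\<^esub> X = X"
    using x by (auto simp: quotient_Arr quotient_simps arrow_simps)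
  assume Y: "Y \<in> Arr ?Q" and XY: "Dom ?Q X = Ran ?Q Y"
  then obtain y where y: "y \<in> Arr C" "Y = cls y" by (auto simp: quotient_Arr)
  have xy: "Dom C x = Ran C y"
    using composable_cls x y XY by blast
  show "X \<cdot>\<^bsub>?Q\<^esub> Y \<in> Arr ?Q" "Dom ?Q (X \<cdot>\<^bsub>?Q\<^esub> Y) = Dom ?Q Y" "Ran ?Q (X \<cdot>\<^bsub>?Q\<^esub> Y) = Ran ?Q X"
    using x y xy by (auto simp: quotient_Arr quotient_simps arrow_simps)
  assume Z: "Z \<in> Arr ?Q" and YZ: "Dom ?Q Y = Ran ?Q Z"
  then obtain z where z: "z \<in> Arr C" "Z = cls z" by (auto simp: quotient_Arr)
  have yz: "Dom C y = Ran C z"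
    using composable_cls y z YZ by blast
  show "X \<cdot>\<^bsub>?Q\<^esub> Y \<cdot>\<^bsub>?Q\<^esub> Z = X \<cdot>\<^bsub>?Q\<^esub> (Y \<cdot>\<^bsub>?Q\<^esub> Z)"
    using x y z xy yz by (simp add: quotient_simps arrow_simps)
qed

lemma functor_cls: "cat_functor C (quotient_category C (cat_congruence C R)) cls"
  by (rule cat_functorI)
    (auto simp: category_axioms category_quotient quotient_Arr quotient_simps)

text \<open>
The value is taken at an arbitrary representative; for a functor that respects the relations all of them
give the same value (\<open>functor_respects_congruence\<close>).
\<close>
definition induced :: "('a \<Rightarrow> 'd) \<Rightarrow> 'a set \<Rightarrow> 'd" where
  "induced F X = F (SOME x. x \<in> X)"

context
  fixes D :: "'d arrow_cat" and F :: "'a \<Rightarrow> 'd"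
  assumes F: "cat_functor C D F"
    and rel: "\<And>x y. (x, y) \<in> R \<Longrightarrow> F x = F y"
begin

lemma functor_respects_congruence: "(x, y) \<in> cat_congruence C R \<Longrightarrow> F x = F y"
proof (induction rule: cat_congruence.induct)
  case (mul x y u v)
  then have "(x, y) \<in> parallel_pairs C" "(u, v) \<in> parallel_pairs C"
    using congruence_parallel by auto
  then show ?case
    using mul cat_functorD[OF F] by (simp add: parallel_pairs_def)
qed (simp_all add: rel)

lemma induced_cls:
  assumes "x \<in> Arr C"
  shows "induced F (cls x) = F x"
proof -
  have "(SOME y. y \<in> cls x) \<in> cls x"
    by (rule someI[where P = "\<lambda>y. y \<in> cls x", OF mem_cls[OF assms]])
  then show ?thesis
    using functor_respects_congruence[of x "SOME y. y \<in> cls x"] by (simp add: induced_def)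
qed

lemma functor_induced:
  "cat_functor (quotient_category C (cat_congruence C R)) D (induced F)"
proof -
  note F' = cat_functorD[OF F]
  show ?thesis
  proof (rule cat_functorI)
    fix X Y
    let ?Q = "quotient_category C (cat_congruence C R)"
    assume X: "X \<in> Arr ?Q"
    then obtain x where x: "x \<in> Arr C" "X = cls x" by (auto simp: quotient_Arr)
    show "induced F X \<in> Arr D" "Dom D (induced F X) = induced F (Dom ?Q X)"
      "Ran D (induced F X) = induced F (Ran ?Q X)"
      using x by (simp_all add: quotient_simps arrow_simps induced_cls F')
    assume Y: "Y \<in> Arr ?Q" and XY: "Dom ?Q X = Ran ?Q Y"
    then obtain y where y: "y \<in> Arr C" "Y = cls y" by (auto simp: quotient_Arr)
    have xy: "Dom C x = Ran C y"
      using composable_cls x y XY by blast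
    show "induced F (X \<cdot>\<^bsub>?Q\<^esub> Y) = induced F X \<cdot>\<^bsub>D\<^esub> induced F Y"
      using x y xy by (simp add: quotient_simps arrow_simps induced_cls F')
  qed (simp_all add: category_quotient F')
qed

end

end


section \<open>Zappa-Szep products\<close>

context self_similar_action
begin

text \<open>
\<open>J\<close> turns an object of \<open>G\<close> into the object of the category acted upon that is identified with it.
\<close>
abbreviation J :: "'g \<Rightarrow> 'c" where
  "J \<equiv> inv_into (Obj C) j"

abbreviation Z :: "('c \<times> 'g) arrow_cat" where
  "Z \<equiv> zappa_szep G C j act res"

lemma j_closed: "v \<in> Obj C \<Longrightarrow> j v \<in> Obj G"
  using identification by (auto simp: bij_betw_def)

lemma J_j: "v \<in> Obj C \<Longrightarrow> J (j v) = v"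
  using identification by (auto simp: bij_betw_def)

lemma J_closed: "e \<in> Obj G \<Longrightarrow> J e \<in> Obj C"
  using identification by (auto simp: bij_betw_def intro: inv_into_into)

lemma j_J: "e \<in> Obj G \<Longrightarrow> j (J e) = e"
  using identification by (auto simp: bij_betw_def intro: f_inv_into_f)

lemma ran_act:
  "\<lbrakk>g \<in> Arr G; x \<in> Arr C; Dom G g = j (Ran C x)\<rbrakk> \<Longrightarrow> Ran C (act g x) = J (Ran G g)"
  by (metis C1 J_j act_closed C.Ran_in_Obj)

lemma ran_res:
  "\<lbrakk>g \<in> Arr G; x \<in> Arr C; Dom G g = j (Ran C x)\<rbrakk> \<Longrightarrow> Ran G (res g x) = j (Dom C (act g x))"
  by (simp add: C2)

lemma dom_res:
  "\<lbrakk>g \<in> Arr G; x \<in> Arr C; Dom G g = j (Ran C x)\<rbrakk> \<Longrightarrow> Dom G (res g x) = j (Dom C x)"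
  by (simp add: C3)

lemma act_J: "g \<in> Arr G \<Longrightarrow> act g (J (Dom G g)) = J (Ran G g)"
  by (rule SS3) (simp_all add: J_closed j_J G.arrow_simps)

lemma res_J: "g \<in> Arr G \<Longrightarrow> res g (J (Dom G g)) = g"
  by (rule SS5) (simp_all add: J_closed j_J G.arrow_simps)

lemma Ran_J: "e \<in> Obj G \<Longrightarrow> Ran C (J e) = J e" "e \<in> Obj G \<Longrightarrow> Dom C (J e) = J e"
  "e \<in> Obj G \<Longrightarrow> J e \<in> Arr C"
  using C.ObjD J_closed by auto

lemma act_ginv_act:
  assumes "g \<in> Arr G" "x \<in> Arr C" "Dom G g = j (Ran C x)"
  shows "act (G.ginv g) (act g x) = x"
  using SS2[of "G.ginv g" g x] assms by (simp add: G.inverse_simps SS1)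

lemma act_act_ginv:
  assumes "g \<in> Arr G" "x \<in> Arr C" "Ran G g = j (Ran C x)"
  shows "act g (act (G.ginv g) x) = x"
  using SS2[of g "G.ginv g" x] assms by (simp add: G.inverse_simps SS1)

lemma zappa_szep_simps [simp]:
  "Dom Z (x, g) = (J (Dom G g), Dom G g)"
  "Ran Z (x, g) = (Ran C x, j (Ran C x))"
  "(x, g) \<cdot>\<^bsub>Z\<^esub> (y, h) = (x \<cdot>\<^bsub>C\<^esub> act g y, res g y \<cdot>\<^bsub>G\<^esub> h)"
  by (simp_all add: zappa_szep_def)

lemma mem_zappa_szep:
  "(x, g) \<in> Arr Z \<longleftrightarrow> x \<in> Arr C \<and> g \<in> Arr G \<and> j (Dom C x) = Ran G g"
  by (simp add: zappa_szep_def)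

lemma composable_zappa_szep:
  assumes "(x, g) \<in> Arr Z" "(y, h) \<in> Arr Z"
  shows "Dom Z (x, g) = Ran Z (y, h) \<longleftrightarrow> Dom G g = j (Ran C y)"
  using assms by (auto simp: mem_zappa_szep J_j C.arrow_simps)

lemma composite_defined:
  assumes "(x, g) \<in> Arr Z" "y \<in> Arr C" "Dom G g = j (Ran C y)"
  shows "Dom C x = Ran C (act g y)"
  using assms J_j[of "Dom C x"] by (simp add: mem_zappa_szep ran_act C.arrow_simps)

lemma mul_zappa_szep_closed:
  assumes "(x, g) \<in> Arr Z" "(y, h) \<in> Arr Z" "Dom G g = j (Ran C y)"
  shows "(x, g) \<cdot>\<^bsub>Z\<^esub> (y, h) \<in> Arr Z"
  using assms composite_defined[OF assms(1) _ assms(3)]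
  by (auto simp: mem_zappa_szep C.arrow_simps G.arrow_simps act_closed res_closed ran_res dom_res)

text \<open>
Associativity is where the axioms meet: (SS2) and (SS8) match the first coordinates, (SS6) and (SS7) the
second.
\<close>
lemma category_zappa_szep: "category Z"
proof unfold_locales
  fix a b c
  assume a: "a \<in> Arr Z"
  obtain x g where a_eq: "a = (x, g)" by fastforce
  have x: "x \<in> Arr C" "g \<in> Arr G" "j (Dom C x) = Ran G g"
    using a a_eq by (auto simp: mem_zappa_szep)
  have Jx: "J (Ran G g) = Dom C x"
    using x J_j[of "Dom C x"] by (simp add: C.arrow_simps)
  show "Dom Z a \<in> Arr Z" "Ran Z a \<in> Arr Z"
    "Dom Z (Dom Z a) = Dom Z a" "Ran Z (Dom Z a) = Dom Z a"
    "Dom Z (Ran Z a) = Ran Z a" "Ran Z (Ran Z a) = Ran Z a"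
    using x a_eq J_j[of "Ran C x"]
    by (auto simp: mem_zappa_szep j_closed j_J Ran_J G.arrow_simps C.arrow_simps G.ObjD)
  show "a \<cdot>\<^bsub>Z\<^esub> Dom Z a = a"
    using x a_eq by (simp add: act_J res_J Jx G.arrow_simps C.arrow_simps)
  show "Ran Z a \<cdot>\<^bsub>Z\<^esub> a = a"
    using x a_eq by (simp add: SS1 SS4 G.arrow_simps C.arrow_simps)
  assume b: "b \<in> Arr Z" and ab: "Dom Z a = Ran Z b"
  obtain y h where b_eq: "b = (y, h)" by fastforce
  have y: "y \<in> Arr C" "h \<in> Arr G" "j (Dom C y) = Ran G h" "Dom G g = j (Ran C y)"
    using a b ab a_eq b_eq composable_zappa_szep by (auto simp: mem_zappa_szep)
  have xy: "Dom C x = Ran C (act g y)"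
    using x y composite_defined[of x g y] by (simp add: mem_zappa_szep)
  show "a \<cdot>\<^bsub>Z\<^esub> b \<in> Arr Z"
    using mul_zappa_szep_closed a b y a_eq b_eq by blast
  show "Dom Z (a \<cdot>\<^bsub>Z\<^esub> b) = Dom Z b" "Ran Z (a \<cdot>\<^bsub>Z\<^esub> b) = Ran Z a"
    using x y xy a_eq b_eq by (simp_all add: act_closed res_closed dom_res G.arrow_simps C.arrow_simps)
  assume c: "c \<in> Arr Z" and bc: "Dom Z b = Ran Z c"
  obtain z k where c_eq: "c = (z, k)" by fastforce
  have z: "z \<in> Arr C" "k \<in> Arr G" "j (Dom C z) = Ran G k" "Dom G h = j (Ran C z)"
    using b c bc b_eq c_eq composable_zappa_szep by (auto simp: mem_zappa_szep)
  have yz: "Dom C y = Ran C (act h z)"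
    using y z composite_defined[of y h z] by (simp add: mem_zappa_szep)
  have gy: "act g y \<in> Arr C" "res g y \<in> Arr G" "act h z \<in> Arr C" "res h z \<in> Arr G"
    "Dom G (res g y) = Ran G h"
    using x y z by (simp_all add: act_closed res_closed dom_res)
  have hz: "Ran G h = j (Ran C (act h z))"
    using C1 y z by simp
  have "Dom C (act g y) = Ran C (act (res g y) (act h z))"
    using composite_defined[of "act g y" "res g y" "act h z"] x y gy hz
    by (simp add: mem_zappa_szep ran_res)
  moreover have "act (res g y) (act h z) \<in> Arr C" "res (res g y) (act h z) \<in> Arr G"
    "Dom G (res (res g y) (act h z)) = Ran G (res h z)"
    using gy hz y z by (simp_all add: act_closed res_closed dom_res ran_res)
  ultimately show "a \<cdot>\<^bsub>Z\<^esub> b \<cdot>\<^bsub>Z\<^esub> c = a \<cdot>\<^bsub>Z\<^esub> (b \<cdot>\<^bsub>Z\<^esub> c)"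
    using x y z xy yz gy hz a_eq b_eq c_eq
    by (simp add: SS2 SS6 SS7 SS8 C.arrow_simps G.arrow_simps dom_res)
qed


section \<open>Zappa-Szep products over free categories are left Rees\<close>

text \<open>
From \<open>x (g \<cdot> y) = x (g \<cdot> z)\<close> one cancels \<open>x\<close> and then \<open>g\<close>, which acts injectively; after that the second
coordinates can be cancelled in the groupoid.
\<close>
lemma left_cancellative_zappa_szep:
  assumes "left_cancellative C"
  shows "left_cancellative Z"
  unfolding left_cancellative_def
proof (intro ballI impI)
  fix a b c
  assume abc: "a \<in> Arr Z" "b \<in> Arr Z" "c \<in> Arr Z"
    "Dom Z a = Ran Z b \<and> Dom Z a = Ran Z c \<and> a \<cdot>\<^bsub>Z\<^esub> b = a \<cdot>\<^bsub>Z\<^esub> c"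
  obtain x g y h z k where eqs: "a = (x, g)" "b = (y, h)" "c = (z, k)"
    by (metis surj_pair)
  have x: "x \<in> Arr C" "g \<in> Arr G" "j (Dom C x) = Ran G g"
    "y \<in> Arr C" "h \<in> Arr G" "j (Dom C y) = Ran G h" "Dom G g = j (Ran C y)"
    "z \<in> Arr C" "k \<in> Arr G" "j (Dom C z) = Ran G k" "Dom G g = j (Ran C z)"
    using abc eqs composable_zappa_szep[of x g y h] composable_zappa_szep[of x g z k]
    by (auto simp: mem_zappa_szep)
  have "Dom C x = Ran C (act g y)" "Dom C x = Ran C (act g z)"
    using composite_defined[of x g y] composite_defined[of x g z] abc(1) x eqs by simp_all
  moreover have "x \<cdot>\<^bsub>C\<^esub> act g y = x \<cdot>\<^bsub>C\<^esub> act g z" and res_eq: "res g y \<cdot>\<^bsub>G\<^esub> h = res g z \<cdot>\<^bsub>G\<^esub> k"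
    using abc eqs by simp_all
  ultimately have "act g y = act g z"
    using assms x act_closed unfolding left_cancellative_def by blast
  then have "y = z"
    using act_ginv_act x by metis
  moreover have "h = k"
    using res_eq x \<open>y = z\<close> G.left_cancel[of "res g y" h k] by (simp add: res_closed dom_res)
  ultimately show "b = c"
    using eqs by simp
qed

text \<open>
The arrows whose first coordinate is a multiple of \<open>x\<close>. Because \<open>G\<close> is a groupoid, this is the principal
right ideal of \<open>(x, g)\<close> for every \<open>g\<close>.
\<close>
definition extensions :: "'c \<Rightarrow> ('c \<times> 'g) set" where
  "extensions x = {(x \<cdot>\<^bsub>C\<^esub> y, k) | y k. y \<in> Arr C \<and> Dom C x = Ran C y \<and> (y, k) \<in> Arr Z}"

lemma principal_right_ideal_zappa_szep:
  assumes "(x, g) \<in> Arr Z"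
  shows "principal_right_ideal Z (x, g) = extensions x"
proof
  have x: "x \<in> Arr C" "g \<in> Arr G" "j (Dom C x) = Ran G g"
    using assms by (simp_all add: mem_zappa_szep)
  show "principal_right_ideal Z (x, g) \<subseteq> extensions x"
  proof
    fix b assume "b \<in> principal_right_ideal Z (x, g)"
    then obtain y h where b: "b = (x \<cdot>\<^bsub>C\<^esub> act g y, res g y \<cdot>\<^bsub>G\<^esub> h)" "(y, h) \<in> Arr Z"
      "Dom Z (x, g) = Ran Z (y, h)"
      by (auto simp: principal_right_ideal_def)
    have g: "Dom G g = j (Ran C y)"
      using composable_zappa_szep[OF assms b(2)] b(3) by simp
    have "(act g y, res g y \<cdot>\<^bsub>G\<^esub> h) \<in> Arr Z"
      using b(2) g x
      by (auto simp: mem_zappa_szep act_closed res_closed G.arrow_simps dom_res ran_res)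
    then show "b \<in> extensions x"
      using b(1) composite_defined[OF assms _ g] b(2)
      by (auto simp: extensions_def mem_zappa_szep)
  qed
  show "extensions x \<subseteq> principal_right_ideal Z (x, g)"
  proof
    fix b assume "b \<in> extensions x"
    then obtain y k where b: "b = (x \<cdot>\<^bsub>C\<^esub> y, k)" "y \<in> Arr C" "Dom C x = Ran C y" "k \<in> Arr G"
      "j (Dom C y) = Ran G k"
      by (auto simp: extensions_def mem_zappa_szep)
    \<comment> \<open>Undo the action of \<open>g\<close> on both coordinates.\<close>
    define y' where "y' = act (G.ginv g) y"
    define h where "h = G.ginv (res g y') \<cdot>\<^bsub>G\<^esub> k"
    have g': "G.ginv g \<in> Arr G" "Dom G (G.ginv g) = j (Ran C y)"
      using x b by (simp_all add: G.inverse_simps)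
    have y': "y' \<in> Arr C" "act g y' = y" "Dom G g = j (Ran C y')"
      using x b g' by (simp_all add: y'_def act_closed act_act_ginv C1 G.inverse_simps)
    have r: "res g y' \<in> Arr G" "Ran G (res g y') = Ran G k" "Dom G (res g y') = j (Dom C y')"
      using x y' b by (simp_all add: res_closed ran_res dom_res)
    have h: "(y', h) \<in> Arr Z" "res g y' \<cdot>\<^bsub>G\<^esub> h = k"
      using y' r b by (simp_all add: mem_zappa_szep h_def G.inverse_simps G.arrow_simps)
    moreover have "b = (x, g) \<cdot>\<^bsub>Z\<^esub> (y', h)"
      using b h(2) y' by simp
    moreover have "Dom Z (x, g) = Ran Z (y', h)"
      using composable_zappa_szep[OF assms h(1)] y'(3) by blast
    ultimately show "b \<in> principal_right_ideal Z (x, g)"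
      unfolding principal_right_ideal_def by blast
  qed
qed

lemma extensions_antimono:
  assumes "x \<in> Arr C" "z \<in> Arr C" "Dom C x = Ran C z"
  shows "extensions (x \<cdot>\<^bsub>C\<^esub> z) \<subseteq> extensions x"
proof
  fix b assume "b \<in> extensions (x \<cdot>\<^bsub>C\<^esub> z)"
  then obtain y k where "b = (x \<cdot>\<^bsub>C\<^esub> z \<cdot>\<^bsub>C\<^esub> y, k)" "y \<in> Arr C" "Dom C z = Ran C y" "(y, k) \<in> Arr Z"
    using assms by (auto simp: extensions_def C.arrow_simps)
  then have "b = (x \<cdot>\<^bsub>C\<^esub> (z \<cdot>\<^bsub>C\<^esub> y), k)" "z \<cdot>\<^bsub>C\<^esub> y \<in> Arr C" "Dom C x = Ran C (z \<cdot>\<^bsub>C\<^esub> y)"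
    "(z \<cdot>\<^bsub>C\<^esub> y, k) \<in> Arr Z"
    using assms by (auto simp: C.arrow_simps mem_zappa_szep)
  then show "b \<in> extensions x"
    unfolding extensions_def by blast
qed

end

locale free_self_similar_action =
  wf_digraph \<G> + self_similar_action G "free_category \<G>" j act res
  for G :: "'g arrow_cat" and \<G> :: "('v, 'e) pre_digraph"
    and j :: "('v, 'e) path \<Rightarrow> 'g"
    and act :: "'g \<Rightarrow> ('v, 'e) path \<Rightarrow> ('v, 'e) path"
    and res :: "'g \<Rightarrow> ('v, 'e) path \<Rightarrow> 'g"
begin

abbreviation F :: "('v, 'e) path arrow_cat" where
  "F \<equiv> free_category \<G>"

lemma left_cancellative_free: "left_cancellative F"
  by (auto simp: left_cancellative_def)

text \<open>
If two ideals meet, then \<open>x\<close> and \<open>x'\<close> are prefixes of a common path, so one is a prefix of the other.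
\<close>
lemma extensions_rigid:
  assumes "x \<in> Arr F" "x' \<in> Arr F" "extensions x \<inter> extensions x' \<noteq> {}"
  shows "extensions x \<subseteq> extensions x' \<or> extensions x' \<subseteq> extensions x"
proof -
  obtain b where "b \<in> extensions x" "b \<in> extensions x'"
    using assms(3) by blast
  then obtain y y' where y: "y \<in> Arr F" "Dom F x = Ran F y" "y' \<in> Arr F" "Dom F x' = Ran F y'"
    "fst b = x \<cdot>\<^bsub>F\<^esub> y" "fst b = x' \<cdot>\<^bsub>F\<^esub> y'"
    unfolding extensions_def by auto
  obtain v p w q u where x: "x = (v, p, w)" "y = (w, q, u)"
    using y(2) by (cases x, cases y) auto
  obtain v' p' w' q' u' where x': "x' = (v', p', w')" "y' = (w', q', u')"
    using y(4) by (cases x', cases y') auto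
  have eqs: "v' = v" "u' = u" "p @ q = p' @ q'"
    using y(5,6) x x' by auto
  then consider r where "p = p' @ r" "r @ q = q'" | r where "p' = p @ r" "q = r @ q'"
    by (auto simp: append_eq_append_conv2)
  then show ?thesis
  proof cases
    case 1
    then have "(w', r, w) \<in> Arr F"
      using y(1,3) x x' eqs path_append_iff[of w' r q u] path_start_unique[of _ q u] by blast
    then have "extensions (x' \<cdot>\<^bsub>F\<^esub> (w', r, w)) \<subseteq> extensions x'"
      using assms(2) x' by (intro extensions_antimono) simp_all
    then show ?thesis
      using 1 x x' eqs by simp
  next
    case 2
    then have "(w, r, w') \<in> Arr F"
      using y(1,3) x x' eqs path_append_iff[of w r q' u] path_start_unique[of _ q' u] by blast
    then have "extensions (x \<cdot>\<^bsub>F\<^esub> (w, r, w')) \<subseteq> extensions x"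
      using assms(1) x by (intro extensions_antimono) simp_all
    then show ?thesis
      using 2 x x' eqs by simp
  qed
qed

text \<open>
A prefix of a path is determined by its list of edges and its domain, and the latter is the tail of an
edge of the path unless the prefix is empty.
\<close>
lemma finite_prefixes:
  assumes "x \<in> Arr F"
  shows "finite {x' \<in> Arr F. \<exists>y \<in> Arr F. Dom F x' = Ran F y \<and> x = x' \<cdot>\<^bsub>F\<^esub> y}"
proof -
  obtain v p u where x: "x = (v, p, u)" by (cases x)
  let ?S = "{v} \<times> (\<lambda>n. take n p) ` {..length p} \<times> insert v (tail \<G> ` set p)"
  have "(v', p', w) \<in> ?S" if "(v', p', w) \<in> Arr F" "x = (v', p', w) \<cdot>\<^bsub>F\<^esub> y" for v' p' w y
  proof -
    obtain a q b where "y = (a, q, b)" by (cases y)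
    then have eqs: "v' = v" "p = p' @ q"
      using that(2) x by simp_all
    then have "p' = take (length p') p" "length p' \<le> length p"
      by auto
    moreover have "w \<in> insert v (tail \<G> ` set p)"
      using that(1) eqs
      by (cases p' rule: rev_cases) (auto simp: path_append_iff path_Cons_iff path_Nil_iff)
    ultimately show ?thesis
      using eqs by blast
  qed
  then have "x' \<in> ?S" if "x' \<in> Arr F" "x = x' \<cdot>\<^bsub>F\<^esub> y" for x' y
    using that by (cases x') blast
  then have "{x' \<in> Arr F. \<exists>y \<in> Arr F. Dom F x' = Ran F y \<and> x = x' \<cdot>\<^bsub>F\<^esub> y} \<subseteq> ?S"
    by blast
  then show ?thesis
    by (rule finite_subset) simp
qed

text \<open>
An ideal that contains the ideal of \<open>(x, g)\<close> contains \<open>(x, g)\<close> and is therefore given by a prefix of \<open>x\<close>.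
\<close>
theorem left_Rees_zappa_szep: "left_Rees_category Z"
  unfolding left_Rees_category_def
proof (intro conjI ballI)
  show "category Z" "left_cancellative Z"
    by (rule category_zappa_szep left_cancellative_zappa_szep[OF left_cancellative_free])+
  show "right_rigid Z"
    unfolding right_rigid_def
  proof (intro ballI impI)
    fix a b
    assume ab: "a \<in> Arr Z" "b \<in> Arr Z"
      "principal_right_ideal Z a \<inter> principal_right_ideal Z b \<noteq> {}"
    have "principal_right_ideal Z a = extensions (fst a)" "fst a \<in> Arr F"
      "principal_right_ideal Z b = extensions (fst b)" "fst b \<in> Arr F"
      using ab principal_right_ideal_zappa_szep[of "fst a" "snd a"]
        principal_right_ideal_zappa_szep[of "fst b" "snd b"] mem_zappa_szep[of "fst a" "snd a"]
        mem_zappa_szep[of "fst b" "snd b"]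
      by simp_all
    then show "principal_right_ideal Z a \<subseteq> principal_right_ideal Z b
        \<or> principal_right_ideal Z b \<subseteq> principal_right_ideal Z a"
      using ab(3) extensions_rigid by simp
  qed
  fix a assume a: "a \<in> Arr Z"
  obtain x g where a_eq: "a = (x, g)" by fastforce
  let ?S = "{x' \<in> Arr F. \<exists>y \<in> Arr F. Dom F x' = Ran F y \<and> x = x' \<cdot>\<^bsub>F\<^esub> y}"
  have x: "x \<in> Arr F" "(x, g) \<in> Arr Z"
    using a a_eq by (auto simp: mem_zappa_szep)
  have "P \<in> extensions ` ?S"
    if P: "P \<in> principal_right_ideal Z ` Arr Z" "principal_right_ideal Z a \<subset> P" for P
  proof -
    obtain x' g' where x': "(x', g') \<in> Arr Z" "P = extensions x'"
      using P(1) by (auto simp: principal_right_ideal_zappa_szep)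
    have "(Dom F x, g) \<in> Arr Z"
      using x by (simp add: mem_zappa_szep C.arrow_simps)
    then have "(x, g) \<in> extensions x"
      unfolding extensions_def mem_Collect_eq
      using x by (intro exI[of _ "Dom F x"] exI[of _ g]) (simp add: C.arrow_simps)
    then have "(x, g) \<in> extensions x'"
      using P(2) x' a_eq x by (auto simp: principal_right_ideal_zappa_szep)
    then have "x' \<in> ?S"
      using x'(1) unfolding extensions_def mem_zappa_szep by blast
    then show ?thesis
      using x'(2) by blast
  qed
  then have "{P \<in> principal_right_ideal Z ` Arr Z. principal_right_ideal Z a \<subset> P} \<subseteq> extensions ` ?S"
    by blast
  then show "finite {P \<in> principal_right_ideal Z ` Arr Z. principal_right_ideal Z a \<subset> P}"
    by (rule finite_subset) (simp add: finite_prefixes x)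
qed

end

text \<open>
The left Rees conditions speak of composition and of inclusions between principal right ideals, both of
which an isomorphism preserves and reflects.
\<close>
lemma principal_right_ideal_iso:
  assumes "cat_iso C D F" "x \<in> Arr C"
  shows "principal_right_ideal D (F x) = F ` principal_right_ideal C x"
proof
  have "cat_functor C D F" and bij: "bij_betw F (Arr C) (Arr D)"
    using assms by (auto simp: cat_iso_def)
  note F = cat_functorD[OF this(1)]
  show "F ` principal_right_ideal C x \<subseteq> principal_right_ideal D (F x)"
  proof
    fix z assume "z \<in> F ` principal_right_ideal C x"
    then obtain y where y: "y \<in> Arr C" "Dom C x = Ran C y" "z = F (x \<cdot>\<^bsub>C\<^esub> y)"
      by (auto simp: principal_right_ideal_def)
    then have "z = F x \<cdot>\<^bsub>D\<^esub> F y" "F y \<in> Arr D" "Dom D (F x) = Ran D (F y)"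
      using assms(2) F(3)[of y] F(4)[of x] F(5)[of y] F(6)[of x y] by simp_all
    then show "z \<in> principal_right_ideal D (F x)"
      by (auto simp: principal_right_ideal_def)
  qed
  show "principal_right_ideal D (F x) \<subseteq> F ` principal_right_ideal C x"
  proof
    fix z assume "z \<in> principal_right_ideal D (F x)"
    then obtain y' where "y' \<in> Arr D" "z = F x \<cdot>\<^bsub>D\<^esub> y'" "Dom D (F x) = Ran D y'"
      by (auto simp: principal_right_ideal_def)
    moreover then obtain y where y: "y \<in> Arr C" "y' = F y"
      using bij by (auto simp: bij_betw_def)
    ultimately have "F (Dom C x) = F (Ran C y)" and z: "z = F x \<cdot>\<^bsub>D\<^esub> F y"
      using F(4)[of x] F(5)[of y] assms(2) by simp_all
    then have "Dom C x = Ran C y"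
      using inj_onD[OF bij_betw_imp_inj_on[OF bij]] assms(2) y(1)
        category.dom_closed[OF F(1)] category.ran_closed[OF F(1)] by blast
    moreover from this have "z = F (x \<cdot>\<^bsub>C\<^esub> y)"
      using z F(6)[of x y] assms(2) y(1) by simp
    ultimately show "z \<in> F ` principal_right_ideal C x"
      using y(1) by (auto simp: principal_right_ideal_def)
  qed
qed

lemma left_Rees_category_iso:
  assumes "cat_iso C D F" "left_Rees_category D"
  shows "left_Rees_category C"
  unfolding left_Rees_category_def
proof (intro conjI ballI)
  have "cat_functor C D F" and bij: "bij_betw F (Arr C) (Arr D)"
    using assms by (auto simp: cat_iso_def)
  note F = cat_functorD[OF this(1)]
  have inj: "inj_on F (Arr C)" and onto: "F ` Arr C = Arr D"
    using bij by (auto simp: bij_betw_def)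
  note ideal = principal_right_ideal_iso[OF assms(1)]
  have ideal_sub: "principal_right_ideal C x \<subseteq> Arr C" if "x \<in> Arr C" for x
    using that category.mul_closed[OF F(1)] by (auto simp: principal_right_ideal_def)
  have D: "left_cancellative D" "right_rigid D"
    "\<And>x. x \<in> Arr D \<Longrightarrow>
       finite {P \<in> principal_right_ideal D ` Arr D. principal_right_ideal D x \<subset> P}"
    using assms(2) by (auto simp: left_Rees_category_def)
  show "category C" by (rule F(1))
  show "left_cancellative C"
    unfolding left_cancellative_def
  proof (intro ballI impI)
    fix x y z
    assume xyz: "x \<in> Arr C" "y \<in> Arr C" "z \<in> Arr C"
      "Dom C x = Ran C y \<and> Dom C x = Ran C z \<and> x \<cdot>\<^bsub>C\<^esub> y = x \<cdot>\<^bsub>C\<^esub> z"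
    then have "F x \<cdot>\<^bsub>D\<^esub> F y = F x \<cdot>\<^bsub>D\<^esub> F z"
      using F(6)[of x y] F(6)[of x z] by metis
    moreover have "Dom D (F x) = Ran D (F y)" "Dom D (F x) = Ran D (F z)"
      using xyz F(4)[of x] F(5)[of y] F(5)[of z] by metis+
    ultimately have "F y = F z"
      using D(1) xyz F(3) unfolding left_cancellative_def by blast
    then show "y = z"
      using inj xyz by (simp add: inj_on_eq_iff)
  qed
  have image_sub_iff: "F ` A \<subseteq> F ` B \<longleftrightarrow> A \<subseteq> B" if "A \<subseteq> Arr C" "B \<subseteq> Arr C" for A B
    using that inj_on_image_mem_iff[OF inj] by blast
  have sub_iff: "principal_right_ideal D (F x) \<subseteq> principal_right_ideal D (F y)
      \<longleftrightarrow> principal_right_ideal C x \<subseteq> principal_right_ideal C y"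
    if "x \<in> Arr C" "y \<in> Arr C" for x y
    using that image_sub_iff by (simp add: ideal ideal_sub)
  show "right_rigid C"
    unfolding right_rigid_def
  proof (intro ballI impI)
    fix x y
    assume xy: "x \<in> Arr C" "y \<in> Arr C"
      "principal_right_ideal C x \<inter> principal_right_ideal C y \<noteq> {}"
    then have "principal_right_ideal D (F x) \<inter> principal_right_ideal D (F y) \<noteq> {}"
      by (auto simp: ideal)
    then show "principal_right_ideal C x \<subseteq> principal_right_ideal C y
        \<or> principal_right_ideal C y \<subseteq> principal_right_ideal C x"
      using D(2) xy F(3) sub_iff unfolding right_rigid_def by metis
  qed
  fix x assume x: "x \<in> Arr C"
  let ?A = "{P \<in> principal_right_ideal C ` Arr C. principal_right_ideal C x \<subset> P}"
  have "(`) F ` ?A \<subseteq> {P \<in> principal_right_ideal D ` Arr D. principal_right_ideal D (F x) \<subset> P}"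
  proof
    fix Q assume "Q \<in> (`) F ` ?A"
    then obtain y where y: "y \<in> Arr C" "Q = F ` principal_right_ideal C y"
      "principal_right_ideal C x \<subset> principal_right_ideal C y"
      by auto
    then show "Q \<in> {P \<in> principal_right_ideal D ` Arr D. principal_right_ideal D (F x) \<subset> P}"
      using F(3) x sub_iff[of x y] sub_iff[of y x] ideal[of y] by fast
  qed
  then have "finite ((`) F ` ?A)"
    using D(3)[OF F(3)[OF x]] by (rule finite_subset)
  moreover have "inj_on ((`) F) ?A"
    using inj by (intro inj_on_subset[OF inj_on_image_Pow[OF inj]]) (use ideal_sub in auto)
  ultimately show "finite ?A"
    by (rule finite_imageD)
qed


section \<open>The universal property of category HNN-extensions\<close>

lemma hnn_graph_simps [simp]:
  "verts (hnn_graph K I e f) = verts K"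
  "Inl k \<in> arcs (hnn_graph K I e f) \<longleftrightarrow> k \<in> arcs K"
  "Inr i \<in> arcs (hnn_graph K I e f) \<longleftrightarrow> i \<in> I"
  "head (hnn_graph K I e f) (Inl k) = head K k" "tail (hnn_graph K I e f) (Inl k) = tail K k"
  "head (hnn_graph K I e f) (Inr i) = e i" "tail (hnn_graph K I e f) (Inr i) = f i"
  by (auto simp: hnn_graph_def)

locale hnn_presentation = B: category B
  for B :: "'a arrow_cat" +
  fixes K :: "('a, 'k) pre_digraph"
    and R :: "(('a, 'k) path \<times> ('a, 'k) path) set"
    and \<epsilon> :: "('a, 'k) path set \<Rightarrow> 'a"
    and I :: "'i set" and H :: "'i \<Rightarrow> 'a set" and \<alpha> :: "'i \<Rightarrow> 'a \<Rightarrow> 'a"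
    and e f :: "'i \<Rightarrow> 'a"
  assumes presentation: "category_presentation B K R \<epsilon>"
    and data: "hnn_data B I H \<alpha> e f"
begin

abbreviation T :: "('a, 'k + 'i) pre_digraph" where
  "T \<equiv> hnn_graph K I e f"

abbreviation S :: "(('a, 'k + 'i) path \<times> ('a, 'k + 'i) path) set" where
  "S \<equiv> hnn_relations K R \<epsilon> I H \<alpha> e f"

abbreviation N :: "('a, 'k + 'i) path set arrow_cat" where
  "N \<equiv> hnn_category K R \<epsilon> I H \<alpha> e f"

lemma
  assumes "i \<in> I"
  shows e_Obj: "e i \<in> Obj B" and f_Obj: "f i \<in> Obj B"
  using data assms by (auto simp: hnn_data_def)

lemma H_local:
  assumes "i \<in> I" "x \<in> H i"
  shows "x \<in> Arr B" "Dom B x = e i" "Ran B x = e i"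
    and "\<alpha> i x \<in> Arr B" "Dom B (\<alpha> i x) = f i" "Ran B (\<alpha> i x) = f i"
proof -
  have "H i \<subseteq> carrier (local_monoid B (e i))" "\<alpha> i ` H i \<subseteq> carrier (local_monoid B (f i))"
    using data assms(1) by (auto simp: hnn_data_def submonoid_def)
  then have "x \<in> carrier (local_monoid B (e i))" "\<alpha> i x \<in> carrier (local_monoid B (f i))"
    using assms(2) by auto
  then show "x \<in> Arr B" "Dom B x = e i" "Ran B x = e i"
    "\<alpha> i x \<in> Arr B" "Dom B (\<alpha> i x) = f i" "Ran B (\<alpha> i x) = f i"
    by (simp_all add: B.mem_local_monoid)
qed

lemma wf_K: "wf_digraph K" and verts_K: "verts K = Obj B"
  and R_parallel: "R \<subseteq> parallel_pairs (free_category K)"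
  and iso_\<epsilon>: "cat_iso (presented_category K R) B \<epsilon>"
  and \<epsilon>_vertex: "v \<in> Obj B \<Longrightarrow> \<epsilon> (path_class K R (v, [], v)) = v"
  using presentation by (auto simp: category_presentation_def)

end

sublocale hnn_presentation \<subseteq> K: wf_digraph K
  by (rule wf_K)

sublocale hnn_presentation \<subseteq> P: generated_congruence "free_category K" R
  by (intro generated_congruence.intro generated_congruence_axioms.intro
      K.category_free_category R_parallel)

sublocale hnn_presentation \<subseteq> T: wf_digraph "hnn_graph K I e f"
  using K.wellformed B.ObjD e_Obj f_Obj
  by unfold_locales (auto simp: hnn_graph_def verts_K)

context hnn_presentation
begin

text \<open>
The evaluation of paths in the base category; two paths are congruent iff it takes the same value on them.
\<close>
definition val :: "('a, 'k) path \<Rightarrow> 'a" where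
  "val p = \<epsilon> (path_class K R p)"

lemma functor_val: "cat_functor (free_category K) B val"
proof -
  have "cat_functor (quotient_category (free_category K) (cat_congruence (free_category K) R)) B \<epsilon>"
    using iso_\<epsilon> by (simp add: cat_iso_def presented_category_def)
  from cat_functor_comp[OF P.functor_cls this] show ?thesis
    by (simp add: val_def[abs_def] path_class_def comp_def)
qed

lemmas val_simps = cat_functorD(3-6)[OF functor_val]

lemma val_vertex: "v \<in> Obj B \<Longrightarrow> val (v, [], v) = v"
  using \<epsilon>_vertex by (simp add: val_def)

lemma val_ends:
  assumes "(v, p, u) \<in> Arr (free_category K)"
  shows "Dom B (val (v, p, u)) = u" "Ran B (val (v, p, u)) = v"
  using val_simps(2,3)[OF assms] K.path_verts[OF assms] by (simp_all add: val_vertex verts_K)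

lemma val_surj:
  assumes "x \<in> Arr B"
  obtains p where "p \<in> Arr (free_category K)" "val p = x"
proof -
  have "\<epsilon> ` Arr (presented_category K R) = Arr B"
    using iso_\<epsilon> by (auto simp: cat_iso_def bij_betw_def)
  then have "x \<in> \<epsilon> ` P.cls ` Arr (free_category K)"
    using assms by (simp add: presented_category_def P.quotient_Arr)
  then obtain p where "p \<in> Arr (free_category K)" "x = \<epsilon> (P.cls p)"
    by blast
  then show ?thesis
    by (intro that) (simp_all add: val_def path_class_def)
qed

lemma val_eq_imp_congruent:
  assumes "p \<in> Arr (free_category K)" "q \<in> Arr (free_category K)" "val p = val q"
  shows "(p, q) \<in> cat_congruence (free_category K) R"
proof -
  have "inj_on \<epsilon> (Arr (presented_category K R))"
    using iso_\<epsilon> by (auto simp: cat_iso_def bij_betw_def)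
  then have "P.cls p = P.cls q"
    using assms
    by (simp add: presented_category_def P.quotient_Arr val_def path_class_def inj_on_eq_iff)
  then show ?thesis
    using P.cls_eq_iff assms by blast
qed

lemma lift_path_closed:
  "(v, map Inl p, u) \<in> Arr (free_category T) \<longleftrightarrow> (v, p, u) \<in> Arr (free_category K)"
  by (induction p arbitrary: v)
    (auto simp: T.path_Nil_iff K.path_Nil_iff T.path_Cons_iff K.path_Cons_iff)

lemma functor_lift_path: "cat_functor (free_category K) (free_category T) lift_path"
  by (rule cat_functorI)
    (auto simp: lift_path_def lift_path_closed T.category_free_category K.category_free_category)

lemmas lift_simps = cat_functorD(3-6)[OF functor_lift_path]

lemma stable_letter_eq: "stable_letter e f i = edge_path T (Inr i)"
  by (simp add: stable_letter_def)

lemma stable_letter_closed: "i \<in> I \<Longrightarrow> stable_letter e f i \<in> Arr (free_category T)"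
  unfolding stable_letter_eq by (rule T.edge_path_closed) simp

lemma slide_relation:
  assumes "i \<in> I" "p \<in> Arr (free_category K)" "q \<in> Arr (free_category K)"
    and "val p \<in> H i" "val q = \<alpha> i (val p)"
  shows "(lift_path p \<cdot>\<^bsub>free_category T\<^esub> stable_letter e f i,
      stable_letter e f i \<cdot>\<^bsub>free_category T\<^esub> lift_path q) \<in> S"
  unfolding hnn_relations_def val_def[symmetric] using assms by blast

lemma relation_cases [consumes 1, case_names base stable]:
  assumes "(x, y) \<in> S"
  obtains p q where "(p, q) \<in> R" "x = lift_path p" "y = lift_path q"
  | i p q where "i \<in> I" "p \<in> Arr (free_category K)" "q \<in> Arr (free_category K)"
      "val p \<in> H i" "val q = \<alpha> i (val p)"
      "x = lift_path p \<cdot>\<^bsub>free_category T\<^esub> stable_letter e f i"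
      "y = stable_letter e f i \<cdot>\<^bsub>free_category T\<^esub> lift_path q"
  using assms unfolding hnn_relations_def val_def by blast

text \<open>
The generated quotient is a category because \<open>x\<close> is a loop at \<open>e i\<close> and \<open>\<alpha>\<^sub>i(x)\<close> a loop at \<open>f i\<close>, so that
both sides of \<open>x t\<^sub>i = t\<^sub>i \<alpha>\<^sub>i(x)\<close> run from \<open>f i\<close> to \<open>e i\<close>.
\<close>
lemma S_parallel: "S \<subseteq> parallel_pairs (free_category T)"
proof (rule subrelI)
  fix x y assume "(x, y) \<in> S"
  then show "(x, y) \<in> parallel_pairs (free_category T)"
  proof (cases rule: relation_cases)
    case (base p q)
    then have "(p, q) \<in> parallel_pairs (free_category K)"
      using R_parallel by blast
    then show ?thesis
      using base(2,3) by (simp add: parallel_pairs_def lift_simps)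
  next
    case (stable i p q)
    obtain v p' u where p: "p = (v, p', u)" by (cases p)
    obtain w q' z where q: "q = (w, q', z)" by (cases q)
    have "u = e i" "v = e i"
      using val_ends[of v p' u] H_local(2,3)[OF stable(1,4)] stable(2) p by simp_all
    moreover have "z = f i" "w = f i"
      using val_ends[of w q' z] H_local(5,6)[OF stable(1,4)] stable(3,5) q by simp_all
    moreover have "(v, map Inl p', u) \<in> Arr (free_category T)"
        "(w, map Inl q', z) \<in> Arr (free_category T)"
      using stable(2,3) p q lift_path_closed by simp_all
    moreover have "(e i, [Inr i], f i) \<in> Arr (free_category T)"
      using stable_letter_closed[OF stable(1)] by (simp add: stable_letter_def)
    ultimately have "(e i, map Inl p' @ [Inr i], f i) \<in> Arr (free_category T)"
      "(e i, [Inr i] @ map Inl q', f i) \<in> Arr (free_category T)"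
      unfolding T.path_append_iff by blast+
    then show ?thesis
      using stable(6,7) p q \<open>v = e i\<close> \<open>z = f i\<close>
      by (simp add: parallel_pairs_def lift_path_def stable_letter_def)
  qed
qed

end

sublocale hnn_presentation \<subseteq>
  Q: generated_congruence "free_category (hnn_graph K I e f)" "hnn_relations K R \<epsilon> I H \<alpha> e f"
  by (intro generated_congruence.intro generated_congruence_axioms.intro
      T.category_free_category S_parallel)

context hnn_presentation
begin

lemma functor_cls_N: "cat_functor (free_category T) N Q.cls"
  using Q.functor_cls by (simp add: hnn_category_def presented_category_def)

lemma Arr_N: "Arr N = Q.cls ` Arr (free_category T)"
  using Q.quotient_Arr by (simp add: hnn_category_def presented_category_def)

sublocale N: category N
  by (rule cat_functorD(2)[OF functor_cls_N])

text \<open>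
The relations of the base category are among those of the HNN-extension. The class of a lifted path thus
depends only on the arrow that the path represents, which makes \<open>\<iota>\<close> below well defined.
\<close>
lemma congruent_lift:
  "(p, q) \<in> cat_congruence (free_category K) R
     \<Longrightarrow> (lift_path p, lift_path q) \<in> cat_congruence (free_category T) S"
proof (induction rule: cat_congruence.induct)
  case (base x y)
  then have "(lift_path x, lift_path y) \<in> S"
    unfolding hnn_relations_def by blast
  then show ?case by (rule cat_congruence.base)
next
  case (mul x y u v)
  then have "(x, y) \<in> parallel_pairs (free_category K)" "(u, v) \<in> parallel_pairs (free_category K)"
    using P.congruence_parallel by auto
  then show ?case
    using mul cat_congruence.mul[OF mul.IH] lift_simps by (simp add: parallel_pairs_def)
qed (auto simp: lift_simps intro: cat_congruence.refl cat_congruence.sym cat_congruence.trans)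

text \<open>
The canonical functor from the base category to its HNN-extension. By \<open>\<iota>_val\<close>, every path that represents
\<open>x\<close> gives the same class.
\<close>
definition \<iota> :: "'a \<Rightarrow> ('a, 'k + 'i) path set" where
  "\<iota> x = Q.cls (lift_path (SOME p. p \<in> Arr (free_category K) \<and> val p = x))"

definition t :: "'i \<Rightarrow> ('a, 'k + 'i) path set" where
  "t i = Q.cls (stable_letter e f i)"

lemma \<iota>_val:
  assumes "p \<in> Arr (free_category K)"
  shows "\<iota> (val p) = Q.cls (lift_path p)"
proof -
  let ?q = "SOME q. q \<in> Arr (free_category K) \<and> val q = val p"
  have "?q \<in> Arr (free_category K) \<and> val ?q = val p"
    by (rule someI[where P = "\<lambda>q. q \<in> Arr (free_category K) \<and> val q = val p" and x = p])
      (simp add: assms)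
  then have "(?q, p) \<in> cat_congruence (free_category K) R"
    using assms by (intro val_eq_imp_congruent) auto
  then show ?thesis
    unfolding \<iota>_def by (intro Q.cls_eqI congruent_lift)
qed

lemma functor_\<iota>: "cat_functor B N \<iota>"
proof (rule cat_functorI)
  note F = cat_functorD[OF cat_functor_comp[OF functor_lift_path functor_cls_N], unfolded comp_def]
  fix x assume "x \<in> Arr B"
  then obtain p where p: "p \<in> Arr (free_category K)" "x = val p"
    using val_surj by metis
  show "\<iota> x \<in> Arr N" "Dom N (\<iota> x) = \<iota> (Dom B x)" "Ran N (\<iota> x) = \<iota> (Ran B x)"
    using p F by (simp_all add: \<iota>_val val_simps P.arrow_simps)
  fix y assume "y \<in> Arr B" and xy: "Dom B x = Ran B y"
  then obtain q where q: "q \<in> Arr (free_category K)" "y = val q"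
    using val_surj by metis
  have pq: "Dom (free_category K) p = Ran (free_category K) q"
    using xy p q val_ends by (cases p, cases q) auto
  then have "x \<cdot>\<^bsub>B\<^esub> y = val (p \<cdot>\<^bsub>free_category K\<^esub> q)" "p \<cdot>\<^bsub>free_category K\<^esub> q \<in> Arr (free_category K)"
    using p q by (simp_all add: val_simps P.mul_closed)
  then show "\<iota> (x \<cdot>\<^bsub>B\<^esub> y) = \<iota> x \<cdot>\<^bsub>N\<^esub> \<iota> y"
    using p q pq F(6)[of p q] by (simp add: \<iota>_val)
qed (simp_all add: B.category_axioms N.category_axioms)

lemmas \<iota>_simps = cat_functorD(3-6)[OF functor_\<iota>]

lemma vertex_N: "v \<in> Obj B \<Longrightarrow> Q.cls (v, [], v) = \<iota> v"
  using \<iota>_val[of "(v, [], v)"] by (simp add: K.path_Nil_iff verts_K val_vertex lift_path_def)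

lemma
  assumes "i \<in> I"
  shows t_closed: "t i \<in> Arr N" and Dom_t: "Dom N (t i) = \<iota> (f i)" and Ran_t: "Ran N (t i) = \<iota> (e i)"
  using stable_letter_closed[OF assms] cat_functorD[OF functor_cls_N]
    vertex_N[OF e_Obj[OF assms]] vertex_N[OF f_Obj[OF assms]]
  by (simp_all add: t_def) (simp_all add: stable_letter_def)

lemma slide:
  assumes "i \<in> I" "x \<in> H i"
  shows "\<iota> x \<cdot>\<^bsub>N\<^esub> t i = t i \<cdot>\<^bsub>N\<^esub> \<iota> (\<alpha> i x)"
proof -
  note F = cat_functorD[OF functor_cls_N]
  note loc = H_local[OF assms]
  obtain p q where p: "p \<in> Arr (free_category K)" "x = val p"
    and q: "q \<in> Arr (free_category K)" "\<alpha> i x = val q"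
    using val_surj[OF loc(1)] val_surj[OF loc(4)] by metis
  obtain v p' u where p': "p = (v, p', u)" by (cases p)
  obtain w q' z where q': "q = (w, q', z)" by (cases q)
  have ends: "u = e i" "w = f i"
    using val_ends[of v p' u] val_ends[of w q' z] p q p' q' loc by simp_all
  have "(lift_path p \<cdot>\<^bsub>free_category T\<^esub> stable_letter e f i,
      stable_letter e f i \<cdot>\<^bsub>free_category T\<^esub> lift_path q) \<in> S"
    using assms p q by (intro slide_relation) simp_all
  then have "Q.cls (lift_path p \<cdot>\<^bsub>free_category T\<^esub> stable_letter e f i)
      = Q.cls (stable_letter e f i \<cdot>\<^bsub>free_category T\<^esub> lift_path q)"
    by (intro Q.cls_eqI cat_congruence.base)
  moreover have "Q.cls (lift_path p \<cdot>\<^bsub>free_category T\<^esub> stable_letter e f i)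
      = Q.cls (lift_path p) \<cdot>\<^bsub>N\<^esub> Q.cls (stable_letter e f i)"
    using p' ends by (intro F(6) lift_simps(1) stable_letter_closed p(1) assms(1))
      (simp add: lift_path_def stable_letter_def)
  moreover have "Q.cls (stable_letter e f i \<cdot>\<^bsub>free_category T\<^esub> lift_path q)
      = Q.cls (stable_letter e f i) \<cdot>\<^bsub>N\<^esub> Q.cls (lift_path q)"
    using q' ends by (intro F(6) lift_simps(1) stable_letter_closed q(1) assms(1))
      (simp add: lift_path_def stable_letter_def)
  ultimately show ?thesis
    unfolding p(2) q(2)[unfolded p(2)] by (simp add: \<iota>_val p(1) q(1) t_def)
qed

text \<open>
An HNN-extension is generated by the images of the base category and of the stable letters. The generators
are multiplied on the right, as in \<open>free_category_induct\<close>.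
\<close>
lemma hnn_induct [consumes 1, case_names vertex base stable]:
  assumes "n \<in> Arr N"
    and vertex: "\<And>v. v \<in> Obj B \<Longrightarrow> P (\<iota> v)"
    and base: "\<And>n x. \<lbrakk>n \<in> Arr N; P n; x \<in> Arr B; Dom N n = \<iota> (Ran B x)\<rbrakk> \<Longrightarrow> P (n \<cdot>\<^bsub>N\<^esub> \<iota> x)"
    and stable: "\<And>n i. \<lbrakk>n \<in> Arr N; P n; i \<in> I; Dom N n = \<iota> (e i)\<rbrakk> \<Longrightarrow> P (n \<cdot>\<^bsub>N\<^esub> t i)"
  shows "P n"
proof -
  note F = cat_functorD[OF functor_cls_N]
  obtain p where p: "p \<in> Arr (free_category T)" "n = Q.cls p"
    using assms(1) by (auto simp: Arr_N)
  have "P (Q.cls p)"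
    using p(1)
  proof (induction p rule: T.free_category_induct)
    case (vertex v)
    then have "v \<in> Obj B" by (simp add: verts_K)
    then show ?case by (simp add: vertex_N assms(2))
  next
    case (edge p a)
    have eq: "Q.cls (p \<cdot>\<^bsub>free_category T\<^esub> edge_path T a) = Q.cls p \<cdot>\<^bsub>N\<^esub> Q.cls (edge_path T a)"
      using edge F(6) T.edge_path_closed by blast
    have dom: "Dom N (Q.cls p) = Q.cls (head T a, [], head T a)"
      using F(4)[OF edge.hyps(1)] edge.hyps(3) by simp
    show ?case
    proof (cases a)
      case (Inl k)
      then have k: "edge_path K k \<in> Arr (free_category K)"
        "edge_path T a = lift_path (edge_path K k)" "head T a = head K k"
        using edge.hyps(2) K.edge_path_closed[of k] by (auto simp: lift_path_def)
      then have "Q.cls (edge_path T a) = \<iota> (val (edge_path K k))"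
        by (simp only: \<iota>_val)
      moreover have "Dom N (Q.cls p) = \<iota> (Ran B (val (edge_path K k)))"
        using dom k val_ends[OF k(1)] vertex_N K.path_verts[OF k(1)] by (simp add: verts_K)
      ultimately show ?thesis
        using base[OF F(3)[OF edge.hyps(1)] edge.IH val_simps(1)[OF k(1)]] eq by simp
    next
      case (Inr i)
      then have i: "i \<in> I" "head T a = e i" "edge_path T a = stable_letter e f i"
        using edge.hyps(2) by (auto simp: stable_letter_def)
      then show ?thesis
        using stable[OF F(3)[OF edge.hyps(1)] edge.IH i(1)] dom vertex_N[OF e_Obj[OF i(1)]] eq
        by (simp add: t_def)
    qed
  qed
  then show ?thesis
    using p(2) by simp
qed

text \<open>
A functor on the free category is prescribed by its values on edges. It sends lifted paths to the
\<open>\<phi>\<close>-values of the arrows that they represent, so it respects the relations of the base category because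
\<open>\<phi>\<close> is well defined, and the new relations by hypothesis.
\<close>
lemma universal_property:
  assumes \<phi>: "cat_functor B D \<phi>"
    and \<tau>: "\<And>i. i \<in> I \<Longrightarrow> \<tau> i \<in> Arr D"
      "\<And>i. i \<in> I \<Longrightarrow> Dom D (\<tau> i) = \<phi> (f i)" "\<And>i. i \<in> I \<Longrightarrow> Ran D (\<tau> i) = \<phi> (e i)"
    and rel: "\<And>i x. \<lbrakk>i \<in> I; x \<in> H i\<rbrakk> \<Longrightarrow> \<phi> x \<cdot>\<^bsub>D\<^esub> \<tau> i = \<tau> i \<cdot>\<^bsub>D\<^esub> \<phi> (\<alpha> i x)"
  obtains \<Phi> where "cat_functor N D \<Phi>" "\<And>x. x \<in> Arr B \<Longrightarrow> \<Phi> (\<iota> x) = \<phi> x"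
    "\<And>i. i \<in> I \<Longrightarrow> \<Phi> (t i) = \<tau> i"
proof -
  note \<phi>_simps = cat_functorD[OF \<phi>]
  interpret D: category D by (rule \<phi>_simps(2))
  \<comment> \<open>the images of the edges of the presentation, which determine a functor on its free category\<close>
  define w where "w = case_sum (\<lambda>k. \<phi> (val (edge_path K k))) \<tau>"
  interpret W: graph_morphism T D \<phi> w
  proof unfold_locales
    fix v assume "v \<in> verts T"
    then have "v \<in> Obj B" by (simp add: verts_K)
    note v = B.ObjD[OF this]
    show "\<phi> v \<in> Obj D"
      using \<phi>_simps(3,4)[OF v(1)] v(2) by (simp add: Obj_def)
  next
    fix a assume a: "a \<in> arcs T"
    have val_edge: "val (edge_path K k) \<in> Arr B" "Dom B (val (edge_path K k)) = tail K k"
      "Ran B (val (edge_path K k)) = head K k" if "k \<in> arcs K" for k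
      using val_simps(1)[OF K.edge_path_closed[OF that]] val_ends[OF K.edge_path_closed[OF that]]
      by simp_all
    show "w a \<in> Arr D" "Dom D (w a) = \<phi> (tail T a)" "Ran D (w a) = \<phi> (head T a)"
      using a \<phi>_simps \<tau> by (cases a; simp add: w_def val_edge)+
  qed
  let ?W = "free_extension D \<phi> w"
  note W = cat_functorD[OF W.functor_free_extension]
  have W_lift: "?W (lift_path p) = \<phi> (val p)" if "p \<in> Arr (free_category K)" for p
    using that
  proof (induction p rule: K.free_category_induct)
    case (vertex v)
    then show ?case
      by (simp add: lift_path_def free_extension_vertex val_vertex verts_K)
  next
    case (edge p k)
    have k: "edge_path K k \<in> Arr (free_category K)"
      using K.edge_path_closed edge.hyps(2) by blast
    have "lift_path (edge_path K k) = edge_path T (Inl k)" "Inl k \<in> arcs T"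
      using edge.hyps(2) by (simp_all add: lift_path_def)
    then have "?W (lift_path (edge_path K k)) = \<phi> (val (edge_path K k))"
      using W.free_extension_edge[of "Inl k"] by (simp add: w_def)
    moreover have "?W (lift_path (p \<cdot>\<^bsub>free_category K\<^esub> edge_path K k))
        = ?W (lift_path p) \<cdot>\<^bsub>D\<^esub> ?W (lift_path (edge_path K k))"
      using cat_functorD(6)[OF cat_functor_comp[OF functor_lift_path W.functor_free_extension]]
        edge.hyps(1,3) k by (simp only: comp_def)
    moreover have "\<phi> (val (p \<cdot>\<^bsub>free_category K\<^esub> edge_path K k))
        = \<phi> (val p) \<cdot>\<^bsub>D\<^esub> \<phi> (val (edge_path K k))"
      using cat_functorD(6)[OF cat_functor_comp[OF functor_val \<phi>]]
        edge.hyps(1,3) k by (simp only: comp_def)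
    ultimately show ?case
      using edge.IH by simp
  qed
  have W_stable: "?W (stable_letter e f i) = \<tau> i" if "i \<in> I" for i
    using that W.free_extension_edge[of "Inr i"] by (simp add: stable_letter_eq w_def)
  have W_rel: "?W x = ?W y" if "(x, y) \<in> S" for x y
    using that
  proof (cases rule: relation_cases)
    case (base p q)
    then have "p \<in> Arr (free_category K)" "q \<in> Arr (free_category K)"
      using R_parallel by (auto simp: parallel_pairs_def)
    moreover have "val p = val q"
      using P.cls_eqI[OF cat_congruence.base[OF base(1)]] by (simp add: val_def path_class_def)
    ultimately show ?thesis
      using base by (simp add: W_lift)
  next
    case (stable i p q)
    obtain v p' u where p: "p = (v, p', u)" by (cases p)
    obtain w q' z where q: "q = (w, q', z)" by (cases q)
    have "u = e i"
      using val_ends[of v p' u] H_local(2,3)[OF stable(1,4)] stable(2) p by simp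
    then have x: "?W x = ?W (lift_path p) \<cdot>\<^bsub>D\<^esub> ?W (stable_letter e f i)"
      unfolding stable(6) using p stable(2) stable_letter_closed[OF stable(1)]
      by (intro W(6) lift_simps(1)) (simp_all add: lift_path_def stable_letter_def)
    have "w = f i"
      using val_ends[of w q' z] H_local(5,6)[OF stable(1,4)] stable(3,5) q by simp
    then have "?W y = ?W (stable_letter e f i) \<cdot>\<^bsub>D\<^esub> ?W (lift_path q)"
      unfolding stable(7) using q stable(3) stable_letter_closed[OF stable(1)]
      by (intro W(6) lift_simps(1)) (simp_all add: lift_path_def stable_letter_def)
    then show ?thesis
      using x stable rel by (simp add: W_lift W_stable)
  qed
  have "cat_functor N D (Q.induced ?W)"
    using Q.functor_induced[OF W.functor_free_extension W_rel]
    by (simp add: hnn_category_def presented_category_def)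
  moreover have "Q.induced ?W (\<iota> x) = \<phi> x" if "x \<in> Arr B" for x
  proof -
    obtain p where "p \<in> Arr (free_category K)" "x = val p"
      using val_surj[OF \<open>x \<in> Arr B\<close>] by metis
    then show ?thesis
      using Q.induced_cls[OF W.functor_free_extension W_rel] lift_simps(1)[of p]
      by (simp add: \<iota>_val W_lift)
  qed
  moreover have "Q.induced ?W (t i) = \<tau> i" if "i \<in> I" for i
    using that Q.induced_cls[OF W.functor_free_extension W_rel] stable_letter_closed[OF that]
    by (simp add: t_def W_stable)
  ultimately show ?thesis
    using that by blast
qed

end


section \<open>HNN-extensions as Zappa-Szep products\<close>

context free_self_similar_action
begin

text \<open>
The groupoid sends vertices to vertices by (SS3), and so does the inverse of each of its elements. Hence paths
of positive length stay of positive length.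
\<close>
lemma act_eq_vertex_iff:
  assumes "g \<in> Arr G" "x \<in> Arr F" "Dom G g = j (Ran F x)"
  shows "fst (snd (act g x)) = [] \<longleftrightarrow> fst (snd x) = []"
proof -
  have vertex_act: "fst (snd (act h y)) = []"
    if "h \<in> Arr G" "y \<in> Arr F" "Dom G h = j (Ran F y)" "fst (snd y) = []" for h y
  proof -
    have "y \<in> Obj F"
      using that(2,4) by (cases y) (auto simp: Obj_free path_Nil_iff)
    then have "J (Dom G h) = y"
      using that(3) C.ObjD J_j by simp
    then have "act h y = J (Ran G h)"
      using act_J[OF that(1)] by simp
    moreover have "J (Ran G h) \<in> Obj F"
      using J_closed that(1) G.Ran_in_Obj by blast
    ultimately show ?thesis
      by (auto simp: Obj_free)
  qed
  show ?thesis
    using vertex_act[OF assms] vertex_act[of "G.ginv g" "act g x"] act_ginv_act[OF assms] assms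
    by (auto simp: G.inverse_simps act_closed C1)
qed

text \<open>
If \<open>g \<cdot> a\<close> had length at least two, it would split as \<open>b q\<close> with \<open>b\<close> an edge and \<open>q\<close> of positive length,
and acting with \<open>g\<inverse>\<close> would split the edge \<open>a\<close> into two paths of positive length.
\<close>
lemma act_edge:
  assumes "g \<in> Arr G" "a \<in> arcs \<G>" "Dom G g = j (head \<G> a, [], head \<G> a)"
  obtains b where "b \<in> arcs \<G>" "act g (edge_path \<G> a) = edge_path \<G> b"
proof -
  let ?a = "edge_path \<G> a"
  have a: "?a \<in> Arr F" "Dom G g = j (Ran F ?a)"
    using assms edge_path_closed by simp_all
  obtain v p u where p: "act g ?a = (v, p, u)" by (cases "act g ?a")
  have ga: "(v, p, u) \<in> Arr F" "Ran G g = j (Ran F (v, p, u))" "p \<noteq> []"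
    using act_closed[OF assms(1) a] C1[OF assms(1) a] act_eq_vertex_iff[OF assms(1) a] p
    by simp_all
  then obtain b q where q: "p = b # q" by (cases p) auto
  then have b: "b \<in> arcs \<G>" "head \<G> b = v" "(tail \<G> b, q, u) \<in> Arr F"
    using ga(1) by (simp_all add: path_Cons_iff)
  let ?b = "edge_path \<G> b" and ?q = "(tail \<G> b, q, u)"
  have bF: "?b \<in> Arr F" using b(1) by (rule edge_path_closed)
  let ?h = "G.ginv g"
  have h: "?h \<in> Arr G" "Dom G ?h = j (Ran F ?b)"
    using assms(1) ga(2) b(2) by (simp_all add: G.inverse_simps)
  have "?a = act ?h (?b \<cdot>\<^bsub>F\<^esub> ?q)"
    using act_ginv_act[OF assms(1) a] p q b(2) by simp
  also have "\<dots> = act ?h ?b \<cdot>\<^bsub>F\<^esub> act (res ?h ?b) ?q"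
    using h b(3) bF by (intro SS8) simp_all
  finally have eq: "?a = act ?h ?b \<cdot>\<^bsub>F\<^esub> act (res ?h ?b) ?q" .
  have "fst (snd (act ?h ?b)) \<noteq> []"
    using act_eq_vertex_iff[OF h(1) bF h(2)] by simp
  then have "fst (snd (act (res ?h ?b) ?q)) = []"
    using arg_cong[OF eq, of "\<lambda>x. length (fst (snd x))"]
    by (cases "act ?h ?b"; cases "act (res ?h ?b) ?q") (auto simp: neq_Nil_conv)
  moreover have "res ?h ?b \<in> Arr G" "Dom G (res ?h ?b) = j (Ran F ?q)"
    using h bF by (simp_all add: res_closed dom_res)
  ultimately have "q = []"
    using act_eq_vertex_iff[of "res ?h ?b" ?q] b(3) by simp
  then have "act g ?a = edge_path \<G> b"
    using p q b(2,3) by (simp add: path_Nil_iff)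
  then show ?thesis
    using that b(1) by blast
qed

text \<open>
The embedding of \<open>G\<close> into the product. On the right, multiplication by its image affects only the second
coordinate (\<open>mul_\<phi>\<close>).
\<close>
definition \<phi> :: "'g \<Rightarrow> ('v, 'e) path \<times> 'g" where
  "\<phi> g = (J (Ran G g), g)"

lemma functor_\<phi>: "cat_functor G Z \<phi>"
proof (rule cat_functorI)
  fix g h assume "g \<in> Arr G" "h \<in> Arr G" "Dom G g = Ran G h"
  then show "\<phi> (g \<cdot>\<^bsub>G\<^esub> h) = \<phi> g \<cdot>\<^bsub>Z\<^esub> \<phi> h"
    using act_J[of g] res_J[of g] C.mul_dom[of "J (Ran G g)"]
    by (simp add: \<phi>_def G.arrow_simps Ran_J)
qed (simp_all add: \<phi>_def mem_zappa_szep Ran_J j_J G.arrow_simps G.category_axioms category_zappa_szep)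

lemma mul_\<phi>:
  assumes "(x, g) \<in> Arr Z" "h \<in> Arr G" "Dom G g = Ran G h"
  shows "(x, g) \<cdot>\<^bsub>Z\<^esub> \<phi> h = (x, g \<cdot>\<^bsub>G\<^esub> h)"
  using assms act_J[of g] res_J[of g] C.mul_dom[of x] J_j[of "Dom F x"]
  by (simp add: \<phi>_def mem_zappa_szep C.arrow_simps)

end

text \<open>
The situation common to both directions: the edges \<open>E i\<close> form a transversal of the orbits of \<open>G\<close> on the
edges of \<open>\<G>\<close>, and the data of the HNN-extension are the stabilizers and restrictions at these edges.
\<close>
locale hnn_transversal =
  free_self_similar_action G \<G> j act res + hnn_presentation G K R \<epsilon> I H \<alpha> e f
  for G :: "'g arrow_cat"
    and K :: "('g, 'k) pre_digraph" and R :: "(('g, 'k) path \<times> ('g, 'k) path) set"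
    and \<epsilon> :: "('g, 'k) path set \<Rightarrow> 'g"
    and I :: "'i set" and H :: "'i \<Rightarrow> 'g set" and \<alpha> :: "'i \<Rightarrow> 'g \<Rightarrow> 'g" and e f :: "'i \<Rightarrow> 'g"
    and \<G> :: "('v, 'e) pre_digraph" and j :: "('v, 'e) path \<Rightarrow> 'g"
    and act :: "'g \<Rightarrow> ('v, 'e) path \<Rightarrow> ('v, 'e) path" and res :: "'g \<Rightarrow> ('v, 'e) path \<Rightarrow> 'g" +
  fixes E :: "'i \<Rightarrow> 'e"
  assumes E_arc: "i \<in> I \<Longrightarrow> E i \<in> arcs \<G>"
    and head_E: "i \<in> I \<Longrightarrow> j (head \<G> (E i), [], head \<G> (E i)) = e i"
    and tail_E: "i \<in> I \<Longrightarrow> j (tail \<G> (E i), [], tail \<G> (E i)) = f i"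
    and H_stabilizer:
      "i \<in> I \<Longrightarrow> H i = {g \<in> Arr G. Dom G g = e i \<and> act g (edge_path \<G> (E i)) = edge_path \<G> (E i)}"
    and \<alpha>_restriction: "\<lbrakk>i \<in> I; g \<in> H i\<rbrakk> \<Longrightarrow> \<alpha> i g = res g (edge_path \<G> (E i))"
    and E_covers: "a \<in> arcs \<G> \<Longrightarrow>
      \<exists>i \<in> I. \<exists>g \<in> Arr G. Dom G g = e i \<and> act g (edge_path \<G> (E i)) = edge_path \<G> a"
    and E_orbits_distinct:
      "\<lbrakk>i \<in> I; i' \<in> I; g \<in> Arr G; Dom G g = e i; act g (edge_path \<G> (E i)) = edge_path \<G> (E i')\<rbrakk>
         \<Longrightarrow> i = i'"
begin

abbreviation edge :: "'i \<Rightarrow> ('v, 'e) path" where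
  "edge i \<equiv> edge_path \<G> (E i)"

lemma edge_simps:
  assumes "i \<in> I"
  shows "edge i \<in> Arr F" "j (Ran F (edge i)) = e i" "j (Dom F (edge i)) = f i"
  using edge_path_closed[OF E_arc[OF assms]] head_E[OF assms] tail_E[OF assms] by simp_all

lemma J_ends:
  assumes "i \<in> I"
  shows "J (e i) = Ran F (edge i)" "J (f i) = Dom F (edge i)"
  using edge_simps[OF assms] J_j[of "Ran F (edge i)"] J_j[of "Dom F (edge i)"]
    C.Ran_in_Obj C.Dom_in_Obj
  by metis+

lemma e_f_simps:
  assumes "i \<in> I"
  shows "e i \<in> Arr G" "Dom G (e i) = e i" "Ran G (e i) = e i"
    "f i \<in> Arr G" "Dom G (f i) = f i" "Ran G (f i) = f i"
  using G.ObjD[OF e_Obj[OF assms]] G.ObjD[OF f_Obj[OF assms]] by simp_all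

lemma res_edge:
  assumes "i \<in> I" "g \<in> Arr G" "Dom G g = e i"
  shows "act g (edge i) \<in> Arr F" "res g (edge i) \<in> Arr G" "Dom G (res g (edge i)) = f i"
    "Ran G (res g (edge i)) = j (Dom F (act g (edge i)))"
    "Ran G g = j (Ran F (act g (edge i)))"
  using assms edge_simps[OF assms(1)] C1[of g "edge i"]
  by (simp_all add: act_closed res_closed dom_res ran_res del: free_category_simps)

text \<open>
The image of the stable letter \<open>t\<^sub>i\<close> in the product.
\<close>
definition \<tau> :: "'i \<Rightarrow> ('v, 'e) path \<times> 'g" where
  "\<tau> i = (edge i, f i)"

lemma mul_\<tau>:
  assumes "i \<in> I" "(x, g) \<in> Arr Z" "Dom G g = e i"
  shows "(x, g) \<cdot>\<^bsub>Z\<^esub> \<tau> i = (x \<cdot>\<^bsub>F\<^esub> act g (edge i), res g (edge i))"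
  using assms res_edge[OF assms(1) _ assms(3)] G.mul_dom[of "res g (edge i)"]
  by (simp add: \<tau>_def mem_zappa_szep)

lemma \<tau>_simps:
  assumes "i \<in> I"
  shows "\<tau> i \<in> Arr Z" "Dom Z (\<tau> i) = \<phi> (f i)" "Ran Z (\<tau> i) = \<phi> (e i)"
  using edge_simps[OF assms] J_ends[OF assms] e_f_simps[OF assms]
  by (simp_all add: \<tau>_def \<phi>_def mem_zappa_szep)

lemma \<phi>_slide:
  assumes "i \<in> I" "h \<in> H i"
  shows "\<phi> h \<cdot>\<^bsub>Z\<^esub> \<tau> i = \<tau> i \<cdot>\<^bsub>Z\<^esub> \<phi> (\<alpha> i h)"
proof -
  have h: "h \<in> Arr G" "Dom G h = e i" "act h (edge i) = edge i"
    using assms H_stabilizer by auto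
  have "\<phi> h \<cdot>\<^bsub>Z\<^esub> \<tau> i = (J (e i) \<cdot>\<^bsub>F\<^esub> edge i, \<alpha> i h)"
    using mul_\<tau>[OF assms(1), of "J (Ran G h)" h] cat_functorD(3)[OF functor_\<phi>, of h] h
      H_local(3)[OF assms] \<alpha>_restriction[OF assms]
    by (simp add: \<phi>_def)
  also have "J (e i) \<cdot>\<^bsub>F\<^esub> edge i = edge i"
    using J_ends[OF assms(1)] by simp
  also have "(edge i, \<alpha> i h) = \<tau> i \<cdot>\<^bsub>Z\<^esub> \<phi> (\<alpha> i h)"
    using mul_\<phi>[of "edge i" "f i" "\<alpha> i h"] \<tau>_simps(1)[OF assms(1)] H_local(4,6)[OF assms]
      G.ran_mul_self[of "\<alpha> i h"] e_f_simps[OF assms(1)]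
    by (simp add: \<tau>_def)
  finally show ?thesis .
qed

text \<open>
In the product, \<open>g x\<^sub>i = (g \<cdot> x\<^sub>i) g|\<^bsub>x\<^sub>i\<^esub>\<close> for the representative \<open>x\<^sub>i\<close>. Solving for the edge \<open>a = g \<cdot> x\<^sub>i\<close>
and replacing \<open>x\<^sub>i\<close> by \<open>t\<^sub>i\<close> gives its image in the HNN-extension.
\<close>
definition \<sigma> :: "'e \<Rightarrow> ('g, 'k + 'i) path set" where
  "\<sigma> a = (SOME n. \<exists>i \<in> I. \<exists>g \<in> Arr G. Dom G g = e i \<and> act g (edge i) = edge_path \<G> a
     \<and> n = \<iota> g \<cdot>\<^bsub>N\<^esub> t i \<cdot>\<^bsub>N\<^esub> \<iota> (G.ginv (res g (edge i))))"

lemma \<sigma>_choice: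
  assumes "a \<in> arcs \<G>"
  obtains i g where "i \<in> I" "g \<in> Arr G" "Dom G g = e i" "act g (edge i) = edge_path \<G> a"
    "\<sigma> a = \<iota> g \<cdot>\<^bsub>N\<^esub> t i \<cdot>\<^bsub>N\<^esub> \<iota> (G.ginv (res g (edge i)))"
proof -
  have "\<exists>n. \<exists>i \<in> I. \<exists>g \<in> Arr G. Dom G g = e i \<and> act g (edge i) = edge_path \<G> a
     \<and> n = \<iota> g \<cdot>\<^bsub>N\<^esub> t i \<cdot>\<^bsub>N\<^esub> \<iota> (G.ginv (res g (edge i)))"
    using E_covers[OF assms] by blast
  from someI_ex[OF this] show ?thesis
    using that unfolding \<sigma>_def by blast
qed

lemma \<sigma>_simps:
  assumes "a \<in> arcs \<G>"
  shows "\<sigma> a \<in> Arr N" "Dom N (\<sigma> a) = \<iota> (j (tail \<G> a, [], tail \<G> a))"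
    "Ran N (\<sigma> a) = \<iota> (j (head \<G> a, [], head \<G> a))"
proof -
  obtain i g where c: "i \<in> I" "g \<in> Arr G" "Dom G g = e i" "act g (edge i) = edge_path \<G> a"
    "\<sigma> a = \<iota> g \<cdot>\<^bsub>N\<^esub> t i \<cdot>\<^bsub>N\<^esub> \<iota> (G.ginv (res g (edge i)))"
    using \<sigma>_choice[OF assms] .
  note r = res_edge[OF c(1-3)]
  show "\<sigma> a \<in> Arr N" "Dom N (\<sigma> a) = \<iota> (j (tail \<G> a, [], tail \<G> a))"
    "Ran N (\<sigma> a) = \<iota> (j (head \<G> a, [], head \<G> a))"
    using c r by (simp_all add: \<iota>_simps t_closed Dom_t Ran_t G.inverse_simps N.arrow_simps)
qed

sublocale \<psi>: graph_morphism \<G> N "\<lambda>v. \<iota> (j (v, [], v))" \<sigma>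
proof unfold_locales
  fix v assume "v \<in> verts \<G>"
  then have "j (v, [], v) \<in> Obj G"
    by (intro j_closed) (simp add: Obj_free)
  note v = G.ObjD[OF this]
  show "\<iota> (j (v, [], v)) \<in> Obj N"
    using \<iota>_simps(1,2)[OF v(1)] v(2) by (simp add: Obj_def)
qed (simp_all add: \<sigma>_simps)

definition \<psi> :: "('v, 'e) path \<Rightarrow> ('g, 'k + 'i) path set" where
  "\<psi> = free_extension N (\<lambda>v. \<iota> (j (v, [], v))) \<sigma>"

lemma functor_\<psi>: "cat_functor F N \<psi>"
  unfolding \<psi>_def by (rule \<psi>.functor_free_extension)

lemmas \<psi>_simps = cat_functorD(3-6)[OF functor_\<psi>]

lemma \<psi>_edge: "a \<in> arcs \<G> \<Longrightarrow> \<psi> (edge_path \<G> a) = \<sigma> a"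
  unfolding \<psi>_def by (rule \<psi>.free_extension_edge)

lemma \<psi>_Obj: "v \<in> Obj F \<Longrightarrow> \<psi> v = \<iota> (j v)"
  by (auto simp: Obj_free \<psi>_def free_extension_vertex)

lemma Dom_\<psi>: "x \<in> Arr F \<Longrightarrow> Dom N (\<psi> x) = \<iota> (j (Dom F x))"
  using \<psi>_simps(2) \<psi>_Obj[OF C.Dom_in_Obj] by simp

text \<open>
The image of \<open>a\<close> does not depend on the choice of \<open>g\<close>. If \<open>h \<cdot> x\<^sub>i = a = g \<cdot> x\<^sub>i\<close>, then \<open>g = h s\<close> with \<open>s\<close> in
the stabilizer of \<open>x\<^sub>i\<close>, and \<open>s\<close> moves through \<open>t\<^sub>i\<close>, where it cancels against the factor \<open>\<alpha>\<^sub>i(s)\<close> by which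
the restrictions of \<open>g\<close> and \<open>h\<close> differ.
\<close>
lemma \<sigma>_act:
  assumes "i \<in> I" "h \<in> Arr G" "Dom G h = e i" "a \<in> arcs \<G>" "act h (edge i) = edge_path \<G> a"
  shows "\<sigma> a \<cdot>\<^bsub>N\<^esub> \<iota> (res h (edge i)) = \<iota> h \<cdot>\<^bsub>N\<^esub> t i"
proof -
  obtain i' g where c: "i' \<in> I" "g \<in> Arr G" "Dom G g = e i'" "act g (edge i') = edge_path \<G> a"
    "\<sigma> a = \<iota> g \<cdot>\<^bsub>N\<^esub> t i' \<cdot>\<^bsub>N\<^esub> \<iota> (G.ginv (res g (edge i')))"
    using \<sigma>_choice[OF assms(4)] .
  note rg = res_edge[OF c(1-3)] and rh = res_edge[OF assms(1-3)]
  have ran: "Ran G g = Ran G h"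
    using rg(5) rh(5) assms(5) c(4) by simp
  define s where "s = G.ginv h \<cdot>\<^bsub>G\<^esub> g"
  have s: "s \<in> Arr G" "Dom G s = e i'" "h \<cdot>\<^bsub>G\<^esub> s = g" "Ran G s = e i"
    using c assms ran by (simp_all add: s_def G.arrow_simps G.inverse_simps)
  have "act s (edge i') = act (G.ginv h) (act g (edge i'))"
    unfolding s_def using c assms ran edge_simps[OF c(1)]
    by (intro SS2) (simp_all add: G.inverse_simps del: free_category_simps)
  also have "\<dots> = edge i"
    using act_ginv_act[of h "edge i"] assms edge_simps[OF assms(1)] c(4) by simp
  finally have act_s: "act s (edge i') = edge i" .
  then have [simp]: "i' = i"
    using E_orbits_distinct c(1) assms(1) s(1,2) by blast
  have sH: "s \<in> H i"
    using H_stabilizer[OF assms(1)] s act_s by simp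
  have \<alpha>s: "res s (edge i) = \<alpha> i s"
    using \<alpha>_restriction[OF assms(1) sH] by simp
  have "res g (edge i) = res h (act s (edge i)) \<cdot>\<^bsub>G\<^esub> res s (edge i)"
    using SS7[of h s "edge i"] assms(2,3) s edge_simps[OF assms(1)] by simp
  then have rg_eq: "res g (edge i) = res h (edge i) \<cdot>\<^bsub>G\<^esub> \<alpha> i s"
    using act_s \<alpha>s by simp
  let ?r = "res g (edge i)" and ?rh = "res h (edge i)"
  note loc = H_local[OF assms(1) sH]
  have r: "?r \<in> Arr G" "Dom G ?r = f i" "?rh \<in> Arr G" "Dom G ?rh = f i" "Ran G ?r = Ran G ?rh"
    using rg rh c(4) assms(5) by simp_all
  have "\<iota> g \<cdot>\<^bsub>N\<^esub> t i = \<iota> h \<cdot>\<^bsub>N\<^esub> (\<iota> s \<cdot>\<^bsub>N\<^esub> t i)"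
    using \<iota>_simps(4)[of h s] s assms(1-3) c(2)
    by (simp add: N.arrow_simps \<iota>_simps t_closed Ran_t)
  then have gt: "\<iota> g \<cdot>\<^bsub>N\<^esub> t i = \<iota> h \<cdot>\<^bsub>N\<^esub> t i \<cdot>\<^bsub>N\<^esub> \<iota> (\<alpha> i s)"
    using slide[OF assms(1) sH] loc assms(1-3)
    by (simp add: N.arrow_simps \<iota>_simps t_closed Ran_t Dom_t)
  have "\<alpha> i s \<cdot>\<^bsub>G\<^esub> (G.ginv ?r \<cdot>\<^bsub>G\<^esub> ?rh) = f i"
  proof -
    have "?rh \<cdot>\<^bsub>G\<^esub> (\<alpha> i s \<cdot>\<^bsub>G\<^esub> (G.ginv ?r \<cdot>\<^bsub>G\<^esub> ?rh)) = ?rh \<cdot>\<^bsub>G\<^esub> \<alpha> i s \<cdot>\<^bsub>G\<^esub> (G.ginv ?r \<cdot>\<^bsub>G\<^esub> ?rh)"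
      using r loc by (intro G.mul_assoc[symmetric]) (simp_all add: G.arrow_simps G.inverse_simps)
    also have "\<dots> = ?r \<cdot>\<^bsub>G\<^esub> (G.ginv ?r \<cdot>\<^bsub>G\<^esub> ?rh)"
      by (simp only: rg_eq)
    also have "\<dots> = ?rh \<cdot>\<^bsub>G\<^esub> f i"
      using r G.mul_dom[of ?rh] by (simp add: G.inverse_simps)
    finally have eq: "?rh \<cdot>\<^bsub>G\<^esub> (\<alpha> i s \<cdot>\<^bsub>G\<^esub> (G.ginv ?r \<cdot>\<^bsub>G\<^esub> ?rh)) = ?rh \<cdot>\<^bsub>G\<^esub> f i" .
    have "G.ginv ?r \<cdot>\<^bsub>G\<^esub> ?rh \<in> Arr G" "Ran G (G.ginv ?r \<cdot>\<^bsub>G\<^esub> ?rh) = f i"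
      using r by (simp_all add: G.mul_closed G.ran_mul G.ginv_closed G.dom_ginv G.ran_ginv)
    then have "\<alpha> i s \<cdot>\<^bsub>G\<^esub> (G.ginv ?r \<cdot>\<^bsub>G\<^esub> ?rh) \<in> Arr G"
        "Ran G (\<alpha> i s \<cdot>\<^bsub>G\<^esub> (G.ginv ?r \<cdot>\<^bsub>G\<^esub> ?rh)) = f i"
      using loc by (simp_all add: G.mul_closed G.ran_mul)
    then show ?thesis
      using G.left_cancel[OF _ _ _ _ _ eq] r e_f_simps[OF assms(1)] by simp
  qed
  then have f: "\<iota> (\<alpha> i s) \<cdot>\<^bsub>N\<^esub> (\<iota> (G.ginv ?r) \<cdot>\<^bsub>N\<^esub> \<iota> ?rh) = \<iota> (f i)"
    using \<iota>_simps(4)[of "G.ginv ?r" ?rh] \<iota>_simps(4)[of "\<alpha> i s" "G.ginv ?r \<cdot>\<^bsub>G\<^esub> ?rh"] r loc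
    by (simp add: G.mul_closed G.ran_mul G.ginv_closed G.dom_ginv G.ran_ginv)
  have "\<sigma> a \<cdot>\<^bsub>N\<^esub> \<iota> ?rh = \<iota> g \<cdot>\<^bsub>N\<^esub> t i \<cdot>\<^bsub>N\<^esub> (\<iota> (G.ginv ?r) \<cdot>\<^bsub>N\<^esub> \<iota> ?rh)"
    using c r assms(1) by (simp add: N.arrow_simps \<iota>_simps t_closed Ran_t Dom_t G.inverse_simps)
  also have "\<dots> = \<iota> h \<cdot>\<^bsub>N\<^esub> t i \<cdot>\<^bsub>N\<^esub> \<iota> (f i)"
    unfolding gt f[symmetric] using r loc assms(1-3)
    by (simp add: N.arrow_simps \<iota>_simps t_closed Ran_t Dom_t G.inverse_simps)
  also have "\<dots> = \<iota> h \<cdot>\<^bsub>N\<^esub> t i"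
    using N.mul_dom[of "\<iota> h \<cdot>\<^bsub>N\<^esub> t i"] assms(1-3)
    by (simp add: N.dom_mul N.mul_closed \<iota>_simps t_closed Ran_t Dom_t)
  finally show ?thesis .
qed

text \<open>
The normal form \<open>(x, g)\<close>, read as a product in the HNN-extension. As a two-sided inverse of the functor
\<open>\<Phi>\<close> it makes \<open>\<Phi>\<close> an isomorphism.
\<close>
definition \<Psi> :: "('v, 'e) path \<times> 'g \<Rightarrow> ('g, 'k + 'i) path set" where
  "\<Psi> = (\<lambda>(x, g). \<psi> x \<cdot>\<^bsub>N\<^esub> \<iota> g)"

lemma \<Psi>_closed: "z \<in> Arr Z \<Longrightarrow> \<Psi> z \<in> Arr N"
  by (cases z) (simp add: \<Psi>_def mem_zappa_szep N.mul_closed \<psi>_simps(1) \<iota>_simps Dom_\<psi>)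

text \<open>
Going from the HNN-extension to the product and back is the identity by induction over the generators:
multiplying the normal form \<open>(x, g)\<close> by \<open>h\<close> changes it to \<open>(x, g h)\<close>, and multiplying it by \<open>t\<^sub>i\<close> appends the
edge \<open>a = g \<cdot> x\<^sub>i\<close> and replaces \<open>g\<close> by its restriction, which \<open>\<sigma>_act\<close> turns back into \<open>g t\<^sub>i\<close>. The other
composite is computed along the path \<open>x\<close>.
\<close>
theorem hnn_isomorphic_zappa_szep: "isomorphic_cats N Z"
proof -
  obtain \<Phi> where \<Phi>: "cat_functor N Z \<Phi>" "\<And>x. x \<in> Arr G \<Longrightarrow> \<Phi> (\<iota> x) = \<phi> x"
    "\<And>i. i \<in> I \<Longrightarrow> \<Phi> (t i) = \<tau> i"
    using universal_property[OF functor_\<phi> \<tau>_simps \<phi>_slide] by blast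
  note \<Phi>_simps = cat_functorD(3-6)[OF \<Phi>(1)]
  have inverse: "\<Psi> (\<Phi> n) = n" if "n \<in> Arr N" for n
    using that
  proof (induction n rule: hnn_induct)
    case (vertex v)
    note v = G.ObjD[OF vertex]
    have "\<psi> (J v) = \<iota> v"
      using \<psi>_Obj[OF J_closed[OF vertex]] j_J[OF vertex] by simp
    then show ?case
      using v \<iota>_simps[of v] N.mul_dom[of "\<iota> v"] by (simp add: \<Phi> \<phi>_def \<Psi>_def)
  next
    case (base n h)
    obtain x g where xg: "\<Phi> n = (x, g)" by fastforce
    have z: "(x, g) \<in> Arr Z"
      using \<Phi>_simps(1)[OF base.hyps(1)] xg by simp
    have d: "Dom G g = Ran G h"
      using \<Phi>_simps(2)[OF base.hyps(1)] xg base.hyps \<Phi>(2)[of "Ran G h"]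
      by (simp add: \<phi>_def G.arrow_simps)
    have "\<Phi> (n \<cdot>\<^bsub>N\<^esub> \<iota> h) = (x, g \<cdot>\<^bsub>G\<^esub> h)"
      using \<Phi>_simps(4)[of n "\<iota> h"] base.hyps xg mul_\<phi>[OF z base.hyps(2) d]
      by (simp add: \<iota>_simps \<Phi>(2))
    then show ?case
      using base.IH[unfolded xg, symmetric] base.hyps(2) d z
      by (simp add: \<Psi>_def mem_zappa_szep \<iota>_simps \<psi>_simps(1) Dom_\<psi> N.mul_assoc)
  next
    case (stable n i)
    obtain x g where xg: "\<Phi> n = (x, g)" by fastforce
    have z: "(x, g) \<in> Arr Z"
      using \<Phi>_simps(1)[OF stable.hyps(1)] xg by simp
    then have g: "g \<in> Arr G" "x \<in> Arr F" "j (Dom F x) = Ran G g"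
      by (simp_all add: mem_zappa_szep)
    note i = stable.hyps(2)
    have d: "Dom G g = e i"
      using \<Phi>_simps(2)[OF stable.hyps(1)] xg stable.hyps \<Phi>(2)[of "e i"] e_f_simps[OF i]
      by (simp add: \<phi>_def)
    \<comment> \<open>The normal form \<open>(x, g)\<close> grows by the edge \<open>a\<close>.\<close>
    obtain a where a: "a \<in> arcs \<G>" "act g (edge i) = edge_path \<G> a"
      using act_edge[OF g(1) E_arc[OF i]] d head_E[OF i] by metis
    have r: "res g (edge i) \<in> Arr G" "Ran G (res g (edge i)) = j (tail \<G> a, [], tail \<G> a)"
      using res_edge[OF i g(1) d] a(2) by simp_all
    have xa: "Dom F x = Ran F (edge_path \<G> a)"
      using composite_defined[OF z edge_simps(1)[OF i]] d edge_simps(2)[OF i] a(2) by simp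
    have "\<Phi> (n \<cdot>\<^bsub>N\<^esub> t i) = (x \<cdot>\<^bsub>F\<^esub> edge_path \<G> a, res g (edge i))"
      using \<Phi>_simps(4)[of n "t i"] stable.hyps xg mul_\<tau>[OF i z d] a(2)
      by (simp add: t_closed Ran_t \<Phi>(3))
    then have "\<Psi> (\<Phi> (n \<cdot>\<^bsub>N\<^esub> t i)) = \<psi> x \<cdot>\<^bsub>N\<^esub> \<sigma> a \<cdot>\<^bsub>N\<^esub> \<iota> (res g (edge i))"
      using \<psi>_simps(4)[OF g(2) edge_path_closed[OF a(1)] xa] \<psi>_edge[OF a(1)] by (simp add: \<Psi>_def)
    also have "\<dots> = \<psi> x \<cdot>\<^bsub>N\<^esub> (\<sigma> a \<cdot>\<^bsub>N\<^esub> \<iota> (res g (edge i)))"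
      using g(2) a(1) r xa
      by (intro N.mul_assoc) (simp_all add: \<psi>_simps(1) \<iota>_simps \<sigma>_simps Dom_\<psi>)
    also have "\<dots> = \<psi> x \<cdot>\<^bsub>N\<^esub> (\<iota> g \<cdot>\<^bsub>N\<^esub> t i)"
      using \<sigma>_act[OF i g(1) d a] by simp
    also have "\<dots> = \<psi> x \<cdot>\<^bsub>N\<^esub> \<iota> g \<cdot>\<^bsub>N\<^esub> t i"
      using g i d by (intro N.mul_assoc[symmetric])
        (simp_all add: \<psi>_simps(1) \<iota>_simps Dom_\<psi> t_closed Ran_t)
    also have "\<dots> = n \<cdot>\<^bsub>N\<^esub> t i"
      using stable.IH xg by (simp add: \<Psi>_def)
    finally show ?case .
  qed
  have \<Phi>_\<sigma>: "\<Phi> (\<sigma> a) = (edge_path \<G> a, j (Dom F (edge_path \<G> a)))" if a: "a \<in> arcs \<G>" for a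
  proof -
    obtain i g where c: "i \<in> I" "g \<in> Arr G" "Dom G g = e i" "act g (edge i) = edge_path \<G> a"
      "\<sigma> a = \<iota> g \<cdot>\<^bsub>N\<^esub> t i \<cdot>\<^bsub>N\<^esub> \<iota> (G.ginv (res g (edge i)))"
      using \<sigma>_choice[OF a] .
    note r = res_edge[OF c(1-3)]
    have "\<Phi> (\<iota> g \<cdot>\<^bsub>N\<^esub> t i) = (J (Ran G g) \<cdot>\<^bsub>F\<^esub> act g (edge i), res g (edge i))"
      using \<Phi>_simps(4)[of "\<iota> g" "t i"] c cat_functorD(3)[OF functor_\<phi> c(2)]
        mul_\<tau>[OF c(1) _ c(3), of "J (Ran G g)"]
      by (simp add: \<iota>_simps t_closed Ran_t \<Phi> \<phi>_def)
    also have "J (Ran G g) \<cdot>\<^bsub>F\<^esub> act g (edge i) = edge_path \<G> a"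
      using ran_act[of g "edge i"] c(2-4) edge_simps[OF c(1)] by (simp add: eq_commute[of _ "J _"])
    finally have gt: "\<Phi> (\<iota> g \<cdot>\<^bsub>N\<^esub> t i) = (edge_path \<G> a, res g (edge i))" .
    have "(edge_path \<G> a, res g (edge i)) \<in> Arr Z"
      using r c(4) edge_path_closed[OF a] by (simp add: mem_zappa_szep)
    then show ?thesis
      using \<Phi>_simps(4)[of "\<iota> g \<cdot>\<^bsub>N\<^esub> t i" "\<iota> (G.ginv (res g (edge i)))"] c r gt
        mul_\<phi>[of "edge_path \<G> a" "res g (edge i)" "G.ginv (res g (edge i))"]
      by (simp add: \<Phi> \<iota>_simps t_closed Ran_t Dom_t N.mul_closed N.dom_mul G.inverse_simps)
  qed
  have \<Phi>_\<psi>: "\<Phi> (\<psi> x) = (x, j (Dom F x))" if "x \<in> Arr F" for x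
    using that
  proof (induction x rule: free_category_induct)
    case (vertex v)
    then have v: "(v, [], v) \<in> Obj F" by (simp add: Obj_free)
    note jv = G.ObjD[OF j_closed[OF v]]
    show ?case
      using \<psi>_Obj[OF v] \<Phi>(2)[OF jv(1)] jv J_j[OF v] by (simp add: \<phi>_def)
  next
    case (edge x a)
    note a = edge_path_closed[OF edge.hyps(2)]
    have "\<Phi> (\<psi> (x \<cdot>\<^bsub>F\<^esub> edge_path \<G> a)) = \<Phi> (\<psi> x) \<cdot>\<^bsub>Z\<^esub> \<Phi> (\<psi> (edge_path \<G> a))"
      using cat_functorD(6)[OF cat_functor_comp[OF functor_\<psi> \<Phi>(1)] edge.hyps(1) a edge.hyps(3)]
      by simp
    also have "\<dots> = (x, j (Dom F x)) \<cdot>\<^bsub>Z\<^esub> (edge_path \<G> a, j (Dom F (edge_path \<G> a)))"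
      using edge.IH \<psi>_edge \<Phi>_\<sigma> edge.hyps(2) by simp
    also have "\<dots> = (x \<cdot>\<^bsub>F\<^esub> edge_path \<G> a, j (Dom F (edge_path \<G> a)))"
      using SS1[OF a] SS4[OF a] G.ObjD[OF j_closed[OF C.Dom_in_Obj[OF a]]]
        G.mul_dom[of "j (Dom F (edge_path \<G> a))"] edge.hyps(3)
      by simp
    finally show ?case
      by (cases x) simp
  qed
  have "\<Phi> (\<Psi> z) = z" if "z \<in> Arr Z" for z
  proof -
    obtain x g where z: "z = (x, g)" by fastforce
    have xg: "x \<in> Arr F" "g \<in> Arr G" "j (Dom F x) = Ran G g"
      using that z by (simp_all add: mem_zappa_szep)
    have "(x, j (Dom F x)) \<in> Arr Z"
      using xg G.ObjD[OF j_closed[OF C.Dom_in_Obj[OF xg(1)]]] by (simp add: mem_zappa_szep)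
    then show ?thesis
      using \<Phi>_simps(4)[of "\<psi> x" "\<iota> g"] xg z mul_\<phi>[of x "j (Dom F x)" g] G.ran_mul_self[of g]
        G.ObjD[OF j_closed[OF C.Dom_in_Obj[OF xg(1)]]]
      by (simp add: \<Psi>_def \<psi>_simps(1) \<iota>_simps Dom_\<psi> \<Phi>_\<psi> \<Phi>(2))
  qed
  then have "bij_betw \<Phi> (Arr N) (Arr Z)"
    using inverse \<Phi>_simps(1) \<Psi>_closed by (intro bij_betw_byWitness[where f' = \<Psi>]) auto
  then show ?thesis
    using \<Phi>(1) by (auto simp: isomorphic_cats_def cat_iso_def)
qed

end


section \<open>Local groups\<close>

lemma (in category) category_submonoid:
  assumes "e \<in> Obj C" "submonoid H (local_monoid C e)"
  shows "category (C\<lparr>Arr := H\<rparr>)"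
proof -
  have H: "\<And>x. x \<in> H \<Longrightarrow> x \<in> Arr C \<and> Dom C x = e \<and> Ran C x = e"
      "\<And>x y. \<lbrakk>x \<in> H; y \<in> H\<rbrakk> \<Longrightarrow> x \<cdot> y \<in> H" "e \<in> H"
    using assms(2) mem_local_monoid
    by (auto simp: submonoid_def local_monoid_def)
  moreover have "x \<cdot> e = x \<and> e \<cdot> x = x" if "x \<in> H" for x
    using H(1)[OF that] mul_dom[of x] ran_mul_self[of x] by auto
  ultimately show ?thesis
    using ObjD[OF assms(1)] by unfold_locales (simp_all add: arrow_simps)
qed

context groupoid
begin

lemma group_local_monoid:
  assumes "e \<in> Obj C"
  shows "group (local_monoid C e)"
proof (rule groupI)
  fix x assume x: "x \<in> carrier (local_monoid C e)"
  then have "ginv x \<in> carrier (local_monoid C e)" "ginv x \<cdot> x = e"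
    by (simp_all add: mem_local_monoid inverse_simps)
  then show "\<exists>y \<in> carrier (local_monoid C e). y \<otimes>\<^bsub>local_monoid C e\<^esub> x = \<one>\<^bsub>local_monoid C e\<^esub>"
    by (intro bexI[of _ "ginv x"]) (simp_all add: local_monoid_def)
  show "\<one>\<^bsub>local_monoid C e\<^esub> \<otimes>\<^bsub>local_monoid C e\<^esub> x = x"
    using x ran_mul_self[of x] by (simp add: local_monoid_def)
qed (use ObjD[OF assms] in \<open>simp_all add: local_monoid_def arrow_simps\<close>)

text \<open>
The inverse in a local group is the inverse in the groupoid.
\<close>
lemma subgroup_local_monoid_iff:
  assumes "e \<in> Obj C"
  shows "subgroup H (local_monoid C e)
    \<longleftrightarrow> submonoid H (local_monoid C e) \<and> (\<forall>x \<in> H. ginv x \<in> H)"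
proof -
  interpret L: group "local_monoid C e"
    by (rule group_local_monoid[OF assms])
  have "inv\<^bsub>local_monoid C e\<^esub> x = ginv x" if "x \<in> carrier (local_monoid C e)" for x
  proof (rule L.inv_equality)
    show "ginv x \<otimes>\<^bsub>local_monoid C e\<^esub> x = \<one>\<^bsub>local_monoid C e\<^esub>" "x \<in> carrier (local_monoid C e)"
      "ginv x \<in> carrier (local_monoid C e)"
      using that by (simp_all add: local_monoid_def inverse_simps)
  qed
  then show ?thesis
    by (auto simp: subgroup_def submonoid_def subset_iff)
qed

end


section \<open>The canonical presentation of a category\<close>

definition underlying_graph :: "'a arrow_cat \<Rightarrow> ('a, 'a) pre_digraph" where
  "underlying_graph C = \<lparr>verts = Obj C, arcs = Arr C, tail = Dom C, head = Ran C\<rparr>"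

text \<open>
Every category is presented by all its arrows, subject to all relations that hold between their products.
\<close>
lemma (in category) ex_presentation:
  "\<exists>R \<epsilon>. category_presentation C (underlying_graph C) R \<epsilon>"
proof -
  let ?K = "underlying_graph C"
  have K: "verts ?K = Obj C" "arcs ?K = Arr C" "tail ?K = Dom C" "head ?K = Ran C"
    by (simp_all add: underlying_graph_def)
  interpret M: graph_morphism ?K C "\<lambda>v. v" "\<lambda>x. x"
    by unfold_locales (simp_all add: K arrow_simps)
  let ?ev = "free_extension C (\<lambda>v. v) (\<lambda>x. x)"
  define R where "R = {(p, q) \<in> parallel_pairs (free_category ?K). ?ev p = ?ev q}"
  interpret P: generated_congruence "free_category ?K" R
    by (intro generated_congruence.intro M.category_free_category generated_congruence_axioms.intro)
      (auto simp: R_def)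
  have rel: "\<And>p q. (p, q) \<in> R \<Longrightarrow> ?ev p = ?ev q"
    by (simp add: R_def)
  note ev = cat_functorD[OF M.functor_free_extension]
  have induced: "P.induced ?ev (P.cls p) = ?ev p" if "p \<in> Arr (free_category ?K)" for p
    by (rule P.induced_cls[OF M.functor_free_extension]) (use rel that in auto)
  have "inj_on (P.induced ?ev) (P.cls ` Arr (free_category ?K))"
  proof (rule inj_onI; clarify)
    fix v p u w q z
    assume p: "(v, p, u) \<in> Arr (free_category ?K)" and q: "(w, q, z) \<in> Arr (free_category ?K)"
      and "P.induced ?ev (P.cls (v, p, u)) = P.induced ?ev (P.cls (w, q, z))"
    then have eq: "?ev (v, p, u) = ?ev (w, q, z)"
      by (simp add: induced)
    \<comment> \<open>Paths with the same value have the same ends, since vertices evaluate to themselves.\<close>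
    have "u = z" "v = w"
      using ev(4)[OF p] ev(4)[OF q] ev(5)[OF p] ev(5)[OF q] eq
      by (simp_all add: free_extension_vertex)
    then have "((v, p, u), (w, q, z)) \<in> R"
      using p q eq by (simp add: R_def parallel_pairs_def)
    then show "P.cls (v, p, u) = P.cls (w, q, z)"
      by (intro P.cls_eqI cat_congruence.base)
  qed
  moreover have "P.induced ?ev ` P.cls ` Arr (free_category ?K) = Arr C"
  proof
    show "P.induced ?ev ` P.cls ` Arr (free_category ?K) \<subseteq> Arr C"
      using ev(3) by (auto simp: induced)
    show "Arr C \<subseteq> P.induced ?ev ` P.cls ` Arr (free_category ?K)"
    proof
      fix x assume "x \<in> Arr C"
      then have p: "edge_path ?K x \<in> Arr (free_category ?K)" "?ev (edge_path ?K x) = x"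
        using M.edge_path_closed[of x] M.free_extension_edge[of x] by (simp_all add: K)
      from induced[OF p(1)] p(2) have "x = P.induced ?ev (P.cls (edge_path ?K x))"
        by simp
      then show "x \<in> P.induced ?ev ` P.cls ` Arr (free_category ?K)"
        by (rule image_eqI[OF _ imageI[OF p(1)]])
    qed
  qed
  ultimately have "cat_iso (presented_category ?K R) C (P.induced ?ev)"
    using P.functor_induced[OF M.functor_free_extension rel]
    by (simp add: cat_iso_def bij_betw_def presented_category_def P.quotient_Arr)
  moreover have "P.induced ?ev (path_class ?K R (v, [], v)) = v" if "v \<in> Obj C" for v
    using induced[of "(v, [], v)"] that
    by (simp add: path_class_def M.path_Nil_iff K free_extension_vertex)
  ultimately have "category_presentation C ?K R (P.induced ?ev)"
    using P.parallel M.wf_digraph_axioms by (simp add: category_presentation_def K)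
  then show ?thesis by blast
qed


section \<open>Every product is an HNN-extension\<close>

context free_self_similar_action
begin

definition same_orbit :: "'e \<Rightarrow> 'e \<Rightarrow> bool" where
  "same_orbit a b \<longleftrightarrow> a \<in> arcs \<G> \<and> b \<in> arcs \<G> \<and> (\<exists>g \<in> Arr G. Dom G g = j (head \<G> a, [], head \<G> a)
     \<and> act g (edge_path \<G> a) = edge_path \<G> b)"

lemma edge_path_simps:
  assumes "a \<in> arcs \<G>"
  shows "edge_path \<G> a \<in> Arr F" "j (Ran F (edge_path \<G> a)) = j (head \<G> a, [], head \<G> a)"
    "(head \<G> a, [], head \<G> a) \<in> Obj F" "(tail \<G> a, [], tail \<G> a) \<in> Obj F"
  using edge_path_closed[OF assms] wellformed assms by (auto simp: Obj_free)

lemma same_orbit_refl: "a \<in> arcs \<G> \<Longrightarrow> same_orbit a a"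
  using SS1[of "edge_path \<G> a"] edge_path_simps[of a] G.ObjD[OF j_closed]
  unfolding same_orbit_def by (metis free_category_simps(2))

lemma same_orbit_sym:
  assumes "same_orbit a b"
  shows "same_orbit b a"
proof -
  obtain g where g: "a \<in> arcs \<G>" "b \<in> arcs \<G>" "g \<in> Arr G" "Dom G g = j (Ran F (edge_path \<G> a))"
    "act g (edge_path \<G> a) = edge_path \<G> b"
    using assms by (auto simp: same_orbit_def)
  have "act (G.ginv g) (edge_path \<G> b) = edge_path \<G> a"
    using act_ginv_act[OF g(3) edge_path_closed[OF g(1)] g(4)] g(5) by simp
  moreover have "Ran G g = j (head \<G> b, [], head \<G> b)"
    using C1[OF g(3) edge_path_closed[OF g(1)] g(4)] g(5) by simp
  ultimately show ?thesis
    using g(1-3) unfolding same_orbit_def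
    by (intro conjI bexI[of _ "G.ginv g"]) (simp_all add: G.inverse_simps)
qed

lemma same_orbit_trans:
  assumes "same_orbit a b" "same_orbit b c"
  shows "same_orbit a c"
proof -
  obtain g h where g: "a \<in> arcs \<G>" "b \<in> arcs \<G>" "g \<in> Arr G" "Dom G g = j (Ran F (edge_path \<G> a))"
    "act g (edge_path \<G> a) = edge_path \<G> b"
    and h: "c \<in> arcs \<G>" "h \<in> Arr G" "Dom G h = j (Ran F (edge_path \<G> b))"
    "act h (edge_path \<G> b) = edge_path \<G> c"
    using assms by (auto simp: same_orbit_def)
  have "Dom G h = Ran G g"
    using C1[OF g(3) edge_path_closed[OF g(1)] g(4)] g(5) h(3) by simp
  then have "act (h \<cdot>\<^bsub>G\<^esub> g) (edge_path \<G> a) = edge_path \<G> c" "h \<cdot>\<^bsub>G\<^esub> g \<in> Arr G"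
      "Dom G (h \<cdot>\<^bsub>G\<^esub> g) = j (Ran F (edge_path \<G> a))"
    using SS2[OF h(2) g(3) edge_path_closed[OF g(1)] _ g(4)] g h
    by (simp_all add: G.arrow_simps)
  then show ?thesis
    using g(1) h(1) unfolding same_orbit_def by (intro conjI bexI[of _ "h \<cdot>\<^bsub>G\<^esub> g"]) simp_all
qed

text \<open>
A choice that depends on \<open>a\<close> only through its orbit, because equivalent edges have equal classes
(\<open>orbit_rep_eq\<close>).
\<close>
definition orbit_rep :: "'e \<Rightarrow> 'e" where
  "orbit_rep a = (SOME b. same_orbit a b)"

lemma same_orbit_rep: "a \<in> arcs \<G> \<Longrightarrow> same_orbit a (orbit_rep a)"
  unfolding orbit_rep_def by (rule someI[of "same_orbit a"]) (rule same_orbit_refl)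

lemma orbit_rep_eq: "same_orbit a b \<Longrightarrow> orbit_rep a = orbit_rep b"
  unfolding orbit_rep_def by (rule arg_cong[of _ _ Eps]) (use same_orbit_sym same_orbit_trans in blast)

definition stabilizer :: "'e \<Rightarrow> 'g set" where
  "stabilizer a = {g \<in> Arr G. Dom G g = j (head \<G> a, [], head \<G> a)
     \<and> act g (edge_path \<G> a) = edge_path \<G> a}"

lemma stabilizer_simps:
  assumes "a \<in> arcs \<G>" "g \<in> stabilizer a"
  shows "g \<in> Arr G" "Dom G g = j (Ran F (edge_path \<G> a))" "Ran G g = j (Ran F (edge_path \<G> a))"
    "act g (edge_path \<G> a) = edge_path \<G> a"
    "res g (edge_path \<G> a) \<in> Arr G"
    "Dom G (res g (edge_path \<G> a)) = j (Dom F (edge_path \<G> a))"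
    "Ran G (res g (edge_path \<G> a)) = j (Dom F (edge_path \<G> a))"
proof -
  show g: "g \<in> Arr G" "Dom G g = j (Ran F (edge_path \<G> a))" "act g (edge_path \<G> a) = edge_path \<G> a"
    using assms(2) by (simp_all add: stabilizer_def)
  show "Ran G g = j (Ran F (edge_path \<G> a))"
    "res g (edge_path \<G> a) \<in> Arr G"
    "Dom G (res g (edge_path \<G> a)) = j (Dom F (edge_path \<G> a))"
    "Ran G (res g (edge_path \<G> a)) = j (Dom F (edge_path \<G> a))"
    using C1[OF g(1) edge_path_closed[OF assms(1)] g(2)] g edge_path_closed[OF assms(1)]
    by (simp_all add: res_closed dom_res ran_res)
qed

lemma subgroup_stabilizer:
  assumes "a \<in> arcs \<G>"
  shows "subgroup (stabilizer a) (local_monoid G (j (head \<G> a, [], head \<G> a)))"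
proof -
  note edge = edge_path_simps[OF assms]
  let ?e = "j (head \<G> a, [], head \<G> a)"
  have e: "?e \<in> Obj G" by (rule j_closed[OF edge(3)])
  have "submonoid (stabilizer a) (local_monoid G ?e)"
  proof
    show "stabilizer a \<subseteq> carrier (local_monoid G ?e)"
      using stabilizer_simps[OF assms] by (auto simp: G.mem_local_monoid)
    show "\<one>\<^bsub>local_monoid G ?e\<^esub> \<in> stabilizer a"
      using G.ObjD[OF e] SS1[OF edge(1)] by (simp add: local_monoid_def stabilizer_def)
    fix g h assume gh: "g \<in> stabilizer a" "h \<in> stabilizer a"
    note g = stabilizer_simps[OF assms gh(1)] and h = stabilizer_simps[OF assms gh(2)]
    have "act (g \<cdot>\<^bsub>G\<^esub> h) (edge_path \<G> a) = edge_path \<G> a"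
      using SS2[OF g(1) h(1) edge(1) _ h(2)] g h by simp
    then show "g \<otimes>\<^bsub>local_monoid G ?e\<^esub> h \<in> stabilizer a"
      using g h by (simp add: local_monoid_def stabilizer_def G.arrow_simps)
  qed
  moreover have "G.ginv g \<in> stabilizer a" if "g \<in> stabilizer a" for g
    using act_ginv_act[of g "edge_path \<G> a"] stabilizer_simps[OF assms that] edge(1)
    by (simp add: stabilizer_def G.inverse_simps)
  ultimately show ?thesis
    using G.subgroup_local_monoid_iff[OF e] by blast
qed

text \<open>
On the stabilizer of \<open>a\<close>, (SS7) says that restriction to \<open>a\<close> is multiplicative, and (SS4) that it preserves
the identity.
\<close>
lemma hnn_data_stabilizers:
  assumes "I \<subseteq> arcs \<G>"
  shows "hnn_data G I stabilizer (\<lambda>a g. res g (edge_path \<G> a))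
    (\<lambda>a. j (head \<G> a, [], head \<G> a)) (\<lambda>a. j (tail \<G> a, [], tail \<G> a))"
  unfolding hnn_data_def
proof (intro ballI conjI)
  fix a assume "a \<in> I"
  then have a: "a \<in> arcs \<G>" using assms by blast
  note edge = edge_path_simps[OF a]
  let ?e = "j (head \<G> a, [], head \<G> a)"
  note sub = subgroup_stabilizer[OF a] stabilizer_simps[OF a]
  show e: "?e \<in> Obj G" and f: "j (tail \<G> a, [], tail \<G> a) \<in> Obj G"
    by (rule j_closed edge)+
  show mon: "submonoid (stabilizer a) (local_monoid G ?e)"
    using G.subgroup_local_monoid_iff[OF e] sub(1) by blast
  show "(\<lambda>g. res g (edge_path \<G> a)) ` stabilizer a
      \<subseteq> carrier (local_monoid G (j (tail \<G> a, [], tail \<G> a)))"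
    using sub by (auto simp: G.mem_local_monoid)
  have "res (j (head \<G> a, [], head \<G> a)) (edge_path \<G> a) = j (tail \<G> a, [], tail \<G> a)"
    using SS4[OF edge(1)] by simp
  moreover have "res (g \<cdot>\<^bsub>G\<^esub> h) (edge_path \<G> a) = res g (edge_path \<G> a) \<cdot>\<^bsub>G\<^esub> res h (edge_path \<G> a)"
    if "g \<in> stabilizer a" "h \<in> stabilizer a" for g h
    using SS7[of g h "edge_path \<G> a"] sub(2-5)[OF that(1)] sub(2-5)[OF that(2)] edge(1) by simp
  ultimately show "cat_functor (G\<lparr>Arr := stabilizer a\<rparr>) G (\<lambda>g. res g (edge_path \<G> a))"
    using G.category_submonoid[OF e mon] G.category_axioms sub
    by (intro cat_functorI) simp_all
qed

text \<open>
One stable letter for each orbit of edges, named by its representative.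
\<close>
theorem ex_hnn_extension:
  "\<exists>(K :: ('g, 'g) pre_digraph) R \<epsilon> (I :: 'e set) H \<alpha> e f.
     category_presentation G K R \<epsilon> \<and> hnn_data G I H \<alpha> e f
     \<and> isomorphic_cats Z (hnn_category K R \<epsilon> I H \<alpha> e f)
     \<and> (\<forall>i \<in> I. is_subgroup_of_groupoid (H i) G)"
proof -
  obtain R \<epsilon> where pres: "category_presentation G (underlying_graph G) R \<epsilon>"
    using G.ex_presentation by blast
  let ?I = "orbit_rep ` arcs \<G>" and ?\<alpha> = "\<lambda>a g. res g (edge_path \<G> a)"
  let ?e = "\<lambda>a. j (head \<G> a, [], head \<G> a)" and ?f = "\<lambda>a. j (tail \<G> a, [], tail \<G> a)"
  have I: "?I \<subseteq> arcs \<G>"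
    using same_orbit_rep by (auto simp: same_orbit_def)
  note data = hnn_data_stabilizers[OF I]
  interpret hnn_transversal G "underlying_graph G" R \<epsilon> ?I stabilizer ?\<alpha> ?e ?f \<G> j act res "\<lambda>a. a"
  proof unfold_locales
    show "category_presentation G (underlying_graph G) R \<epsilon>" by (rule pres)
    show "hnn_data G ?I stabilizer ?\<alpha> ?e ?f" by (rule data)
  next
    fix a assume a: "a \<in> arcs \<G>"
    then have "same_orbit (orbit_rep a) a"
      by (rule same_orbit_sym[OF same_orbit_rep])
    then show "\<exists>i \<in> ?I. \<exists>g \<in> Arr G. Dom G g = ?e i \<and> act g (edge_path \<G> i) = edge_path \<G> a"
      using imageI[OF a, of orbit_rep] unfolding same_orbit_def by blast
  next
    fix i i' g
    assume i: "i \<in> ?I" "i' \<in> ?I" and g: "g \<in> Arr G" "Dom G g = ?e i" "act g (edge_path \<G> i) = edge_path \<G> i'"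
    then obtain a a' where a: "a \<in> arcs \<G>" "i = orbit_rep a" "a' \<in> arcs \<G>" "i' = orbit_rep a'"
      by blast
    have "same_orbit i i'"
      unfolding same_orbit_def using i g subsetD[OF I] by blast
    then have "same_orbit a a'"
      using a same_orbit_rep same_orbit_sym same_orbit_trans by metis
    then show "i = i'"
      using a orbit_rep_eq by simp
  qed (simp_all add: subsetD[OF I] stabilizer_def)
  have "isomorphic_cats Z (hnn_category (underlying_graph G) R \<epsilon> ?I stabilizer ?\<alpha> ?e ?f)"
    by (rule isomorphic_cats_sym[OF hnn_isomorphic_zappa_szep])
  moreover have "is_subgroup_of_groupoid (stabilizer i) G" if "i \<in> ?I" for i
    using subgroup_stabilizer[of i] j_closed[OF edge_path_simps(3)] that I
    unfolding is_subgroup_of_groupoid_def by blast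
  ultimately show ?thesis
    using pres data by blast
qed

end


section \<open>Self-similar actions on free categories from their values on edges\<close>

text \<open>
A self-similar action on a free category is determined by the action and restriction on edges, and (SS6) and
(SS8) say how: to act with \<open>g\<close> on a path, act on its first edge, restrict \<open>g\<close> to that edge, and continue with
the rest of the path. Here the vertices are the objects of \<open>G\<close> themselves.
\<close>
locale self_similar_graph = G: groupoid G + wf_digraph \<G>
  for G :: "'g arrow_cat" and \<G> :: "('g, 'e) pre_digraph" +
  fixes edge_act :: "'g \<Rightarrow> 'e \<Rightarrow> 'e" and edge_res :: "'g \<Rightarrow> 'e \<Rightarrow> 'g"
  assumes verts_eq: "verts \<G> = Obj G"
    and edge_act_closed: "\<lbrakk>g \<in> Arr G; a \<in> arcs \<G>; Dom G g = head \<G> a\<rbrakk> \<Longrightarrow> edge_act g a \<in> arcs \<G>"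
    and head_edge_act: "\<lbrakk>g \<in> Arr G; a \<in> arcs \<G>; Dom G g = head \<G> a\<rbrakk> \<Longrightarrow> head \<G> (edge_act g a) = Ran G g"
    and edge_res_closed: "\<lbrakk>g \<in> Arr G; a \<in> arcs \<G>; Dom G g = head \<G> a\<rbrakk> \<Longrightarrow> edge_res g a \<in> Arr G"
    and dom_edge_res: "\<lbrakk>g \<in> Arr G; a \<in> arcs \<G>; Dom G g = head \<G> a\<rbrakk> \<Longrightarrow> Dom G (edge_res g a) = tail \<G> a"
    and ran_edge_res:
      "\<lbrakk>g \<in> Arr G; a \<in> arcs \<G>; Dom G g = head \<G> a\<rbrakk> \<Longrightarrow> Ran G (edge_res g a) = tail \<G> (edge_act g a)"
    and edge_act_head: "a \<in> arcs \<G> \<Longrightarrow> edge_act (head \<G> a) a = a"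
    and edge_res_head: "a \<in> arcs \<G> \<Longrightarrow> edge_res (head \<G> a) a = tail \<G> a"
    and edge_act_mul: "\<lbrakk>g \<in> Arr G; h \<in> Arr G; a \<in> arcs \<G>; Dom G g = Ran G h; Dom G h = head \<G> a\<rbrakk>
       \<Longrightarrow> edge_act (g \<cdot>\<^bsub>G\<^esub> h) a = edge_act g (edge_act h a)"
    and edge_res_mul: "\<lbrakk>g \<in> Arr G; h \<in> Arr G; a \<in> arcs \<G>; Dom G g = Ran G h; Dom G h = head \<G> a\<rbrakk>
       \<Longrightarrow> edge_res (g \<cdot>\<^bsub>G\<^esub> h) a = edge_res g (edge_act h a) \<cdot>\<^bsub>G\<^esub> edge_res h a"
begin

primrec list_act :: "'e list \<Rightarrow> 'g \<Rightarrow> 'e list" where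
  "list_act [] g = []"
| "list_act (a # p) g = edge_act g a # list_act p (edge_res g a)"

primrec list_res :: "'e list \<Rightarrow> 'g \<Rightarrow> 'g" where
  "list_res [] g = g"
| "list_res (a # p) g = list_res p (edge_res g a)"

text \<open>
The domain of \<open>g \<cdot> x\<close> is read off from the restriction, as (C2) demands. For an empty path this gives the
identity at the codomain of \<open>g\<close>, which is (SS3).
\<close>
definition path_act :: "'g \<Rightarrow> ('g, 'e) path \<Rightarrow> ('g, 'e) path" where
  "path_act g = (\<lambda>(v, p, u). (Ran G g, list_act p g, Ran G (list_res p g)))"

definition path_res :: "'g \<Rightarrow> ('g, 'e) path \<Rightarrow> 'g" where
  "path_res g = (\<lambda>(v, p, u). list_res p g)"

lemma list_act_append: "list_act (p @ q) g = list_act p g @ list_act q (list_res p g)"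
  by (induction p arbitrary: g) simp_all

lemma list_res_append: "list_res (p @ q) g = list_res q (list_res p g)"
  by (induction p arbitrary: g) simp_all

lemma list_act_closed:
  assumes "(v, p, u) \<in> Arr (free_category \<G>)" "g \<in> Arr G" "Dom G g = v"
  shows "list_res p g \<in> Arr G \<and> Dom G (list_res p g) = u
    \<and> (Ran G g, list_act p g, Ran G (list_res p g)) \<in> Arr (free_category \<G>)"
  using assms
proof (induction p arbitrary: v g)
  case Nil
  then show ?case
    by (auto simp: path_Nil_iff verts_eq G.arrow_simps)
next
  case (Cons a p)
  then have a: "a \<in> arcs \<G>" "Dom G g = head \<G> a" "(tail \<G> a, p, u) \<in> Arr (free_category \<G>)"
    by (auto simp: path_Cons_iff)
  then show ?case
    using Cons.IH[OF a(3) edge_res_closed dom_edge_res] Cons.prems(2)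
    by (simp add: path_Cons_iff edge_act_closed head_edge_act ran_edge_res)
qed

lemma list_act_vertex:
  assumes "(v, p, u) \<in> Arr (free_category \<G>)"
  shows "list_act p v = p \<and> list_res p v = u"
  using assms
  by (induction p arbitrary: v) (auto simp: path_Nil_iff path_Cons_iff edge_act_head edge_res_head)

lemma list_act_mul:
  assumes "(v, p, u) \<in> Arr (free_category \<G>)" "g \<in> Arr G" "h \<in> Arr G" "Dom G g = Ran G h" "Dom G h = v"
  shows "list_act p (g \<cdot>\<^bsub>G\<^esub> h) = list_act (list_act p h) g \<and> list_res p (g \<cdot>\<^bsub>G\<^esub> h) = list_res (list_act p h) g \<cdot>\<^bsub>G\<^esub> list_res p h"
  using assms
proof (induction p arbitrary: v g h)
  case (Cons a p)
  then have a: "a \<in> arcs \<G>" "Dom G h = head \<G> a" "(tail \<G> a, p, u) \<in> Arr (free_category \<G>)"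
    by (auto simp: path_Cons_iff)
  have ha: "edge_act h a \<in> arcs \<G>" "Dom G g = head \<G> (edge_act h a)"
    using a Cons.prems(2-4) by (simp_all add: edge_act_closed head_edge_act)
  have "Dom G (edge_res g (edge_act h a)) = Ran G (edge_res h a)"
    using a ha Cons.prems(2,3) by (simp add: dom_edge_res ran_edge_res)
  then show ?case
    using a ha Cons.prems(2-4)
      Cons.IH[OF a(3) edge_res_closed[OF _ ha] edge_res_closed[OF _ a(1,2)] _ dom_edge_res[OF _ a(1,2)]]
    by (simp add: edge_act_mul edge_res_mul)
qed simp

lemma path_act_simps:
  assumes "x \<in> Arr (free_category \<G>)" "g \<in> Arr G" "Dom G g = fst (Ran (free_category \<G>) x)"
  shows "path_act g x \<in> Arr (free_category \<G>)" "path_res g x \<in> Arr G"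
    "Ran (free_category \<G>) (path_act g x) = (Ran G g, [], Ran G g)"
    "Dom (free_category \<G>) (path_act g x) = (Ran G (path_res g x), [], Ran G (path_res g x))"
    "Dom (free_category \<G>) x = (Dom G (path_res g x), [], Dom G (path_res g x))"
  using assms list_act_closed
  by (cases x; auto simp: path_act_def path_res_def)+

lemma self_similar_action_paths: "self_similar_action G (free_category \<G>) fst path_act path_res"
proof (intro self_similar_action.intro self_similar_action_axioms.intro
    G.groupoid_axioms category_free_category)
  show "bij_betw fst (Obj (free_category \<G>)) (Obj G)"
    by (rule bij_betw_byWitness[where f' = "\<lambda>v. (v, [], v)"]) (auto simp: Obj_free verts_eq)
next
  fix x assume x: "x \<in> Arr (free_category \<G>)"
  obtain v p u where p: "x = (v, p, u)" by (cases x)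
  have v: "v \<in> Obj G" "u \<in> Obj G"
    using path_verts x p verts_eq by auto
  show "path_act (fst (Ran (free_category \<G>) x)) x = x"
    "path_res (fst (Ran (free_category \<G>) x)) x = fst (Dom (free_category \<G>) x)"
    using p list_act_vertex[of v p u] x G.ObjD[OF v(1)] G.ObjD[OF v(2)]
    by (simp_all add: path_act_def path_res_def)
next
  fix g h x
  assume g: "g \<in> Arr G" and h: "h \<in> Arr G" and x: "x \<in> Arr (free_category \<G>)"
    and gh: "Dom G g = Ran G h" and hx: "Dom G h = fst (Ran (free_category \<G>) x)"
  obtain v p u where p: "x = (v, p, u)" by (cases x)
  note mul = list_act_mul[of v p u g h] and closed = list_act_closed[of v p u h]
  have "Dom G (list_res (list_act p h) g) = Ran G (list_res p h)"
    using list_act_closed[of "Ran G h" "list_act p h" "Ran G (list_res p h)" g] closed g h gh hx x p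
    by simp
  moreover have "list_res (list_act p h) g \<in> Arr G"
    using list_act_closed[of "Ran G h" "list_act p h" "Ran G (list_res p h)" g] closed g h gh hx x p
    by simp
  ultimately show "path_act (g \<cdot>\<^bsub>G\<^esub> h) x = path_act g (path_act h x)"
    "path_res (g \<cdot>\<^bsub>G\<^esub> h) x = path_res g (path_act h x) \<cdot>\<^bsub>G\<^esub> path_res h x"
    using mul closed g h gh hx x p by (simp_all add: path_act_def path_res_def G.ran_mul)
next
  fix g x y
  assume g: "g \<in> Arr G" and x: "x \<in> Arr (free_category \<G>)" and y: "y \<in> Arr (free_category \<G>)"
    and xy: "Dom (free_category \<G>) x = Ran (free_category \<G>) y"
    and gx: "Dom G g = fst (Ran (free_category \<G>) x)"
  obtain v p u where p: "x = (v, p, u)" by (cases x)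
  obtain w q z where q: "y = (w, q, z)" by (cases y)
  show "path_res g (x \<cdot>\<^bsub>free_category \<G>\<^esub> y) = path_res (path_res g x) y"
    "path_act g (x \<cdot>\<^bsub>free_category \<G>\<^esub> y) = path_act g x \<cdot>\<^bsub>free_category \<G>\<^esub> path_act (path_res g x) y"
    using p q by (simp_all add: path_act_def path_res_def list_act_append list_res_append)
next
  fix g x x'
  assume "g \<in> Arr G" "x \<in> Obj (free_category \<G>)" "x' \<in> Obj (free_category \<G>)"
    "fst x = Dom G g" "fst x' = Ran G g"
  then show "path_act g x = x'"
    by (auto simp: Obj_free path_act_def)
next
  fix g x
  assume "g \<in> Arr G" "x \<in> Obj (free_category \<G>)" "fst x = Dom G g"
  then show "path_res g x = g"
    by (auto simp: Obj_free path_res_def)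
qed (simp_all add: path_act_simps)

end


section \<open>HNN-extensions with associated subgroups\<close>

locale hnn_subgroups = G: groupoid G + hnn_presentation G K R \<epsilon> I H \<alpha> e f
  for G :: "'g arrow_cat"
    and K :: "('g, 'k) pre_digraph" and R :: "(('g, 'k) path \<times> ('g, 'k) path) set"
    and \<epsilon> :: "('g, 'k) path set \<Rightarrow> 'g"
    and I :: "'i set" and H :: "'i \<Rightarrow> 'g set" and \<alpha> :: "'i \<Rightarrow> 'g \<Rightarrow> 'g" and e f :: "'i \<Rightarrow> 'g" +
  assumes subgroups: "i \<in> I \<Longrightarrow> is_subgroup_of_groupoid (H i) G"
begin

lemma e_f_simps:
  assumes "i \<in> I"
  shows "e i \<in> Arr G" "Dom G (e i) = e i" "Ran G (e i) = e i"
    "f i \<in> Arr G" "Dom G (f i) = f i" "Ran G (f i) = f i"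
  using G.ObjD[OF e_Obj[OF assms]] G.ObjD[OF f_Obj[OF assms]] by simp_all

lemma H_closed:
  assumes "i \<in> I"
  shows "e i \<in> H i" "\<lbrakk>x \<in> H i; y \<in> H i\<rbrakk> \<Longrightarrow> x \<cdot>\<^bsub>G\<^esub> y \<in> H i" "x \<in> H i \<Longrightarrow> G.ginv x \<in> H i"
proof -
  have mon: "submonoid (H i) (local_monoid G (e i))"
    using data assms by (simp add: hnn_data_def)
  then show eH: "e i \<in> H i" and "\<lbrakk>x \<in> H i; y \<in> H i\<rbrakk> \<Longrightarrow> x \<cdot>\<^bsub>G\<^esub> y \<in> H i"
    by (auto simp: submonoid_def local_monoid_def)
  obtain c where c: "c \<in> Obj G" "subgroup (H i) (local_monoid G c)"
    using subgroups[OF assms] by (auto simp: is_subgroup_of_groupoid_def)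
  then show "x \<in> H i \<Longrightarrow> G.ginv x \<in> H i"
    using G.subgroup_local_monoid_iff[OF c(1)] by blast
qed

lemma functor_\<alpha>: "i \<in> I \<Longrightarrow> cat_functor (G\<lparr>Arr := H i\<rparr>) G (\<alpha> i)"
  using data by (simp add: hnn_data_def)

lemma \<alpha>_mul: "\<lbrakk>i \<in> I; x \<in> H i; y \<in> H i\<rbrakk> \<Longrightarrow> \<alpha> i (x \<cdot>\<^bsub>G\<^esub> y) = \<alpha> i x \<cdot>\<^bsub>G\<^esub> \<alpha> i y"
  using cat_functorD(6)[OF functor_\<alpha>, of i x y] by (simp add: H_local)

lemma \<alpha>_e: "i \<in> I \<Longrightarrow> \<alpha> i (e i) = f i"
  using cat_functorD(4)[OF functor_\<alpha>, of i "e i"] H_local(5)[of i "e i"]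
  by (simp add: H_closed e_f_simps)

definition coset :: "'i \<Rightarrow> 'g \<Rightarrow> 'g set" where
  "coset i g = {g \<cdot>\<^bsub>G\<^esub> h | h. h \<in> H i}"

text \<open>
A representative of the coset \<open>g H\<^sub>i\<close>. For \<open>H\<^sub>i\<close> itself it is the identity \<open>e i\<close>, so that the edge
\<open>(e i, i)\<close> exists and has stabilizer \<open>H\<^sub>i\<close>; it stands for the stable letter \<open>t\<^sub>i\<close>.
\<close>
definition rep :: "'i \<Rightarrow> 'g \<Rightarrow> 'g" where
  "rep i g = (SOME r. r \<in> coset i g \<and> (e i \<in> coset i g \<longrightarrow> r = e i))"

text \<open>
The element of \<open>H\<^sub>i\<close> with \<open>g = rep i g \<cdot> \<delta> i g\<close>.
\<close>
definition \<delta> :: "'i \<Rightarrow> 'g \<Rightarrow> 'g" where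
  "\<delta> i g = G.ginv (rep i g) \<cdot>\<^bsub>G\<^esub> g"

lemma coset_self:
  assumes "i \<in> I" "g \<in> Arr G" "Dom G g = e i"
  shows "g \<in> coset i g"
  unfolding coset_def mem_Collect_eq
  using G.mul_dom[OF assms(2)] assms(3) H_closed(1)[OF assms(1)] by (intro exI[of _ "e i"]) simp

lemma rep_in_coset:
  assumes "i \<in> I" "g \<in> Arr G" "Dom G g = e i"
  shows "rep i g \<in> coset i g" "e i \<in> coset i g \<Longrightarrow> rep i g = e i"
proof -
  have "\<exists>r. r \<in> coset i g \<and> (e i \<in> coset i g \<longrightarrow> r = e i)"
    using coset_self[OF assms] by blast
  then have "rep i g \<in> coset i g \<and> (e i \<in> coset i g \<longrightarrow> rep i g = e i)"
    unfolding rep_def by (rule someI_ex)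
  then show "rep i g \<in> coset i g" "e i \<in> coset i g \<Longrightarrow> rep i g = e i"
    by blast+
qed

lemma coset_mul:
  assumes "i \<in> I" "g \<in> Arr G" "Dom G g = e i" "h \<in> H i"
  shows "coset i (g \<cdot>\<^bsub>G\<^esub> h) = coset i g"
proof -
  have sub: "coset i (g \<cdot>\<^bsub>G\<^esub> h) \<subseteq> coset i g" if "g \<in> Arr G" "Dom G g = e i" "h \<in> H i" for g h
  proof
    fix x assume "x \<in> coset i (g \<cdot>\<^bsub>G\<^esub> h)"
    then obtain k where k: "k \<in> H i" "x = g \<cdot>\<^bsub>G\<^esub> h \<cdot>\<^bsub>G\<^esub> k"
      by (auto simp: coset_def)
    then have "x = g \<cdot>\<^bsub>G\<^esub> (h \<cdot>\<^bsub>G\<^esub> k)"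
      using that H_local[OF assms(1)] by (simp add: G.mul_assoc)
    then show "x \<in> coset i g"
      using H_closed(2)[OF assms(1) that(3) k(1)] by (auto simp: coset_def)
  qed
  note h = H_local[OF assms(1,4)]
  have "g \<cdot>\<^bsub>G\<^esub> h \<cdot>\<^bsub>G\<^esub> G.ginv h = g"
    using h assms G.mul_dom[of g] by (simp add: G.mul_assoc G.inverse_simps)
  then have "coset i g \<subseteq> coset i (g \<cdot>\<^bsub>G\<^esub> h)"
    using sub[of "g \<cdot>\<^bsub>G\<^esub> h" "G.ginv h"] h assms H_closed(3)[OF assms(1,4)]
    by (simp add: G.mul_closed G.dom_mul)
  then show ?thesis
    using sub[OF assms(2-4)] by blast
qed

text \<open>
The choice in \<open>rep\<close> refers to \<open>g\<close> only through its coset.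
\<close>
lemma rep_mul:
  assumes "i \<in> I" "g \<in> Arr G" "Dom G g = e i" "h \<in> H i"
  shows "rep i (g \<cdot>\<^bsub>G\<^esub> h) = rep i g"
  unfolding rep_def coset_mul[OF assms] ..

lemma rep_eq_mul:
  assumes "i \<in> I" "g \<in> Arr G" "Dom G g = e i"
  obtains h where "h \<in> H i" "rep i g = g \<cdot>\<^bsub>G\<^esub> h"
  using rep_in_coset(1)[OF assms] by (auto simp: coset_def)

lemma rep_simps:
  assumes "i \<in> I" "g \<in> Arr G" "Dom G g = e i"
  shows "rep i g \<in> Arr G" "Dom G (rep i g) = e i" "Ran G (rep i g) = Ran G g"
    "rep i (rep i g) = rep i g"
    "\<delta> i g \<in> H i" "rep i g \<cdot>\<^bsub>G\<^esub> \<delta> i g = g"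
proof -
  obtain h where h: "h \<in> H i" "rep i g = g \<cdot>\<^bsub>G\<^esub> h"
    using rep_eq_mul[OF assms] .
  note loc = H_local[OF assms(1) h(1)]
  show r: "rep i g \<in> Arr G" "Dom G (rep i g) = e i" "Ran G (rep i g) = Ran G g"
    using h(2) loc assms by (simp_all add: G.arrow_simps)
  show "rep i (rep i g) = rep i g"
    using rep_mul[OF assms h(1)] h(2) by simp
  show "rep i g \<cdot>\<^bsub>G\<^esub> \<delta> i g = g"
    unfolding \<delta>_def using r assms by (intro G.mul_ginv_cancel) simp_all
  have "rep i g \<cdot>\<^bsub>G\<^esub> G.ginv h = g"
    using h loc assms G.mul_dom[of g] by (simp add: G.mul_assoc G.inverse_simps)
  then have "\<delta> i g = G.ginv (rep i g) \<cdot>\<^bsub>G\<^esub> (rep i g \<cdot>\<^bsub>G\<^esub> G.ginv h)"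
    by (simp add: \<delta>_def)
  also have "\<dots> = G.ginv h"
    using r loc by (intro G.ginv_mul_cancel) (simp_all add: G.inverse_simps)
  finally show "\<delta> i g \<in> H i"
    using H_closed(3)[OF assms(1) h(1)] by simp
qed

lemma rep_mul_left:
  assumes "i \<in> I" "g \<in> Arr G" "h \<in> Arr G" "Dom G h = e i" "Dom G g = Ran G h"
  shows "rep i (g \<cdot>\<^bsub>G\<^esub> rep i h) = rep i (g \<cdot>\<^bsub>G\<^esub> h)"
proof -
  obtain k where k: "k \<in> H i" "rep i h = h \<cdot>\<^bsub>G\<^esub> k"
    using rep_eq_mul[OF assms(1,3,4)] .
  then show ?thesis
    using rep_mul[OF assms(1) _ _ k(1), of "g \<cdot>\<^bsub>G\<^esub> h"] assms H_local[OF assms(1) k(1)]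
    by (simp add: G.arrow_simps)
qed

text \<open>
The cocycle identity behind (SS7) for the action on cosets.
\<close>
lemma \<delta>_mul_left:
  assumes "i \<in> I" "g \<in> Arr G" "h \<in> Arr G" "Dom G h = e i" "Dom G g = Ran G h"
  shows "\<delta> i (g \<cdot>\<^bsub>G\<^esub> h) = \<delta> i (g \<cdot>\<^bsub>G\<^esub> rep i h) \<cdot>\<^bsub>G\<^esub> \<delta> i h"
proof -
  note h = rep_simps[OF assms(1,3,4)]
  note loc = H_local[OF assms(1) h(5)]
  have gh: "g \<cdot>\<^bsub>G\<^esub> h \<in> Arr G" "Dom G (g \<cdot>\<^bsub>G\<^esub> h) = e i" "Ran G (g \<cdot>\<^bsub>G\<^esub> h) = Ran G g"
    using assms by (simp_all add: G.arrow_simps)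
  note r = rep_simps[OF assms(1) gh(1,2)]
  have "\<delta> i (g \<cdot>\<^bsub>G\<^esub> rep i h) \<cdot>\<^bsub>G\<^esub> \<delta> i h = G.ginv (rep i (g \<cdot>\<^bsub>G\<^esub> h)) \<cdot>\<^bsub>G\<^esub> (g \<cdot>\<^bsub>G\<^esub> (rep i h \<cdot>\<^bsub>G\<^esub> \<delta> i h))"
    unfolding \<delta>_def[of i "g \<cdot>\<^bsub>G\<^esub> rep i h"] rep_mul_left[OF assms]
    using r(1-3) gh h(1-3) loc assms
    by (simp add: G.mul_assoc G.mul_closed G.dom_mul G.ran_mul G.ginv_closed G.dom_ginv G.ran_ginv)
  then show ?thesis
    using h(6) by (simp add: \<delta>_def)
qed

text \<open>
The edge \<open>(r, i)\<close> stands for the product \<open>r t\<^sub>i\<close>.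
\<close>
definition coset_graph :: "('g, 'g \<times> 'i) pre_digraph" where
  "coset_graph =
     \<lparr> verts = Obj G,
       arcs = {(r, i). i \<in> I \<and> r \<in> Arr G \<and> Dom G r = e i \<and> rep i r = r},
       tail = (\<lambda>(r, i). f i),
       head = (\<lambda>(r, i). Ran G r) \<rparr>"

text \<open>
With \<open>r' = rep i (g r)\<close> and \<open>h = \<delta> i (g r)\<close> one has \<open>g (r t\<^sub>i) = r' h t\<^sub>i = (r' t\<^sub>i) \<alpha>\<^sub>i(h)\<close>: the first factor is
the result of the action, the second the restriction.
\<close>
definition coset_act :: "'g \<Rightarrow> 'g \<times> 'i \<Rightarrow> 'g \<times> 'i" where
  "coset_act g = (\<lambda>(r, i). (rep i (g \<cdot>\<^bsub>G\<^esub> r), i))"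

definition coset_res :: "'g \<Rightarrow> 'g \<times> 'i \<Rightarrow> 'g" where
  "coset_res g = (\<lambda>(r, i). \<alpha> i (\<delta> i (g \<cdot>\<^bsub>G\<^esub> r)))"

lemma coset_graph_simps [simp]:
  "verts coset_graph = Obj G"
  "(r, i) \<in> arcs coset_graph \<longleftrightarrow> i \<in> I \<and> r \<in> Arr G \<and> Dom G r = e i \<and> rep i r = r"
  "tail coset_graph (r, i) = f i" "head coset_graph (r, i) = Ran G r"
  by (simp_all add: coset_graph_def)

lemma wf_coset_graph: "wf_digraph coset_graph"
  by unfold_locales (auto simp: f_Obj G.Ran_in_Obj)

lemma self_similar_graph_cosets: "self_similar_graph G coset_graph coset_act coset_res"
proof (intro self_similar_graph.intro self_similar_graph_axioms.intro G.groupoid_axioms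
    wf_coset_graph)
  show "verts coset_graph = Obj G" by simp
next
  fix a assume "a \<in> arcs coset_graph"
  then obtain r i where a: "a = (r, i)" "i \<in> I" "r \<in> Arr G" "Dom G r = e i" "rep i r = r"
    by (cases a) auto
  have "\<delta> i r = e i"
    using a by (simp add: \<delta>_def G.inverse_simps)
  then show "coset_act (head coset_graph a) a = a" "coset_res (head coset_graph a) a = tail coset_graph a"
    using a by (simp_all add: coset_act_def coset_res_def G.ran_mul_self \<alpha>_e)
next
  fix g a assume g: "g \<in> Arr G" and "a \<in> arcs coset_graph" and ga: "Dom G g = head coset_graph a"
  then obtain r i where a: "a = (r, i)" "i \<in> I" "r \<in> Arr G" "Dom G r = e i"
    by (cases a) auto
  have gr: "g \<cdot>\<^bsub>G\<^esub> r \<in> Arr G" "Dom G (g \<cdot>\<^bsub>G\<^esub> r) = e i" "Ran G (g \<cdot>\<^bsub>G\<^esub> r) = Ran G g"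
    using a g ga by (simp_all add: G.arrow_simps)
  note rep = rep_simps[OF a(2) gr(1,2)]
  show "coset_act g a \<in> arcs coset_graph" "head coset_graph (coset_act g a) = Ran G g" "coset_res g a \<in> Arr G"
    "Dom G (coset_res g a) = tail coset_graph a" "Ran G (coset_res g a) = tail coset_graph (coset_act g a)"
    using a rep gr H_local[OF a(2) rep(5)] by (simp_all add: coset_act_def coset_res_def)
  fix h assume h: "h \<in> Arr G" and hg: "Dom G h = Ran G g"
  have assoc: "h \<cdot>\<^bsub>G\<^esub> g \<cdot>\<^bsub>G\<^esub> r = h \<cdot>\<^bsub>G\<^esub> (g \<cdot>\<^bsub>G\<^esub> r)"
    using a g ga h hg by (intro G.mul_assoc) simp_all
  show "coset_act (h \<cdot>\<^bsub>G\<^esub> g) a = coset_act h (coset_act g a)"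
    using rep_mul_left[OF a(2) h gr(1,2)] hg gr(3) a(1) by (simp add: coset_act_def assoc)
  have "h \<cdot>\<^bsub>G\<^esub> rep i (g \<cdot>\<^bsub>G\<^esub> r) \<in> Arr G" "Dom G (h \<cdot>\<^bsub>G\<^esub> rep i (g \<cdot>\<^bsub>G\<^esub> r)) = e i"
    using h hg rep(1-3) gr(3) by (simp_all add: G.mul_closed G.dom_mul)
  then show "coset_res (h \<cdot>\<^bsub>G\<^esub> g) a = coset_res h (coset_act g a) \<cdot>\<^bsub>G\<^esub> coset_res g a"
    using \<delta>_mul_left[OF a(2) h gr(1,2)] hg gr(3) a(1) \<alpha>_mul[OF a(2)] rep(5) rep_simps(5)[OF a(2)]
    by (simp add: coset_act_def coset_res_def assoc)
qed

sublocale cosets: self_similar_graph G coset_graph coset_act coset_res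
  by (rule self_similar_graph_cosets)

lemma free_self_similar_action_cosets:
  "free_self_similar_action G coset_graph fst cosets.path_act cosets.path_res"
  by (intro free_self_similar_action.intro wf_coset_graph cosets.self_similar_action_paths)

lemma rep_eq_e_iff:
  assumes "i \<in> I" "g \<in> Arr G" "Dom G g = e i"
  shows "rep i g = e i \<longleftrightarrow> g \<in> H i"
proof
  assume "rep i g = e i"
  then have "g = \<delta> i g"
    using rep_simps(5,6)[OF assms] H_local[OF assms(1), of "\<delta> i g"] G.ran_mul_self[of "\<delta> i g"]
    by simp
  then show "g \<in> H i"
    using rep_simps(5)[OF assms] by simp
next
  assume g: "g \<in> H i"
  then have "g \<cdot>\<^bsub>G\<^esub> G.ginv g \<in> coset i g"
    using H_closed(3)[OF assms(1)] by (auto simp: coset_def)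
  then show "rep i g = e i"
    using rep_in_coset(2)[OF assms] H_local[OF assms(1) g] by (simp add: G.mul_ginv)
qed

lemma cosets_edge:
  assumes "i \<in> I" "g \<in> Arr G" "Dom G g = e i"
  shows "cosets.path_act g (edge_path coset_graph (e i, i)) = edge_path coset_graph (rep i g, i)"
    "cosets.path_res g (edge_path coset_graph (e i, i)) = \<alpha> i (\<delta> i g)"
  using assms G.mul_dom[OF assms(2)] rep_simps[OF assms] H_local[OF assms(1), of "\<delta> i g"]
  by (simp_all add: cosets.path_act_def cosets.path_res_def coset_act_def coset_res_def)

text \<open>
The edges \<open>(r, i)\<close> with a fixed \<open>i\<close> form the orbit of \<open>(e i, i)\<close>, since \<open>r\<close> carries the latter to \<open>(r, i)\<close>.
On its stabilizer \<open>H\<^sub>i\<close>, the restriction is \<open>\<alpha>\<^sub>i\<close> because \<open>\<delta> i g = g\<close> for \<open>g \<in> H\<^sub>i\<close>.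
\<close>
lemma hnn_transversal_cosets:
  "hnn_transversal G K R \<epsilon> I H \<alpha> e f coset_graph fst cosets.path_act cosets.path_res (\<lambda>i. (e i, i))"
proof (intro hnn_transversal.intro hnn_transversal_axioms.intro free_self_similar_action_cosets
    hnn_presentation_axioms)
  fix i assume i: "i \<in> I"
  have e: "rep i (e i) = e i"
    using rep_eq_e_iff[OF i] e_f_simps[OF i] H_closed(1)[OF i] by simp
  show "(e i, i) \<in> arcs coset_graph"
    "fst (head coset_graph (e i, i), [], head coset_graph (e i, i)) = e i"
    "fst (tail coset_graph (e i, i), [], tail coset_graph (e i, i)) = f i"
    using i e e_f_simps[OF i] by simp_all
  have "g \<in> H i \<longleftrightarrow> g \<in> Arr G \<and> Dom G g = e i
      \<and> cosets.path_act g (edge_path coset_graph (e i, i)) = edge_path coset_graph (e i, i)" for g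
    using cosets_edge(1)[OF i, of g] rep_eq_e_iff[OF i, of g] H_local(1,2)[OF i, of g] by auto
  then show "H i = {g \<in> Arr G. Dom G g = e i
      \<and> cosets.path_act g (edge_path coset_graph (e i, i)) = edge_path coset_graph (e i, i)}"
    by blast
  fix g assume g: "g \<in> H i"
  have "\<delta> i g = g"
    using rep_simps(6)[OF i H_local(1,2)[OF i g]] rep_eq_e_iff[OF i H_local(1,2)[OF i g]] g
      H_local[OF i rep_simps(5)[OF i H_local(1,2)[OF i g]]] G.ran_mul_self[of "\<delta> i g"]
    by simp
  then show "\<alpha> i g = cosets.path_res g (edge_path coset_graph (e i, i))"
    using cosets_edge(2)[OF i H_local(1,2)[OF i g]] by simp
next
  fix a assume "a \<in> arcs coset_graph"
  then obtain r i where a: "a = (r, i)" "i \<in> I" "r \<in> Arr G" "Dom G r = e i" "rep i r = r"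
    by (cases a) auto
  then show "\<exists>i \<in> I. \<exists>g \<in> Arr G. Dom G g = e i
      \<and> cosets.path_act g (edge_path coset_graph (e i, i)) = edge_path coset_graph a"
    using cosets_edge(1)[OF a(2-4)] by metis
next
  fix i i' g
  assume "i \<in> I" "g \<in> Arr G" "Dom G g = e i"
    "cosets.path_act g (edge_path coset_graph (e i, i)) = edge_path coset_graph (e i', i')"
  then show "i = i'"
    using cosets_edge(1)[of i g] by simp
qed

theorem ex_free_zappa_szep:
  "\<exists>(\<G> :: ('g, 'g \<times> 'i) pre_digraph) j act res. free_self_similar_action G \<G> j act res
     \<and> isomorphic_cats N (zappa_szep G (free_category \<G>) j act res)"
  using free_self_similar_action_cosets
    hnn_transversal.hnn_isomorphic_zappa_szep[OF hnn_transversal_cosets] by blast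

end

section \<open>The characterisation\<close>

theorem theorem3p3p1:
  fixes G :: "'g arrow_cat" and M :: "'m arrow_cat"
  assumes "groupoid G" and "category M"
  shows
    "(\<forall>(K :: ('g, 'k) pre_digraph) R \<epsilon> (I :: 'i set) H \<alpha> e f.
        is_hnn_extension M G K R \<epsilon> I H \<alpha> e f
        \<and> (\<forall>i \<in> I. is_subgroup_of_groupoid (H i) G)
        \<longrightarrow> left_Rees_category M
            \<and> (\<exists>(\<G> :: ('g, 'g \<times> 'i) pre_digraph) j act res.
                  is_free_zappa_szep M G \<G> j act res))
     \<and>
     (\<forall>(\<G> :: ('v, 'e) pre_digraph) j act res.
        left_Rees_category M \<and> is_free_zappa_szep M G \<G> j act res
        \<longrightarrow> (\<exists>(K :: ('g, 'g) pre_digraph) R \<epsilon> (I :: 'e set) H \<alpha> e f.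
              is_hnn_extension M G K R \<epsilon> I H \<alpha> e f
              \<and> (\<forall>i \<in> I. is_subgroup_of_groupoid (H i) G)))"
proof (intro conjI allI impI)
  fix K :: "('g, 'k) pre_digraph" and R \<epsilon> and I :: "'i set" and H \<alpha> e f
  assume *: "is_hnn_extension M G K R \<epsilon> I H \<alpha> e f \<and> (\<forall>i \<in> I. is_subgroup_of_groupoid (H i) G)"
  then have "hnn_subgroups G K R \<epsilon> I H \<alpha> e f"
    using assms(1)
    by (simp add: is_hnn_extension_def hnn_subgroups_def hnn_subgroups_axioms_def
        hnn_presentation_def hnn_presentation_axioms_def groupoid_def)
  then obtain \<G> :: "('g, 'g \<times> 'i) pre_digraph" and j act res
    where act: "free_self_similar_action G \<G> j act res"
      and iso: "isomorphic_cats (hnn_category K R \<epsilon> I H \<alpha> e f)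
        (zappa_szep G (free_category \<G>) j act res)"
    using hnn_subgroups.ex_free_zappa_szep by blast
  then interpret A: free_self_similar_action G \<G> j act res
    by simp
  have M: "isomorphic_cats M A.Z"
    using * iso isomorphic_cats_trans unfolding is_hnn_extension_def by blast
  then show "left_Rees_category M"
    using left_Rees_category_iso A.left_Rees_zappa_szep unfolding isomorphic_cats_def by blast
  show "\<exists>(\<G> :: ('g, 'g \<times> 'i) pre_digraph) j act res. is_free_zappa_szep M G \<G> j act res"
    using M A.wf_digraph_axioms A.self_similar_action_axioms
    unfolding is_free_zappa_szep_def by blast
next
  fix \<G> :: "('v, 'e) pre_digraph" and j act res
  assume "left_Rees_category M \<and> is_free_zappa_szep M G \<G> j act res"
  then have *: "free_self_similar_action G \<G> j act res"
      "isomorphic_cats M (zappa_szep G (free_category \<G>) j act res)"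
    by (simp_all add: is_free_zappa_szep_def free_self_similar_action_def)
  interpret A: free_self_similar_action G \<G> j act res
    by (rule *(1))
  obtain K :: "('g, 'g) pre_digraph" and R \<epsilon> and I :: "'e set" and H \<alpha> e f
    where "category_presentation G K R \<epsilon>" "hnn_data G I H \<alpha> e f"
      and iso: "isomorphic_cats A.Z (hnn_category K R \<epsilon> I H \<alpha> e f)"
      and sub: "\<forall>i \<in> I. is_subgroup_of_groupoid (H i) G"
    using A.ex_hnn_extension by blast
  then have "is_hnn_extension M G K R \<epsilon> I H \<alpha> e f"
    using isomorphic_cats_trans[OF *(2) iso] unfolding is_hnn_extension_def by blast
  then show "\<exists>(K :: ('g, 'g) pre_digraph) R \<epsilon> (I :: 'e set) H \<alpha> e f.
      is_hnn_extension M G K R \<epsilon> I H \<alpha> e f \<and> (\<forall>i \<in> I. is_subgroup_of_groupoid (H i) G)"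
    using sub by blast
qed

end
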